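(* Let $\pi\colon B\to M$ be a semi-principal $G$-bundle and $\omega$ a $G$-connection on $B$. Given any piece-wise smooth curve $\gamma\colon[0,1]\to M$ and an initial point $b\in B$ above $\gamma(0)$, there is a unique horizontal lift $\Gamma\colon[0,1]\to B$ through $b$, specified by $\pi\circ\Gamma=\gamma$ and $\Gamma(0)=b$. Moreover, the parallel transport maps are $G$-equivariant: for every $g\in G$, the horizontal lift of $\gamma$ starting from $gb$ is $g\Gamma$.
   Context: A $G$-manifold is a manifold with a smooth left $G$-action ($G$ a finite-dimensional Lie group with Lie algebra $\mathfrak g$). A $G$-semi-torsor is a $G$-manifold $F$ whose action is free and whose orbit space $F/G$ is discrete. A semi-principal $G$-bundle over $M$ with model fiber a $G$-semi-torsor $F$ is a smooth fiber bundle $\pi\colon B\to M$ with a fiber-preserving smooth left $G$-action, admitting around each point of $M$ local trivializations $\phi\colon U\times F\to\pi^{-1}(U)$ with $\pi\circ\phi=\mathrm{pr}_U$ that restrict to isomorphisms of $G$-manifolds $F\to B_u$ for all $u\in U$. For a $G$-manifold $B$ write $L_g\colon B\to B$ for the action of $g$ and $a_b\colon\mathfrak g\to T_bB$ for the infinitesimal action, i.e. the differential at $e$ of $g\mapsto gb$. A $G$-connection on $B$ is a $\mathfrak g$-valued 1-form $\omega$ on $B$ such that $\omega_b\circ a_b=\mathrm{id}_{\mathfrak g}$ for all $b\in B$ and $(L_g)^*\omega=\mathrm{Ad}_g(\omega)$ for all $g\in G$. A (piece-wise smooth) curve $\Gamma$ in $B$ is horizontal if $\omega(\dot\Gamma)=0$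 wherever $\dot\Gamma$ is defined. *)

theory Defs
  imports "HOL-Analysis.Analysis" "HOL-Algebra.Group_Action"
begin

section \<open>Model spaces\<close>

text \<open>
  Manifolds are modelled on finite-dimensional inner product spaces. The library class
  \<^class>\<open>euclidean_space\<close> excludes dimension 0, and with it discrete Lie groups. The following
  class has the same axioms, except that the orthonormal basis may be empty.
\<close>

class findim_inner = real_inner +
  assumes finite_orthonormal_basis:
    "\<exists>B. finite B \<and> (\<forall>u\<in>B. \<forall>v\<in>B. inner u v = (if u = v then 1 else 0)) \<and>
      (\<forall>x. (\<forall>u\<in>B. inner x u = 0) \<longleftrightarrow> x = 0)"

instance euclidean_space \<subseteq> findim_inner
proof
  show "\<exists>B :: 'a set. finite B \<and> (\<forall>u\<in>B. \<forall>v\<in>B. inner u v = (if u = v then 1 else 0)) \<and>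
      (\<forall>x. (\<forall>u\<in>B. inner x u = 0) \<longleftrightarrow> x = 0)"
    by (rule exI[of _ Basis]) (auto simp: inner_Basis euclidean_all_zero_iff)
qed

instantiation unit :: real_inner
begin

definition zero_unit :: unit where "zero_unit = ()"
definition plus_unit :: "unit \<Rightarrow> unit \<Rightarrow> unit" where "plus_unit x y = ()"
definition minus_unit :: "unit \<Rightarrow> unit \<Rightarrow> unit" where "minus_unit x y = ()"
definition uminus_unit :: "unit \<Rightarrow> unit" where "uminus_unit x = ()"
definition scaleR_unit :: "real \<Rightarrow> unit \<Rightarrow> unit" where "scaleR_unit r x = ()"
definition sgn_unit :: "unit \<Rightarrow> unit" where "sgn_unit x = ()"
definition norm_unit :: "unit \<Rightarrow> real" where "norm_unit x = 0"
definition dist_unit :: "unit \<Rightarrow> unit \<Rightarrow> real" where "dist_unit x y = 0"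
definition inner_unit :: "unit \<Rightarrow> unit \<Rightarrow> real" where "inner_unit x y = 0"
definition uniformity_unit :: "(unit \<times> unit) filter"
  where "uniformity_unit = (INF e\<in>{0<..}. principal {(x, y). dist x y < e})"
definition open_unit :: "unit set \<Rightarrow> bool"
  where "open_unit U \<longleftrightarrow> (\<forall>x\<in>U. eventually (\<lambda>(x', y). x' = x \<longrightarrow> y \<in> U) uniformity)"

instance
  by standard (simp_all add: dist_unit_def norm_unit_def inner_unit_def uniformity_unit_def
      open_unit_def)

end

instance unit :: findim_inner
  by standard (rule exI[of _ "{}"], simp)


section \<open>Smooth manifolds\<close>

text \<open>
  For open \<open>S\<close> in a finite-dimensional space, \<open>Ck_on k S f\<close> says that \<open>f\<close> is of class \<open>C\<^sup>k\<close>
  on \<open>S\<close>: it is differentiable and each directional derivative is of class \<open>C\<^sup>k\<^sup>-\<^sup>1\<close>.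
\<close>

primrec Ck_on ::
  "nat \<Rightarrow> 'a::real_normed_vector set \<Rightarrow> ('a \<Rightarrow> 'b::real_normed_vector) \<Rightarrow> bool" where
  "Ck_on 0 S f \<longleftrightarrow> continuous_on S f"
| "Ck_on (Suc k) S f \<longleftrightarrow>
     (\<forall>x\<in>S. f differentiable (at x)) \<and> (\<forall>v. Ck_on k S (\<lambda>x. frechet_derivative f (at x) v))"

definition smooth_on ::
  "'a::real_normed_vector set \<Rightarrow> ('a \<Rightarrow> 'b::real_normed_vector) \<Rightarrow> bool" where
  "smooth_on S f \<longleftrightarrow> (\<forall>k. Ck_on k S f)"

type_synonym ('a, 'e) chart = "'a set \<times> ('a \<Rightarrow> 'e)"

text \<open>
  The atlas need not be maximal. The values of a chart outside its domain and of a map between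
  manifolds outside the underlying space of its source are irrelevant.
\<close>

record ('a, 'e) manifold =
  topo :: "'a topology"
  atlas :: "('a, 'e) chart set"

abbreviation points :: "('a, 'e) manifold \<Rightarrow> 'a set" where
  "points M \<equiv> topspace (topo M)"

definition smooth_manifold :: "('a, 'e::findim_inner) manifold \<Rightarrow> bool" where
  "smooth_manifold M \<longleftrightarrow>
     Hausdorff_space (topo M) \<and> second_countable (topo M) \<and>
     (\<Union>(U, x)\<in>atlas M. U) = points M \<and>
     (\<forall>(U, x)\<in>atlas M. openin (topo M) U \<and> open (x ` U) \<and>
        homeomorphic_map (subtopology (topo M) U) (top_of_set (x ` U)) x) \<and>
     (\<forall>(U, x)\<in>atlas M. \<forall>(V, y)\<in>atlas M. smooth_on (x ` (U \<inter> V)) (y \<circ> inv_into U x))"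

definition smooth_map ::
  "('a, 'd::real_normed_vector) manifold \<Rightarrow> ('b, 'e::real_normed_vector) manifold \<Rightarrow> ('a \<Rightarrow> 'b) \<Rightarrow> bool"
  where
  "smooth_map M N f \<longleftrightarrow>
     continuous_map (topo M) (topo N) f \<and>
     (\<forall>(U, x)\<in>atlas M. \<forall>(V, y)\<in>atlas N.
        smooth_on (x ` (U \<inter> f -` V)) (y \<circ> f \<circ> inv_into U x))"

definition diffeomorphism ::
  "('a, 'd::real_normed_vector) manifold \<Rightarrow> ('b, 'e::real_normed_vector) manifold \<Rightarrow> ('a \<Rightarrow> 'b) \<Rightarrow> bool"
  where
  "diffeomorphism M N f \<longleftrightarrow>
     smooth_map M N f \<and> bij_betw f (points M) (points N) \<and>
     smooth_map N M (inv_into (points M) f)"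

definition prod_manifold ::
  "('a, 'd) manifold \<Rightarrow> ('b, 'e) manifold \<Rightarrow> ('a \<times> 'b, 'd \<times> 'e) manifold" where
  "prod_manifold M N =
     \<lparr>topo = prod_topology (topo M) (topo N),
      atlas = {(U \<times> V, map_prod x y) |U x V y. (U, x) \<in> atlas M \<and> (V, y) \<in> atlas N}\<rparr>"

definition open_submanifold :: "('a, 'e) manifold \<Rightarrow> 'a set \<Rightarrow> ('a, 'e) manifold" where
  "open_submanifold M W =
     \<lparr>topo = subtopology (topo M) W, atlas = {(U \<inter> W, x) |U x. (U, x) \<in> atlas M}\<rparr>"


section \<open>Tangent vectors\<close>

text \<open>
  We choose one chart of the atlas around each point \<open>p\<close>; the differential of this chart at \<open>p\<close>
  identifies the tangent space at \<open>p\<close> with the model space. Thus a tangent vector at \<open>p\<close> is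
  an element of the model space, namely its coordinate vector in \<open>chart_at M p\<close>.
\<close>

definition chart_at :: "('a, 'e) manifold \<Rightarrow> 'a \<Rightarrow> ('a, 'e) chart" where
  "chart_at M p = (SOME c. c \<in> atlas M \<and> p \<in> fst c)"

abbreviation coord_at :: "('a, 'e) manifold \<Rightarrow> 'a \<Rightarrow> 'a \<Rightarrow> 'e" where
  "coord_at M p \<equiv> snd (chart_at M p)"

text \<open>The tangent vector at \<open>p\<close> whose coordinate vector in an arbitrary chart is \<open>v\<close>\<close>

fun tangent_of_coords ::
  "('a, 'e::real_normed_vector) manifold \<Rightarrow> ('a, 'e) chart \<Rightarrow> 'a \<Rightarrow> 'e \<Rightarrow> 'e" where
  "tangent_of_coords M (U, x) p v =
     frechet_derivative (coord_at M p \<circ> inv_into U x) (at (x p)) v"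

definition differential ::
  "('a, 'd::real_normed_vector) manifold \<Rightarrow> ('b, 'e::real_normed_vector) manifold \<Rightarrow>
   ('a \<Rightarrow> 'b) \<Rightarrow> 'a \<Rightarrow> 'd \<Rightarrow> 'e" where
  "differential M N f p =
     frechet_derivative (coord_at N (f p) \<circ> f \<circ> inv_into (fst (chart_at M p)) (coord_at M p))
       (at (coord_at M p p))"

text \<open>A smooth 1-form on \<open>M\<close> with values in the vector space \<open>'v\<close>\<close>

definition one_form ::
  "('a, 'e::real_normed_vector) manifold \<Rightarrow> ('a \<Rightarrow> 'e \<Rightarrow> 'v::real_normed_vector) \<Rightarrow> bool" where
  "one_form M \<omega> \<longleftrightarrow>
     (\<forall>p\<in>points M. linear (\<omega> p)) \<and>
     (\<forall>(U, x)\<in>atlas M. \<forall>v.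
        smooth_on (x ` U)
          (\<lambda>z. let p = inv_into U x z in \<omega> p (tangent_of_coords M (U, x) p v)))"


section \<open>Curves\<close>

text \<open>
  Smoothness of a curve on a set \<open>I\<close> of reals (below, a closed interval): in a chart, the curve
  extends smoothly to a neighbourhood of each point of \<open>I\<close>, the end points included.
\<close>

definition smooth_curve_on ::
  "('a, 'e::real_normed_vector) manifold \<Rightarrow> real set \<Rightarrow> (real \<Rightarrow> 'a) \<Rightarrow> bool" where
  "smooth_curve_on M I \<gamma> \<longleftrightarrow>
     (\<forall>t\<in>I. \<exists>e>0. \<exists>(U, x)\<in>atlas M. \<exists>c. smooth_on (ball t e) c \<and>
        (\<forall>s\<in>I \<inter> ball t e. \<gamma> s \<in> U \<and> x (\<gamma> s) = c s))"

definition piecewise_smooth_curve ::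
  "('a, 'e::real_normed_vector) manifold \<Rightarrow> (real \<Rightarrow> 'a) \<Rightarrow> bool" where
  "piecewise_smooth_curve M \<gamma> \<longleftrightarrow>
     continuous_map (top_of_set {0..1}) (topo M) \<gamma> \<and>
     (\<exists>n (\<tau> :: nat \<Rightarrow> real). \<tau> 0 = 0 \<and> \<tau> n = 1 \<and>
        (\<forall>i<n. \<tau> i < \<tau> (Suc i) \<and> smooth_curve_on M {\<tau> i..\<tau> (Suc i)} \<gamma>))"

text \<open>The curve has velocity \<open>v\<close> at time \<open>t\<close> (a one-sided one at the two end points)\<close>

definition has_velocity ::
  "('a, 'e::real_normed_vector) manifold \<Rightarrow> (real \<Rightarrow> 'a) \<Rightarrow> real \<Rightarrow> 'e \<Rightarrow> bool" where
  "has_velocity M \<gamma> t v \<longleftrightarrow>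
     ((coord_at M (\<gamma> t) \<circ> \<gamma>) has_vector_derivative v) (at t within {0..1})"


section \<open>Lie groups and their actions\<close>

definition lie_group :: "('g, 'r) monoid_scheme \<Rightarrow> ('g, 'eg::findim_inner) manifold \<Rightarrow> bool" where
  "lie_group G GM \<longleftrightarrow>
     group G \<and> smooth_manifold GM \<and> points GM = carrier G \<and>
     smooth_map (prod_manifold GM GM) GM (\<lambda>(g, h). g \<otimes>\<^bsub>G\<^esub> h) \<and>
     smooth_map GM GM (\<lambda>g. inv\<^bsub>G\<^esub> g)"

definition G_manifold ::
  "('g, 'r) monoid_scheme \<Rightarrow> ('g, 'eg::findim_inner) manifold \<Rightarrow>
   ('b, 'eb::findim_inner) manifold \<Rightarrow> ('g \<Rightarrow> 'b \<Rightarrow> 'b) \<Rightarrow> bool" where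
  "G_manifold G GM B act \<longleftrightarrow>
     lie_group G GM \<and> smooth_manifold B \<and> group_action G (points B) act \<and>
     smooth_map (prod_manifold GM B) B (\<lambda>(g, b). act g b)"

text \<open>
  Freeness is triviality of all stabilizers. The orbit space is discrete if the quotient topology
  on the set of orbits is the discrete one.
\<close>

definition semi_torsor ::
  "('g, 'r) monoid_scheme \<Rightarrow> ('g, 'eg::findim_inner) manifold \<Rightarrow>
   ('f, 'ef::findim_inner) manifold \<Rightarrow> ('g \<Rightarrow> 'f \<Rightarrow> 'f) \<Rightarrow> bool" where
  "semi_torsor G GM F act \<longleftrightarrow>
     G_manifold G GM F act \<and>
     (\<forall>f\<in>points F. stabilizer G act f = {\<one>\<^bsub>G\<^esub>}) \<and>
     quotient_map (topo F) (discrete_topology (orbits G (points F) act)) (orbit G act)"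

text \<open>
  The smooth structure on a fiber \<open>B\<^sub>u\<close> is that of an embedded submanifold, namely the one
  transported along \<open>\<phi>(u, _)\<close>, which does not depend on the diffeomorphism \<open>\<phi>\<close> over \<open>U\<close>.
  So \<open>\<phi>(u, _)\<close> is an isomorphism of \<open>G\<close>-manifolds as soon as it is an equivariant bijection onto
  the fiber.
\<close>

definition semi_principal_bundle ::
  "('g, 'r) monoid_scheme \<Rightarrow> ('g, 'eg::findim_inner) manifold \<Rightarrow>
   ('f, 'ef::findim_inner) manifold \<Rightarrow> ('g \<Rightarrow> 'f \<Rightarrow> 'f) \<Rightarrow>
   ('m, 'em::findim_inner) manifold \<Rightarrow>
   ('b, 'eb::findim_inner) manifold \<Rightarrow> ('g \<Rightarrow> 'b \<Rightarrow> 'b) \<Rightarrow> ('b \<Rightarrow> 'm) \<Rightarrow> bool" where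
  "semi_principal_bundle G GM F actF M B actB \<pi> \<longleftrightarrow>
     semi_torsor G GM F actF \<and> smooth_manifold M \<and> G_manifold G GM B actB \<and>
     smooth_map B M \<pi> \<and> (\<forall>g\<in>carrier G. \<forall>b\<in>points B. \<pi> (actB g b) = \<pi> b) \<and>
     (\<forall>p\<in>points M. \<exists>U \<phi>. openin (topo M) U \<and> p \<in> U \<and>
        diffeomorphism (prod_manifold (open_submanifold M U) F)
          (open_submanifold B {b \<in> points B. \<pi> b \<in> U}) \<phi> \<and>
        (\<forall>u\<in>U. \<forall>f\<in>points F. \<pi> (\<phi> (u, f)) = u) \<and>
        (\<forall>u\<in>U. bij_betw (\<lambda>f. \<phi> (u, f)) (points F) {b \<in> points B. \<pi> b = u} \<and>
           (\<forall>g\<in>carrier G. \<forall>f\<in>points F. \<phi> (u, actF g f) = actB g (\<phi> (u, f)))))"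


section \<open>Connections, horizontal lifts and parallel transport\<close>

text \<open>
  The Lie algebra of \<open>G\<close> is the tangent space at the identity; as a vector space, it is thus
  the model space of \<open>G\<close>.
\<close>

definition infinitesimal_action ::
  "('g, 'r) monoid_scheme \<Rightarrow> ('g, 'eg::findim_inner) manifold \<Rightarrow>
   ('b, 'eb::findim_inner) manifold \<Rightarrow> ('g \<Rightarrow> 'b \<Rightarrow> 'b) \<Rightarrow> 'b \<Rightarrow> 'eg \<Rightarrow> 'eb" where
  "infinitesimal_action G GM B act b = differential GM B (\<lambda>g. act g b) \<one>\<^bsub>G\<^esub>"

definition Ad ::
  "('g, 'r) monoid_scheme \<Rightarrow> ('g, 'eg::findim_inner) manifold \<Rightarrow> 'g \<Rightarrow> 'eg \<Rightarrow> 'eg" where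
  "Ad G GM g = differential GM GM (\<lambda>h. g \<otimes>\<^bsub>G\<^esub> h \<otimes>\<^bsub>G\<^esub> inv\<^bsub>G\<^esub> g) \<one>\<^bsub>G\<^esub>"

definition G_connection ::
  "('g, 'r) monoid_scheme \<Rightarrow> ('g, 'eg::findim_inner) manifold \<Rightarrow>
   ('b, 'eb::findim_inner) manifold \<Rightarrow> ('g \<Rightarrow> 'b \<Rightarrow> 'b) \<Rightarrow> ('b \<Rightarrow> 'eb \<Rightarrow> 'eg) \<Rightarrow> bool" where
  "G_connection G GM B act \<omega> \<longleftrightarrow>
     one_form B \<omega> \<and>
     (\<forall>b\<in>points B. \<omega> b \<circ> infinitesimal_action G GM B act b = id) \<and>
     (\<forall>g\<in>carrier G. \<forall>b\<in>points B.
        \<omega> (act g b) \<circ> differential B B (act g) b = Ad G GM g \<circ> \<omega> b)"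

definition horizontal ::
  "('b, 'eb::findim_inner) manifold \<Rightarrow> ('b \<Rightarrow> 'eb \<Rightarrow> 'eg::findim_inner) \<Rightarrow> (real \<Rightarrow> 'b) \<Rightarrow> bool"
  where
  "horizontal B \<omega> \<Gamma> \<longleftrightarrow> (\<forall>t\<in>{0..1}. \<forall>v. has_velocity B \<Gamma> t v \<longrightarrow> \<omega> (\<Gamma> t) v = 0)"

definition horizontal_lift ::
  "('b, 'eb::findim_inner) manifold \<Rightarrow> ('b \<Rightarrow> 'm) \<Rightarrow> ('b \<Rightarrow> 'eb \<Rightarrow> 'eg::findim_inner) \<Rightarrow>
   (real \<Rightarrow> 'm) \<Rightarrow> 'b \<Rightarrow> (real \<Rightarrow> 'b) \<Rightarrow> bool" where
  "horizontal_lift B \<pi> \<omega> \<gamma> b \<Gamma> \<longleftrightarrow>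
     piecewise_smooth_curve B \<Gamma> \<and> horizontal B \<omega> \<Gamma> \<and>
     (\<forall>t\<in>{0..1}. \<pi> (\<Gamma> t) = \<gamma> t) \<and> \<Gamma> 0 = b"

definition parallel_transport ::
  "('b, 'eb::findim_inner) manifold \<Rightarrow> ('b \<Rightarrow> 'm) \<Rightarrow> ('b \<Rightarrow> 'eb \<Rightarrow> 'eg::findim_inner) \<Rightarrow>
   (real \<Rightarrow> 'm) \<Rightarrow> 'b \<Rightarrow> 'b" where
  "parallel_transport B \<pi> \<omega> \<gamma> b = (THE c. \<exists>\<Gamma>. horizontal_lift B \<pi> \<omega> \<gamma> b \<Gamma> \<and> c = \<Gamma> 1)"

end

theory Submission
  imports Defs
begin

text \<open>
  Over a small piece of the curve, a trivialization \<open>\<phi>\<close> writes every lift as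
  \<open>\<Gamma>(s) = \<phi>(\<gamma>(s), f(s))\<close>, and in a chart of the fibre \<open>F\<close> the curve \<open>f\<close> becomes a curve \<open>w\<close> in a
  Euclidean space. The form \<open>\<omega>\<close> applied to the velocity of \<open>\<Gamma>\<close> is \<open>P(s, w) + Q(s, w) w'\<close>, where \<open>Q\<close>
  is the restriction of \<open>\<omega>\<close> to vertical vectors. Since \<open>\<omega>\<close> inverts the infinitesimal action and \<open>\<phi>\<close>
  is equivariant, \<open>Q\<close> is a left inverse of the infinitesimal action \<open>a(w)\<close> on \<open>F\<close>. If \<open>a(w)\<close> is onto
  as well, the curve is horizontal if and only if \<open>w' = - a(w) P(s, w)\<close>: an ordinary differential
  equation with smooth right-hand side (lemma \<open>horizontal_in_trivialization_ode\<close>).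

  That \<open>a(w)\<close> is onto is where semi-torsors enter. The map \<open>a(w)\<close> is injective, having a left
  inverse, so the only obstruction would be \<open>dim G < dim F\<close>. But then an orbit, a countable union of
  smooth images of charts of \<open>G\<close>, would have measure zero in a chart of \<open>F\<close>, whereas orbits are open
  because the orbit space is discrete (lemma \<open>semi_torsor_dim_le\<close>).

  \<^emph>\<open>Existence.\<close> The Picard-Lindeloef theorem gives a horizontal lift near each time \<open>x\<close>, but on
  an interval that depends on the orbit of the initial point, and there may be infinitely many orbits.
  Within one orbit the interval is uniform, since translates of horizontal curves are horizontal.
  Bisection on the parameter interval thus gives lifts first over pieces of the curve
  inside one trivialization, for one orbit at a time (lemma \<open>lift_on_trivial_interval\<close>), and then, by a
  second bisection, over the whole curve (lemma \<open>lift_on_exists\<close>).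

  \<^emph>\<open>Uniqueness.\<close> The times at which two lifts agree form a closed set, because \<open>B\<close> is Hausdorff, and an
  open set, by uniqueness for the differential equation; so they are all of \<open>[0, 1]\<close>.

  \<^emph>\<open>Equivariance.\<close> The identity \<open>(L\<^sub>g)\<^sup>*\<omega> = Ad\<^sub>g \<omega>\<close> shows that \<open>g\<Gamma>\<close> is horizontal
  when \<open>\<Gamma>\<close> is, and \<open>g\<Gamma>\<close> lies above the same curve; uniqueness identifies it as the lift from \<open>gb\<close>.
\<close>

section \<open>Finite-dimensional inner product spaces\<close>

definition onb :: "'a::findim_inner set" where
  "onb = (SOME B. finite B \<and> (\<forall>u\<in>B. \<forall>v\<in>B. inner u v = (if u = v then 1 else 0)) \<and>
      (\<forall>x. (\<forall>u\<in>B. inner x u = 0) \<longleftrightarrow> x = 0))"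

lemma onb_props:
  shows finite_onb: "finite (onb :: 'a::findim_inner set)"
    and inner_onb: "\<And>u v :: 'a. u \<in> onb \<Longrightarrow> v \<in> onb \<Longrightarrow> inner u v = (if u = v then 1 else 0)"
    and onb_all_zero: "\<And>x :: 'a. (\<And>u. u \<in> onb \<Longrightarrow> inner x u = 0) \<Longrightarrow> x = 0"
proof -
  have *: "finite (onb :: 'a set) \<and>
      (\<forall>u\<in>onb. \<forall>v\<in>(onb :: 'a set). inner u v = (if u = v then 1 else 0)) \<and>
      (\<forall>x::'a. (\<forall>u\<in>onb. inner x u = 0) \<longleftrightarrow> x = 0)"
    unfolding onb_def by (rule someI_ex[OF finite_orthonormal_basis])
  show "finite (onb :: 'a set)" using * by blast
  show "\<And>u v :: 'a. u \<in> onb \<Longrightarrow> v \<in> onb \<Longrightarrow> inner u v = (if u = v then 1 else 0)"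
    using * by blast
  show "\<And>x :: 'a. (\<And>u. u \<in> onb \<Longrightarrow> inner x u = 0) \<Longrightarrow> x = 0"
    using * by blast
qed

lemma inner_sum_onb:
  fixes v :: "'a::findim_inner"
  assumes "v \<in> onb"
  shows "inner (\<Sum>u\<in>onb. c u *\<^sub>R u) v = c v"
proof -
  have "inner (\<Sum>u\<in>onb. c u *\<^sub>R u) v = (\<Sum>u\<in>onb. if v = u then c u else 0)"
    unfolding inner_sum_left using assms by (intro sum.cong) (auto simp: inner_onb)
  thus ?thesis using assms by (simp add: finite_onb)
qed

lemma onb_expansion: "(\<Sum>u\<in>onb. inner x u *\<^sub>R u) = (x :: 'a::findim_inner)"
proof -
  have "x - (\<Sum>u\<in>onb. inner x u *\<^sub>R u) = 0"
    by (rule onb_all_zero) (simp add: inner_diff_left inner_sum_onb)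
  thus ?thesis by simp
qed

lemma linear_onb_expansion:
  fixes f :: "'a::findim_inner \<Rightarrow> 'b::real_vector"
  assumes "linear f"
  shows "f x = (\<Sum>u\<in>onb. inner x u *\<^sub>R f u)"
proof -
  have "f x = f (\<Sum>u\<in>onb. inner x u *\<^sub>R u)" by (simp add: onb_expansion)
  also have "\<dots> = (\<Sum>u\<in>onb. inner x u *\<^sub>R f u)"
    by (simp add: linear_sum[OF assms] linear_scale[OF assms])
  finally show ?thesis .
qed

lemma span_onb: "span (onb :: 'a::findim_inner set) = UNIV"
proof -
  have "x \<in> span onb" for x :: 'a
    using span_sum[of onb "\<lambda>u. inner x u *\<^sub>R u" onb] unfolding onb_expansion
    by (simp add: span_scale span_base)
  thus ?thesis by blast
qed

lemma linear_bounded_linear: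
  fixes f :: "'a::findim_inner \<Rightarrow> 'b::real_normed_vector"
  assumes "linear f"
  shows "bounded_linear f"
proof -
  have "f = (\<lambda>x. \<Sum>u\<in>onb. inner x u *\<^sub>R f u)"
    by (rule ext) (rule linear_onb_expansion[OF assms])
  moreover have "bounded_linear (\<lambda>x. \<Sum>u\<in>onb. inner x u *\<^sub>R f u)"
    by (intro bounded_linear_sum bounded_linear_compose[OF bounded_linear_scaleR_left]
        bounded_linear_inner_left)
  ultimately show ?thesis by simp
qed

instance findim_inner \<subseteq> banach
proof
  fix X :: "nat \<Rightarrow> 'a"
  assume X: "Cauchy X"
  have "\<exists>l. (\<lambda>n. inner (X n) u) \<longlonglongrightarrow> l" for u
    using bounded_linear.Cauchy[OF bounded_linear_inner_left X, of u]
    by (simp add: Cauchy_convergent_iff convergent_def)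
  then obtain l where l: "\<And>u. (\<lambda>n. inner (X n) u) \<longlonglongrightarrow> l u" by metis
  have "(\<lambda>n. \<Sum>u\<in>onb. inner (X n) u *\<^sub>R u) \<longlonglongrightarrow> (\<Sum>u\<in>onb. l u *\<^sub>R u)"
    by (intro tendsto_intros l)
  thus "convergent X" unfolding onb_expansion convergent_def by blast
qed

instance prod :: (findim_inner, findim_inner) findim_inner
proof
  let ?B = "(\<lambda>u. (u, 0)) ` (onb :: 'a set) \<union> Pair 0 ` (onb :: 'b set)"
  have nz: "0 \<notin> (onb :: 'a set)" "0 \<notin> (onb :: 'b set)"
    using inner_onb[of "0::'a" 0] inner_onb[of "0::'b" 0] by auto
  have "x = 0" if "\<forall>u\<in>?B. inner x u = 0" for x :: "'a \<times> 'b"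
  proof (cases x)
    case (Pair y z)
    have "y = 0" by (rule onb_all_zero) (use that Pair in force)
    moreover have "z = 0" by (rule onb_all_zero) (use that Pair in force)
    ultimately show ?thesis using Pair by (simp add: zero_prod_def)
  qed
  hence "\<forall>x. (\<forall>u\<in>?B. inner x u = 0) \<longleftrightarrow> x = 0" by auto
  moreover have "\<forall>u\<in>?B. \<forall>v\<in>?B. inner u v = (if u = v then 1 else 0)"
    using nz by (auto simp: inner_onb split: if_splits)
  ultimately show "\<exists>B :: ('a \<times> 'b) set. finite B \<and>
      (\<forall>u\<in>B. \<forall>v\<in>B. inner u v = (if u = v then 1 else 0)) \<and>
      (\<forall>x. (\<forall>u\<in>B. inner x u = 0) \<longleftrightarrow> x = 0)"
    by (intro exI[of _ ?B]) (simp add: finite_onb)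
qed

text \<open>
  The cardinality of an orthonormal basis serves as the dimension.
\<close>

lemma linear_surj_or_card_less:
  fixes f :: "'a::findim_inner \<Rightarrow> 'b::findim_inner"
  assumes f: "linear f" and inj: "inj f"
  shows "surj f \<or> card (onb :: 'a set) < card (onb :: 'b set)"
proof (cases "surj f")
  case False
  have ind: "independent (onb :: 'a set)"
    unfolding dependent_finite[OF finite_onb]
  proof safe
    fix c :: "'a \<Rightarrow> real" and v :: 'a
    assume "(\<Sum>v\<in>onb. c v *\<^sub>R v) = 0" "v \<in> onb" "c v \<noteq> 0"
    with inner_sum_onb[of v c] show False by simp
  qed
  have ind': "independent (f ` onb)"
    by (rule linear_independent_injective_image[OF f ind]) (use inj in \<open>simp add: span_onb\<close>)
  obtain y where "y \<notin> range f" using False by blast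
  hence y: "y \<notin> span (f ` onb)"
    by (simp add: linear_span_image[OF f] span_onb)
  hence "independent (insert y (f ` onb))" using ind' independent_insertI by blast
  hence "card (insert y (f ` onb)) \<le> card (onb :: 'b set)"
    using independent_span_bound[OF finite_onb[where 'a='b], of "insert y (f ` onb)"]
    by (simp add: span_onb)
  moreover have "card (insert y (f ` onb)) = Suc (card (onb :: 'a set))"
  proof -
    have "y \<notin> f ` onb" using y span_base[of y "f ` onb"] by blast
    hence "card (insert y (f ` onb)) = Suc (card (f ` onb))"
      by (rule card_insert_disjoint[OF finite_imageI[OF finite_onb]])
    also have "card (f ` onb) = card (onb :: 'a set)"
      by (rule card_image[OF inj_on_subset[OF inj subset_UNIV]])
    finally show ?thesis .
  qed
  ultimately show ?thesis by linarith
qed (rule disjI1)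


section \<open>Calculus of smooth maps between open sets\<close>

text \<open>
  The hypothesis \<open>cong\<close> allows this rule to be used in the inductive proof of \<open>Ck_on_cong\<close>,
  by which it is discharged afterwards.
\<close>

lemma Ck_on_SucI:
  fixes f :: "'a::real_normed_vector \<Rightarrow> 'b::real_normed_vector"
  assumes "open S" "\<And>x. x \<in> S \<Longrightarrow> (f has_derivative f' x) (at x)"
    and "\<And>v. Ck_on k S (\<lambda>x. f' x v)"
    and cong: "\<And>g h :: 'a \<Rightarrow> 'b. (\<forall>x\<in>S. g x = h x) \<Longrightarrow> Ck_on k S g \<Longrightarrow> Ck_on k S h"
  shows "Ck_on (Suc k) S f"
proof -
  have "frechet_derivative f (at x) = f' x" if "x \<in> S" for x
    using frechet_derivative_at[OF assms(2)[OF that]] by simp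
  moreover have "Ck_on k S (\<lambda>x. frechet_derivative f (at x) v)" for v
    by (rule cong[OF _ assms(3)[of v]]) (simp add: calculation)
  ultimately show ?thesis using assms(2) by (auto simp: differentiable_def)
qed

lemma Ck_on_cong:
  fixes f g :: "'a::real_normed_vector \<Rightarrow> 'b::real_normed_vector"
  assumes "open S" "\<forall>x\<in>S. f x = g x" "Ck_on k S f"
  shows "Ck_on k S g"
  using assms(2,3)
proof (induction k arbitrary: f g)
  case 0
  thus ?case using continuous_on_cong[of S S f g] by auto
next
  case (Suc k)
  show ?case
  proof (rule Ck_on_SucI[OF assms(1)])
    show "(g has_derivative frechet_derivative f (at x)) (at x)" if "x \<in> S" for x
    proof (rule has_derivative_transform_within_open[OF _ assms(1) that])
      show "(f has_derivative frechet_derivative f (at x)) (at x)"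
        using Suc.prems that by (auto simp: frechet_derivative_works[symmetric])
    qed (use Suc.prems in auto)
  qed (use Suc in auto)
qed

lemmas Ck_on_SucI' = Ck_on_SucI[OF _ _ _ Ck_on_cong]

lemma Ck_on_SucD:
  "Ck_on (Suc k) S f \<Longrightarrow> x \<in> S \<Longrightarrow> (f has_derivative frechet_derivative f (at x)) (at x)"
  "Ck_on (Suc k) S f \<Longrightarrow> Ck_on k S (\<lambda>x. frechet_derivative f (at x) v)"
  by (auto simp: frechet_derivative_works[symmetric])

lemma Ck_on_subset: "Ck_on k S f \<Longrightarrow> T \<subseteq> S \<Longrightarrow> Ck_on k T f"
  by (induction k arbitrary: f) (auto intro: continuous_on_subset)

lemma Ck_on_Suc_imp: "Ck_on (Suc k) S f \<Longrightarrow> Ck_on k S f"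
proof (induction k arbitrary: f)
  case 0
  hence "\<forall>x\<in>S. isCont f x" using differentiable_imp_continuous_within by auto
  thus ?case by (simp add: continuous_at_imp_continuous_on)
qed auto

lemma Ck_on_local:
  assumes "\<And>x. x \<in> S \<Longrightarrow> \<exists>T. open T \<and> x \<in> T \<and> Ck_on k T f"
  shows "Ck_on k S f"
  using assms
proof (induction k arbitrary: f)
  case 0
  have "isCont f x" if "x \<in> S" for x
    using 0[OF that] by (auto simp: continuous_on_eq_continuous_at)
  thus ?case by (simp add: continuous_at_imp_continuous_on)
next
  case (Suc k)
  show ?case unfolding Ck_on.simps
  proof (intro conjI ballI allI)
    fix x assume "x \<in> S"
    thus "f differentiable at x" using Suc.prems by auto
  next
    fix v
    show "Ck_on k S (\<lambda>x. frechet_derivative f (at x) v)"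
      by (rule Suc.IH) (use Suc.prems in fastforce)
  qed
qed

lemma Ck_on_const: "Ck_on k S (\<lambda>x. c)"
proof (induction k arbitrary: c)
  case (Suc k)
  have "frechet_derivative (\<lambda>x. c) (at x) = (\<lambda>_. 0)" for x
    by (rule frechet_derivative_at[symmetric]) (rule has_derivative_const)
  thus ?case using Suc by simp
qed simp

lemma Ck_on_linear_compose:
  assumes L: "bounded_linear L" and "open S" "Ck_on k S f"
  shows "Ck_on k S (\<lambda>x. L (f x))"
  using assms(3)
proof (induction k arbitrary: f)
  case 0
  thus ?case using bounded_linear.continuous_on[OF L] by simp
next
  case (Suc k)
  show ?case
  proof (rule Ck_on_SucI'[OF assms(2)])
    show "((\<lambda>x. L (f x)) has_derivative (\<lambda>v. L (frechet_derivative f (at x) v))) (at x)"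
      if "x \<in> S" for x
      using bounded_linear.has_derivative[OF L Ck_on_SucD(1)[OF Suc.prems that]] .
  qed (use Suc assms(2) Ck_on_SucD(2) in auto)
qed

lemma Ck_on_id: "Ck_on k S (\<lambda>x. x)"
proof (cases k)
  case (Suc m)
  have "frechet_derivative (\<lambda>x. x) (at x) = (\<lambda>v. v)" for x :: 'a
    by (rule frechet_derivative_at[symmetric]) (rule has_derivative_ident)
  thus ?thesis using Suc by (simp add: Ck_on_const)
qed simp

lemma Ck_on_bounded_linear: "bounded_linear L \<Longrightarrow> open S \<Longrightarrow> Ck_on k S L"
  using Ck_on_linear_compose[OF _ _ Ck_on_id] .

lemma Ck_on_add:
  assumes "open S" "Ck_on k S f" "Ck_on k S g"
  shows "Ck_on k S (\<lambda>x. f x + g x)"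
  using assms(2,3)
proof (induction k arbitrary: f g)
  case 0
  thus ?case by (auto intro: continuous_on_add)
next
  case (Suc k)
  show ?case
  proof (rule Ck_on_SucI'[OF assms(1)])
    show "((\<lambda>x. f x + g x) has_derivative
        (\<lambda>v. frechet_derivative f (at x) v + frechet_derivative g (at x) v)) (at x)"
      if "x \<in> S" for x
      by (intro has_derivative_add Ck_on_SucD(1)[OF Suc.prems(1) that] Ck_on_SucD(1)[OF Suc.prems(2) that])
  qed (use Suc assms(1) Ck_on_SucD(2) in auto)
qed

lemma Ck_on_sum:
  assumes "open S" "\<And>i. i \<in> I \<Longrightarrow> Ck_on k S (f i)"
  shows "Ck_on k S (\<lambda>x. \<Sum>i\<in>I. f i x)"
  using assms(2)
  by (induction I rule: infinite_finite_induct) (auto simp: Ck_on_const intro: Ck_on_add[OF assms(1)])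

lemma Ck_on_bilinear:
  assumes B: "bounded_bilinear B" and "open S" "Ck_on k S f" "Ck_on k S g"
  shows "Ck_on k S (\<lambda>x. B (f x) (g x))"
  using assms(3,4)
proof (induction k arbitrary: f g)
  case 0
  thus ?case using bounded_bilinear.continuous_on[OF B] by simp
next
  case (Suc k)
  show ?case
  proof (rule Ck_on_SucI'[OF assms(2)])
    show "((\<lambda>x. B (f x) (g x)) has_derivative
        (\<lambda>v. B (f x) (frechet_derivative g (at x) v) + B (frechet_derivative f (at x) v) (g x))) (at x)"
      if "x \<in> S" for x
      by (intro bounded_bilinear.FDERIV[OF B] Ck_on_SucD(1)[OF Suc.prems(1) that] Ck_on_SucD(1)[OF Suc.prems(2) that])
    show "Ck_on k S (\<lambda>x. B (f x) (frechet_derivative g (at x) v) +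
        B (frechet_derivative f (at x) v) (g x))" for v
      by (intro Ck_on_add assms(2) Suc.IH Ck_on_SucD(2)[OF Suc.prems(1)] Ck_on_SucD(2)[OF Suc.prems(2)]
          Ck_on_Suc_imp[OF Suc.prems(1)] Ck_on_Suc_imp[OF Suc.prems(2)])
  qed (use assms(2) in auto)
qed

lemma Ck_on_Pair:
  assumes "open S" "Ck_on k S f" "Ck_on k S g"
  shows "Ck_on k S (\<lambda>x. (f x, g x))"
proof -
  have "Ck_on k S (\<lambda>x. (f x, 0) + (0, g x))"
  proof (rule Ck_on_add[OF assms(1)])
    show "Ck_on k S (\<lambda>x. (f x, 0))"
      by (rule Ck_on_linear_compose[OF bounded_linear_Pair[OF bounded_linear_ident bounded_linear_zero] assms(1,2)])
    show "Ck_on k S (\<lambda>x. (0, g x))"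
      by (rule Ck_on_linear_compose[OF bounded_linear_Pair[OF bounded_linear_zero bounded_linear_ident] assms(1,3)])
  qed
  thus ?thesis by simp
qed

text \<open>
  Expanding \<open>Df(x)v\<close> in an orthonormal basis turns the chain rule
  \<open>D(g \<circ> f)(x)v = Dg(f(x))(Df(x)v)\<close> into a finite sum of products of class \<open>C\<^sup>k\<close> functions
  by induction. This is why the intermediate space has to be finite-dimensional.
\<close>

lemma Ck_on_compose:
  fixes f :: "'a::real_normed_vector \<Rightarrow> 'b::findim_inner" and g :: "'b \<Rightarrow> 'c::real_normed_vector"
  assumes S: "open S" and f: "Ck_on k S f" and g: "Ck_on k T g" and "f ` S \<subseteq> T"
  shows "Ck_on k S (\<lambda>x. g (f x))"
  using f g
proof (induction k arbitrary: g)
  case 0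
  thus ?case using assms(4) continuous_on_compose2[of T g S f] by auto
next
  case (Suc k)
  let ?f' = "\<lambda>x. frechet_derivative f (at x)" and ?g' = "\<lambda>y. frechet_derivative g (at y)"
  have g': "(g has_derivative ?g' (f x)) (at (f x))" if "x \<in> S" for x
    using Ck_on_SucD(1)[OF Suc.prems(2)] that assms(4) by blast
  show ?case
  proof (rule Ck_on_SucI'[OF S])
    fix x assume x: "x \<in> S"
    have "((\<lambda>x. g (f x)) has_derivative (\<lambda>v. ?g' (f x) (?f' x v))) (at x)"
      using has_derivative_compose[OF Ck_on_SucD(1)[OF Suc.prems(1) x]] g'[OF x] by blast
    also have "(\<lambda>v. ?g' (f x) (?f' x v)) = (\<lambda>v. \<Sum>u\<in>onb. inner (?f' x v) u *\<^sub>R ?g' (f x) u)"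
      by (rule ext) (rule linear_onb_expansion[OF has_derivative_linear[OF g'[OF x]]])
    finally show "((\<lambda>x. g (f x)) has_derivative (\<lambda>v. \<Sum>u\<in>onb. inner (?f' x v) u *\<^sub>R ?g' (f x) u)) (at x)" .
  next
    fix v
    show "Ck_on k S (\<lambda>x. \<Sum>u\<in>onb. inner (?f' x v) u *\<^sub>R ?g' (f x) u)"
    proof (intro Ck_on_sum[OF S] Ck_on_bilinear[OF bounded_bilinear_scaleR S])
      fix u
      show "Ck_on k S (\<lambda>x. inner (?f' x v) u)"
        by (rule Ck_on_linear_compose[OF bounded_linear_inner_left S Ck_on_SucD(2)[OF Suc.prems(1)]])
      show "Ck_on k S (\<lambda>x. ?g' (f x) u)"
        by (rule Suc.IH[OF Ck_on_Suc_imp[OF Suc.prems(1)] Ck_on_SucD(2)[OF Suc.prems(2)]])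
    qed
  qed (rule S)
qed

lemma smooth_onI: "(\<And>k. Ck_on k S f) \<Longrightarrow> smooth_on S f"
  and smooth_onD: "smooth_on S f \<Longrightarrow> Ck_on k S f"
  by (auto simp: smooth_on_def)

lemma smooth_on_cong: "open S \<Longrightarrow> (\<And>x. x \<in> S \<Longrightarrow> f x = g x) \<Longrightarrow> smooth_on S f \<Longrightarrow> smooth_on S g"
  unfolding smooth_on_def using Ck_on_cong by blast

lemma smooth_on_subset: "smooth_on S f \<Longrightarrow> T \<subseteq> S \<Longrightarrow> smooth_on T f"
  unfolding smooth_on_def using Ck_on_subset by blast

lemma smooth_on_local:
  "(\<And>x. x \<in> S \<Longrightarrow> \<exists>T. open T \<and> x \<in> T \<and> smooth_on T f) \<Longrightarrow> smooth_on S f"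
  unfolding smooth_on_def by (intro allI Ck_on_local) blast

lemma smooth_on_continuous: "smooth_on S f \<Longrightarrow> continuous_on S f"
  using smooth_onD[of S f 0] by simp

lemma smooth_on_has_derivative:
  "smooth_on S f \<Longrightarrow> x \<in> S \<Longrightarrow> (f has_derivative frechet_derivative f (at x)) (at x)"
  using Ck_on_SucD(1)[OF smooth_onD[of S f "Suc 0"]] .

lemma smooth_on_linear_derivative:
  "smooth_on S f \<Longrightarrow> x \<in> S \<Longrightarrow> linear (frechet_derivative f (at x))"
  using smooth_on_has_derivative has_derivative_linear by blast

lemma smooth_on_derivative:
  "smooth_on S f \<Longrightarrow> smooth_on S (\<lambda>x. frechet_derivative f (at x) v)"
  by (rule smooth_onI) (rule Ck_on_SucD(2), rule smooth_onD)

lemma smooth_on_const: "smooth_on S (\<lambda>x. c)"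
  by (rule smooth_onI) (rule Ck_on_const)

lemma smooth_on_id: "smooth_on S (\<lambda>x. x)"
  by (rule smooth_onI) (rule Ck_on_id)

lemma smooth_on_linear_compose:
  "bounded_linear L \<Longrightarrow> open S \<Longrightarrow> smooth_on S f \<Longrightarrow> smooth_on S (\<lambda>x. L (f x))"
  by (rule smooth_onI, rule Ck_on_linear_compose, assumption, assumption, rule smooth_onD)

lemma smooth_on_sum:
  "open S \<Longrightarrow> (\<And>i. i \<in> I \<Longrightarrow> smooth_on S (f i)) \<Longrightarrow> smooth_on S (\<lambda>x. \<Sum>i\<in>I. f i x)"
  unfolding smooth_on_def by (intro allI Ck_on_sum) auto

lemma smooth_on_scaleR:
  "open S \<Longrightarrow> smooth_on S f \<Longrightarrow> smooth_on S g \<Longrightarrow> smooth_on S (\<lambda>x. f x *\<^sub>R g x)"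
  unfolding smooth_on_def by (intro allI Ck_on_bilinear[OF bounded_bilinear_scaleR]) auto

lemma smooth_on_Pair:
  "open S \<Longrightarrow> smooth_on S f \<Longrightarrow> smooth_on S g \<Longrightarrow> smooth_on S (\<lambda>x. (f x, g x))"
  unfolding smooth_on_def by (intro allI Ck_on_Pair) auto

lemma smooth_on_compose:
  fixes f :: "'a::real_normed_vector \<Rightarrow> 'b::findim_inner" and g :: "'b \<Rightarrow> 'c::real_normed_vector"
  assumes "open S" "smooth_on S f" "smooth_on T g" "\<And>x. x \<in> S \<Longrightarrow> f x \<in> T"
  shows "smooth_on S (\<lambda>x. g (f x))"
  by (rule smooth_onI, rule Ck_on_compose[OF assms(1) smooth_onD[OF assms(2)] smooth_onD[OF assms(3)]])
    (use assms(4) in auto)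

text \<open>
  The expansion of the vectors in an orthonormal basis reduces this to the values of the linear maps on fixed
  vectors.
\<close>

lemma smooth_on_linear_family:
  fixes A :: "'a::real_normed_vector \<Rightarrow> 'b::findim_inner \<Rightarrow> 'c::real_normed_vector"
  assumes "open S" "\<And>x. x \<in> S \<Longrightarrow> linear (A x)" "\<And>v. smooth_on S (\<lambda>x. A x v)" "smooth_on S f"
  shows "smooth_on S (\<lambda>x. A x (f x))"
proof (rule smooth_on_cong[OF assms(1)])
  show "smooth_on S (\<lambda>x. \<Sum>u\<in>onb. inner (f x) u *\<^sub>R A x u)"
  proof (intro smooth_on_sum smooth_on_scaleR assms(1))
    show "smooth_on S (\<lambda>x. inner (f x) u)" for u
      by (rule smooth_on_linear_compose[OF bounded_linear_inner_left assms(1,4)])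
  qed (rule assms(3))
  show "(\<Sum>u\<in>onb. inner (f x) u *\<^sub>R A x u) = A x (f x)" if "x \<in> S" for x
    by (rule linear_onb_expansion[OF assms(2)[OF that], symmetric])
qed


section \<open>Ordinary differential equations\<close>

text \<open>
  The partial derivatives in the directions of an orthonormal basis are bounded near a point by
  continuity; the mean value inequality turns this into a Lipschitz bound.
\<close>

lemma smooth_locally_lipschitz:
  fixes R :: "real \<times> 'a::findim_inner \<Rightarrow> 'b::real_normed_vector"
  assumes D: "open D" and R: "smooth_on D R" and z0: "(x0, w0) \<in> D"
  obtains r L M where "r > 0" "L \<ge> 0" "M \<ge> 0" "cball x0 r \<times> cball w0 r \<subseteq> D"
    and "\<And>s w w'. s \<in> cball x0 r \<Longrightarrow> w \<in> cball w0 r \<Longrightarrow> w' \<in> cball w0 r \<Longrightarrow>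
      norm (R (s, w) - R (s, w')) \<le> L * norm (w - w')"
    and "\<And>s w. s \<in> cball x0 r \<Longrightarrow> w \<in> cball w0 r \<Longrightarrow> norm (R (s, w)) \<le> M"
proof -
  let ?DR = "\<lambda>z. frechet_derivative R (at z)"
  define K where "K u = norm (?DR (x0, w0) (0, u)) + 1" for u
  define M where "M = norm (R (x0, w0)) + 1"
  have ev: "eventually (\<lambda>z. norm (f z) < norm (f (x0, w0)) + 1) (nhds (x0, w0))"
    if "smooth_on D f" for f :: "real \<times> 'a \<Rightarrow> 'b"
  proof -
    have "isCont f (x0, w0)"
      using smooth_on_continuous[OF that] D z0 by (simp add: continuous_on_eq_continuous_at)
    hence "((\<lambda>z. norm (f z)) \<longlongrightarrow> norm (f (x0, w0))) (nhds (x0, w0))"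
      by (intro tendsto_norm) (simp add: continuous_at_imp_continuous_within isCont_def tendsto_nhds_iff)
    thus ?thesis by (rule order_tendstoD(2)) simp
  qed
  have "eventually (\<lambda>z. z \<in> D \<and> norm (R z) < M \<and> (\<forall>u\<in>onb. norm (?DR z (0, u)) < K u)) (nhds (x0, w0))"
    unfolding M_def K_def
    by (intro eventually_conj eventually_nhds_in_open D z0 ev R eventually_ball_finite ballI
        finite_onb smooth_on_derivative)
  then obtain e where e: "e > 0"
    and eD: "\<And>z. dist z (x0, w0) < e \<Longrightarrow> z \<in> D \<and> norm (R z) < M \<and> (\<forall>u\<in>onb. norm (?DR z (0, u)) < K u)"
    unfolding eventually_nhds_metric by blast
  define r where "r = e / 3"
  have r: "r > 0" using e by (simp add: r_def)
  have in_e: "dist (s, w) (x0, w0) < e" if "s \<in> cball x0 r" "w \<in> cball w0 r" for s w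
  proof -
    have "dist (s, w) (x0, w0) \<le> dist s x0 + dist w w0"
      unfolding dist_prod_def by (simp add: sqrt_sum_squares_le_sum)
    also have "\<dots> \<le> r + r" using that by (intro add_mono) (simp_all add: dist_commute)
    also have "\<dots> < e" using e by (simp add: r_def)
    finally show ?thesis .
  qed
  define L where "L = (\<Sum>u\<in>onb. K u)"
  have K: "K u \<ge> 0" for u by (simp add: K_def)
  have bound: "norm (?DR (s, w) (0, v)) \<le> L * norm v" if "s \<in> cball x0 r" "w \<in> cball w0 r" for s w v
  proof -
    note d = eD[OF in_e[OF that]]
    have lin: "linear (\<lambda>v. ?DR (s, w) (0, v))"
    proof -
      have "linear ((?DR (s, w)) \<circ> Pair 0)"
        by (intro linear_compose smooth_on_linear_derivative[OF R] conjunct1[OF d]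
            bounded_linear.linear bounded_linear_Pair bounded_linear_zero bounded_linear_ident)
      thus ?thesis by (simp add: o_def)
    qed
    have "norm (?DR (s, w) (0, v)) = norm (\<Sum>u\<in>onb. inner v u *\<^sub>R ?DR (s, w) (0, u))"
      using linear_onb_expansion[OF lin, of v] by simp
    also have "\<dots> \<le> (\<Sum>u\<in>onb. norm v * K u)"
    proof (rule sum_norm_le)
      fix u :: 'a assume u: "u \<in> onb"
      have "norm u = 1" using inner_onb[OF u u] by (simp add: norm_eq_sqrt_inner)
      hence "\<bar>inner v u\<bar> \<le> norm v" using Cauchy_Schwarz_ineq2[of v u] by simp
      thus "norm (inner v u *\<^sub>R ?DR (s, w) (0, u)) \<le> norm v * K u"
        using d u unfolding norm_scaleR by (intro mult_mono) (auto intro: less_imp_le)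
    qed
    also have "\<dots> = L * norm v" by (simp add: L_def sum_distrib_left mult.commute)
    finally show ?thesis .
  qed
  show thesis
  proof
    show "r > 0" by (rule r)
    show "L \<ge> 0" unfolding L_def by (intro sum_nonneg K)
    show "M \<ge> 0" by (simp add: M_def)
    show "cball x0 r \<times> cball w0 r \<subseteq> D" using eD in_e by blast
    show "norm (R (s, w)) \<le> M" if "s \<in> cball x0 r" "w \<in> cball w0 r" for s w
      using eD[OF in_e[OF that]] by simp
    show "norm (R (s, w) - R (s, w')) \<le> L * norm (w - w')"
      if s: "s \<in> cball x0 r" and w: "w \<in> cball w0 r" "w' \<in> cball w0 r" for s w w'
    proof (rule differentiable_bound[OF convex_cball _ _ w])
      fix w assume w: "w \<in> cball w0 r"
      have "((\<lambda>w. R (s, w)) has_derivative (\<lambda>v. ?DR (s, w) (0, v))) (at w)"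
        by (rule has_derivative_compose[of "Pair s" "Pair 0" w UNIV R "?DR (s, w)"])
          (auto intro!: derivative_eq_intros smooth_on_has_derivative[OF R] eD[OF in_e[OF s w], THEN conjunct1])
      thus "((\<lambda>w. R (s, w)) has_derivative (\<lambda>v. ?DR (s, w) (0, v))) (at w within cball w0 r)"
        by (rule has_derivative_at_withinI)
      show "onorm (\<lambda>v. ?DR (s, w) (0, v)) \<le> L"
      proof (rule onorm_bound)
        show "0 \<le> L" unfolding L_def by (intro sum_nonneg K)
      qed (rule bound[OF s w])
    qed
  qed
qed

lemma vector_mean_value_bound:
  fixes f :: "real \<Rightarrow> 'a::real_normed_vector"
  assumes f: "\<And>t. t \<in> {a..b} \<Longrightarrow> (f has_vector_derivative f' t) (at t within {a..b})"
    and B: "\<And>t. t \<in> {a..b} \<Longrightarrow> norm (f' t) \<le> B" and "x \<in> {a..b}" "y \<in> {a..b}"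
  shows "norm (f x - f y) \<le> B * \<bar>x - y\<bar>"
proof -
  have "B \<ge> 0" using B[OF assms(3)] norm_ge_zero order_trans by blast
  show ?thesis unfolding real_norm_def[symmetric]
  proof (rule differentiable_bound[OF convex_real_interval(5) _ _ assms(3,4)])
    fix t assume t: "t \<in> {a..b}"
    show "(f has_derivative (\<lambda>h. h *\<^sub>R f' t)) (at t within {a..b})"
      using f[OF t] by (simp add: has_vector_derivative_def)
    show "onorm (\<lambda>h. h *\<^sub>R f' t) \<le> B"
    proof (rule onorm_bound[OF \<open>B \<ge> 0\<close>])
      show "norm (h *\<^sub>R f' t) \<le> B * norm h" for h
        using mult_right_mono[OF B[OF t], of "norm h"] by (simp add: mult.commute)
    qed
  qed
qed

text \<open>
  The time interval \<open>\<delta>\<close> is so short that a curve of speed at most \<open>M\<close> stays in the ball of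
  radius \<open>r\<close> and that the Picard operator is a contraction with factor \<open>L\<delta> \<le> 1/2\<close>. The operator
  acts on bounded continuous functions on the whole line; times outside the interval are clamped to it.
\<close>

lemma picard_lindelof:
  fixes R :: "real \<times> 'a::banach \<Rightarrow> 'a"
  assumes r: "r > 0" and L: "L \<ge> 0" and M: "M \<ge> 0"
    and cont: "continuous_on (cball x0 r \<times> cball w0 r) R"
    and lip: "\<And>s w w'. s \<in> cball x0 r \<Longrightarrow> w \<in> cball w0 r \<Longrightarrow> w' \<in> cball w0 r \<Longrightarrow>
      norm (R (s, w) - R (s, w')) \<le> L * norm (w - w')"
    and bound: "\<And>s w. s \<in> cball x0 r \<Longrightarrow> w \<in> cball w0 r \<Longrightarrow> norm (R (s, w)) \<le> M"
  obtains \<delta> w where "\<delta> > 0" "\<delta> \<le> r" "w x0 = w0"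
    and "\<And>s. s \<in> ball x0 \<delta> \<Longrightarrow> w s \<in> cball w0 r \<and> (w has_vector_derivative R (s, w s)) (at s)"
proof -
  \<comment> \<open>adding \<open>1\<close> to \<open>M\<close> and \<open>L\<close> avoids division by zero\<close>
  define \<delta> where "\<delta> = min r (min (r / (M + 1)) (1 / (2 * (L + 1))))"
  have d: "\<delta> > 0" "\<delta> \<le> r" using r L M by (auto simp: \<delta>_def)
  have Md: "M * \<delta> \<le> r"
  proof -
    have "M * \<delta> \<le> M * (r / (M + 1))" by (rule mult_left_mono) (use M in \<open>auto simp: \<delta>_def\<close>)
    also have "\<dots> \<le> r" using M r by (simp add: field_simps)
    finally show ?thesis .
  qed
  have Ld: "L * \<delta> \<le> 1 / 2"
  proof -
    have "L * \<delta> \<le> L * (1 / (2 * (L + 1)))" by (rule mult_left_mono) (use L in \<open>auto simp: \<delta>_def\<close>)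
    also have "\<dots> \<le> 1 / 2" using L by (simp add: field_simps)
    finally show ?thesis .
  qed
  define a where "a = x0 - \<delta>"
  define b where "b = x0 + \<delta>"
  have x0: "x0 \<in> {a..b}" using d by (simp add: a_def b_def)
  have ab: "t \<in> cball x0 r" "\<bar>t - x0\<bar> \<le> \<delta>" if "t \<in> {a..b}" for t
    using that d by (auto simp: a_def b_def dist_real_def)
  define cl where "cl s = max a (min b s)" for s
  have cl: "cl s \<in> {a..b}" for s using x0 by (auto simp: cl_def)
  have cl_id: "cl s = s" if "s \<in> {a..b}" for s using that by (auto simp: cl_def)
  have cl_cont: "continuous_on UNIV cl" unfolding cl_def by (intro continuous_intros)
  define g where "g u t = R (t, apply_bcontfun u t)" for u :: "real \<Rightarrow>\<^sub>C 'a" and t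
  define I where "I u s = integral {a..s} (g u)" for u s
  define S where "S = PiC UNIV (\<lambda>_::real. cball w0 r)"
  have S: "apply_bcontfun u t \<in> cball w0 r" if "u \<in> S" for u t
    using that by (auto simp: S_def mem_PiC_iff)
  have g_cont: "continuous_on {a..b} (g u)" if "u \<in> S" for u
    unfolding g_def
    by (rule continuous_on_compose2[OF cont]) (auto intro!: continuous_intros ab S[OF that] simp del: mem_cball)
  have I_der: "(I u has_vector_derivative g u s) (at s within {a..b})" if "u \<in> S" "s \<in> {a..b}" for u s
    unfolding I_def by (rule integral_has_vector_derivative[OF g_cont[OF that(1)] that(2)])
  have I_cont: "continuous_on {a..b} (I u)" if "u \<in> S" for u
    using I_der[OF that] has_vector_derivative_continuous continuous_on_eq_continuous_within by blast
  define T0 where "T0 u s = w0 + (I u (cl s) - I u x0)" for u s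
  have T0_ball: "T0 u s \<in> cball w0 r" if u: "u \<in> S" for u s
  proof -
    have "norm (I u (cl s) - I u x0) \<le> M * \<bar>cl s - x0\<bar>"
      by (rule vector_mean_value_bound[OF I_der[OF u] _ cl x0])
        (auto simp: g_def intro!: bound ab S[OF u] simp del: mem_cball)
    also have "\<dots> \<le> M * \<delta>" by (rule mult_left_mono[OF ab(2)[OF cl] M])
    finally show ?thesis using Md by (simp add: T0_def dist_norm norm_minus_commute)
  qed
  have T0_bc: "T0 u \<in> bcontfun" if u: "u \<in> S" for u
  proof (rule bcontfun_normI)
    show "continuous_on UNIV (T0 u)" unfolding T0_def
      by (intro continuous_intros continuous_on_compose2[OF I_cont[OF u] cl_cont]) (use cl in auto)
    show "norm (T0 u s) \<le> norm w0 + r" for s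
    proof -
      have "norm (T0 u s) \<le> norm w0 + norm (T0 u s - w0)" using norm_triangle_sub by blast
      also have "\<dots> \<le> norm w0 + r"
        using T0_ball[OF u, of s] by (simp add: dist_norm norm_minus_commute)
      finally show ?thesis .
    qed
  qed
  define T where "T u = Bcontfun (T0 u)" for u
  have T: "apply_bcontfun (T u) = T0 u" if "u \<in> S" for u
    unfolding T_def by (rule Bcontfun_inverse[OF T0_bc[OF that]])
  have "\<exists>!u\<in>S. T u = u"
  proof (rule Banach_fix)
    show "complete S" unfolding S_def by (intro closed_PiC complete_eq_closed[THEN iffD2]) auto
    have "const_bcontfun w0 \<in> S" using r by (auto simp: S_def mem_PiC_iff)
    thus "S \<noteq> {}" by blast
    show "(0::real) \<le> 1 / 2" "(1::real) / 2 < 1" by auto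
    show "T ` S \<subseteq> S" using T0_ball T by (auto simp: S_def[of] mem_PiC_iff simp del: mem_cball)
    show "dist (T u) (T v) \<le> 1 / 2 * dist u v" if uv: "u \<in> S" "v \<in> S" for u v
    proof (rule dist_bound)
      fix s
      let ?f = "\<lambda>s. I u s - I v s"
      have "norm (?f (cl s) - ?f x0) \<le> (L * dist u v) * \<bar>cl s - x0\<bar>"
      proof (rule vector_mean_value_bound[OF _ _ cl x0])
        fix t assume t: "t \<in> {a..b}"
        show "(?f has_vector_derivative g u t - g v t) (at t within {a..b})"
          by (intro has_vector_derivative_diff I_der uv t)
        have "norm (g u t - g v t) \<le> L * norm (apply_bcontfun u t - apply_bcontfun v t)"
          unfolding g_def by (rule lip[OF ab(1)[OF t] S[OF uv(1)] S[OF uv(2)]])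
        also have "\<dots> \<le> L * dist u v"
          using dist_bounded[of u t v] by (intro mult_left_mono L) (simp add: dist_norm)
        finally show "norm (g u t - g v t) \<le> L * dist u v" .
      qed
      also have "\<dots> \<le> (L * dist u v) * \<delta>" by (intro mult_left_mono ab(2)[OF cl]) (simp add: L)
      also have "\<dots> = (L * \<delta>) * dist u v" by simp
      also have "\<dots> \<le> 1 / 2 * dist u v" by (intro mult_right_mono Ld) simp
      finally show "dist (apply_bcontfun (T u) s) (apply_bcontfun (T v) s) \<le> 1 / 2 * dist u v"
        by (simp add: T uv T0_def dist_norm algebra_simps)
    qed
  qed
  then obtain u where u: "u \<in> S" "T u = u" by blast
  have u_eq: "apply_bcontfun u s = T0 u s" for s using T[OF u(1)] u(2) by simp
  show thesis
  proof (rule that[OF d, of "apply_bcontfun u"])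
    show "apply_bcontfun u x0 = w0" unfolding u_eq by (simp add: T0_def cl_id[OF x0])
    fix s assume "s \<in> ball x0 \<delta>"
    hence s: "s \<in> {a<..<b}" by (auto simp: a_def b_def dist_real_def abs_less_iff)
    hence s': "s \<in> {a..b}" by auto
    have "((\<lambda>s. w0 + (I u s - I u x0)) has_vector_derivative g u s) (at s within {a..b})"
      using I_der[OF u(1) s'] by (auto intro!: derivative_eq_intros)
    hence "(apply_bcontfun u has_vector_derivative g u s) (at s within {a..b})"
      by (rule has_vector_derivative_transform[OF s', rotated]) (simp add: u_eq T0_def cl_id)
    hence "(apply_bcontfun u has_vector_derivative g u s) (at s within {a<..<b})"
      by (rule has_vector_derivative_within_subset) auto
    hence "(apply_bcontfun u has_vector_derivative g u s) (at s)"
      using s at_within_open[of s "{a<..<b}"] by simp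
    thus "apply_bcontfun u s \<in> cball w0 r \<and>
        (apply_bcontfun u has_vector_derivative R (s, apply_bcontfun u s)) (at s)"
      using S[OF u(1)] by (simp add: g_def)
  qed
qed

text \<open>
  Bootstrapping: if \<open>w\<close> is of class \<open>C\<^sup>k\<close>, then so is \<open>w' = R(s, w)\<close>.
\<close>

lemma ode_solution_smooth:
  fixes w :: "real \<Rightarrow> 'a::findim_inner"
  assumes J: "open J" and D: "smooth_on D R"
    and w: "\<And>s. s \<in> J \<Longrightarrow> (s, w s) \<in> D \<and> (w has_vector_derivative R (s, w s)) (at s)"
  shows "smooth_on J w"
proof (rule smooth_onI)
  fix k show "Ck_on k J w"
  proof (induction k)
    case 0
    have "isCont w s" if "s \<in> J" for s
      using w[OF that] has_vector_derivative_continuous by blast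
    thus ?case by (simp add: continuous_at_imp_continuous_on)
  next
    case (Suc k)
    show ?case
    proof (rule Ck_on_SucI'[OF J])
      show "(w has_derivative (\<lambda>v. v *\<^sub>R R (s, w s))) (at s)" if "s \<in> J" for s
        using w[OF that] by (simp add: has_vector_derivative_def)
      have "Ck_on k J (\<lambda>s. R (s, w s))"
        by (rule Ck_on_compose[OF J Ck_on_Pair[OF J Ck_on_id Suc] smooth_onD[OF D]]) (use w in auto)
      thus "Ck_on k J (\<lambda>s. v *\<^sub>R R (s, w s))" for v
        by (rule Ck_on_linear_compose[OF bounded_linear_scaleR_right J])
    qed (rule J)
  qed
qed

text \<open>
  The function \<open>\<bar>v\<bar>\<^sup>2 e\<^bsup>-2Lt\<^esup>\<close> is nonincreasing, nonnegative and zero at \<open>a\<close>.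
\<close>

lemma gronwall_zero_aux:
  fixes v :: "real \<Rightarrow> 'a::real_inner" and L :: real
  assumes ab: "a \<le> b" and cont: "continuous_on {a..b} v"
    and der: "\<And>t. t \<in> {a<..<b} \<Longrightarrow> (v has_vector_derivative v' t) (at t) \<and> norm (v' t) \<le> L * norm (v t)"
    and va: "v a = 0"
  shows "v b = 0"
proof -
  define \<phi> where "\<phi> t = inner (v t) (v t) * exp (- 2 * L * t)" for t
  have "\<phi> b \<le> \<phi> a"
  proof (rule DERIV_nonpos_imp_decreasing_open[OF ab])
    show "continuous_on {a..b} \<phi>" unfolding \<phi>_def by (intro continuous_intros cont)
    fix t assume "a < t" "t < b"
    hence t: "t \<in> {a<..<b}" by simp
    have 1: "((\<lambda>t. inner (v t) (v t)) has_real_derivative 2 * inner (v t) (v' t)) (at t)"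
      using has_derivative_inner[OF der[OF t, THEN conjunct1, unfolded has_vector_derivative_def]
          der[OF t, THEN conjunct1, unfolded has_vector_derivative_def]]
      unfolding has_field_derivative_def
      by (rule has_derivative_eq_rhs) (auto simp: inner_commute algebra_simps)
    have 2: "((\<lambda>t. exp (- 2 * L * t)) has_real_derivative exp (- 2 * L * t) * (- 2 * L)) (at t)"
      by (auto intro!: derivative_eq_intros)
    have 3: "(\<phi> has_real_derivative
        (2 * inner (v t) (v' t)) * exp (- 2 * L * t) + (exp (- 2 * L * t) * (- 2 * L)) * inner (v t) (v t)) (at t)"
      unfolding \<phi>_def by (rule DERIV_mult[OF 1 2])
    have "inner (v t) (v' t) \<le> norm (v t) * norm (v' t)" by (rule norm_cauchy_schwarz)
    also have "\<dots> \<le> norm (v t) * (L * norm (v t))" using der[OF t] by (intro mult_left_mono) auto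
    also have "\<dots> = L * inner (v t) (v t)" by (simp add: power2_norm_eq_inner[symmetric] power2_eq_square)
    finally have "(2 * exp (- 2 * L * t)) * (inner (v t) (v' t) - L * inner (v t) (v t)) \<le> 0"
      by (intro mult_nonneg_nonpos) auto
    thus "\<exists>y. (\<phi> has_real_derivative y) (at t) \<and> y \<le> 0"
      by (intro exI[of _ "(2 * inner (v t) (v' t)) * exp (- 2 * L * t) +
            (exp (- 2 * L * t) * (- 2 * L)) * inner (v t) (v t)"] conjI 3) (simp add: algebra_simps)
  qed
  hence "inner (v b) (v b) * exp (- 2 * L * b) \<le> 0" by (simp add: \<phi>_def va)
  hence "inner (v b) (v b) \<le> 0" by (simp add: mult_le_0_iff not_le[symmetric])
  thus ?thesis by (metis inner_eq_zero_iff inner_ge_zero order_antisym)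
qed

text \<open>
  Going backwards in time reduces to going forwards by reflection.
\<close>

lemma gronwall_zero:
  fixes v :: "real \<Rightarrow> 'a::real_inner" and L :: real
  assumes cont: "continuous_on (closed_segment a b) v"
    and der: "\<And>t. t \<in> open_segment a b \<Longrightarrow>
      (v has_vector_derivative v' t) (at t) \<and> norm (v' t) \<le> L * norm (v t)"
    and va: "v a = 0"
  shows "v b = 0"
proof (cases "a \<le> b")
  case True
  thus ?thesis
    using gronwall_zero_aux[OF True, of v v' L] assms
    by (auto simp: closed_segment_eq_real_ivl open_segment_eq_real_ivl split: if_splits)
next
  case False
  have "(v \<circ> uminus) (- b) = 0"
  proof (rule gronwall_zero_aux[of "- a" "- b" "v \<circ> uminus" "\<lambda>t. - v' (- t)" L])
    show "continuous_on {- a..- b} (v \<circ> uminus)"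
      by (intro continuous_on_compose continuous_intros continuous_on_subset[OF cont])
        (use False in \<open>auto simp: closed_segment_eq_real_ivl\<close>)
    fix t assume "t \<in> {- a<..<- b}"
    hence t: "- t \<in> open_segment a b" using False by (auto simp: open_segment_eq_real_ivl)
    have "((v \<circ> uminus) has_vector_derivative (-1) *\<^sub>R v' (- t)) (at t)"
      by (rule vector_diff_chain_at[of uminus "-1"])
        (use der[OF t] in \<open>auto intro!: derivative_eq_intros\<close>)
    thus "((v \<circ> uminus) has_vector_derivative - v' (- t)) (at t) \<and>
        norm (- v' (- t)) \<le> L * norm ((v \<circ> uminus) t)"
      using der[OF t] by simp
  qed (use False va in auto)
  thus ?thesis by simp
qed


section \<open>Charts, smooth maps and smooth curves\<close>

text \<open>
  What is needed of an atlas for working in charts. It passes to products and open subsets without any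
  discussion of transition maps.
\<close>

definition charted :: "('a, 'e::real_normed_vector) manifold \<Rightarrow> bool" where
  "charted M \<longleftrightarrow> (\<Union>(U, x)\<in>atlas M. U) = points M \<and>
     (\<forall>(U, x)\<in>atlas M. openin (topo M) U \<and> inj_on x U \<and>
        (\<forall>W. openin (topo M) W \<longrightarrow> W \<subseteq> U \<longrightarrow> open (x ` W)))"

lemma chartedD:
  assumes "charted M" "(U, x) \<in> atlas M"
  shows "openin (topo M) U" "inj_on x U" "\<And>W. openin (topo M) W \<Longrightarrow> W \<subseteq> U \<Longrightarrow> open (x ` W)"
    "open (x ` U)" "U \<subseteq> points M"
  using assms openin_subset unfolding charted_def by fast+

lemma charted_cover: "charted M \<Longrightarrow> p \<in> points M \<Longrightarrow> \<exists>U x. (U, x) \<in> atlas M \<and> p \<in> U"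
  unfolding charted_def by blast

lemma smooth_manifold_charted:
  assumes "smooth_manifold M"
  shows "charted M"
  unfolding charted_def
proof (intro conjI ballI, goal_cases)
  case 1
  show ?case using assms by (simp add: smooth_manifold_def)
next
  case (2 c)
  obtain U x where c: "c = (U, x)" by (cases c)
  have U: "openin (topo M) U" and x: "open (x ` U)"
    and h: "homeomorphic_map (subtopology (topo M) U) (top_of_set (x ` U)) x"
    using assms 2 unfolding smooth_manifold_def c by fast+
  have "inj_on x (topspace (subtopology (topo M) U))"
    using h unfolding homeomorphic_eq_everything_map by blast
  hence "inj_on x U" using openin_subset[OF U] by (simp add: inf_absorb2)
  moreover have "open (x ` W)" if W: "openin (topo M) W" "W \<subseteq> U" for W
  proof -
    have "openin (subtopology (topo M) U) W"
      using W by (simp add: openin_open_subtopology[OF U])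
    hence "openin (top_of_set (x ` U)) (x ` W)"
      using homeomorphic_imp_open_map[OF h] by (simp add: open_map_def)
    thus ?thesis using x openin_open_trans by blast
  qed
  ultimately show ?case using U by (simp add: c)
qed

lemma charted_prod_manifold:
  assumes M: "charted M" and N: "charted N"
  shows "charted (prod_manifold M N)"
  unfolding charted_def
proof (intro conjI ballI, goal_cases)
  case 1
  show ?case
  proof (intro equalityI subsetI)
    fix z assume "z \<in> (\<Union>(U, x)\<in>atlas (prod_manifold M N). U)"
    thus "z \<in> points (prod_manifold M N)"
      using chartedD(5)[OF M] chartedD(5)[OF N] by (fastforce simp: prod_manifold_def)
  next
    fix z assume "z \<in> points (prod_manifold M N)"
    then obtain p q where z: "z = (p, q)" "p \<in> points M" "q \<in> points N"
      by (auto simp: prod_manifold_def)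
    obtain U x V y where "(U, x) \<in> atlas M" "p \<in> U" "(V, y) \<in> atlas N" "q \<in> V"
      using charted_cover[OF M z(2)] charted_cover[OF N z(3)] by blast
    hence "(U \<times> V, map_prod x y) \<in> atlas (prod_manifold M N)" "z \<in> U \<times> V"
      unfolding prod_manifold_def z(1) by auto
    thus "z \<in> (\<Union>(U, x)\<in>atlas (prod_manifold M N). U)" by (intro UN_I) auto
  qed
next
  case (2 c)
  then obtain U x V y where c: "c = (U \<times> V, map_prod x y)"
    and x: "(U, x) \<in> atlas M" and y: "(V, y) \<in> atlas N"
    unfolding prod_manifold_def by auto
  note x' = chartedD[OF M x] and y' = chartedD[OF N y]
  have "open (map_prod x y ` W)" if W: "openin (prod_topology (topo M) (topo N)) W" "W \<subseteq> U \<times> V" for W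
  proof (rule topological_space_class.openI)
    fix z assume "z \<in> map_prod x y ` W"
    then obtain p q where z: "z = (x p, y q)" and pq: "(p, q) \<in> W" by auto
    obtain A B where A: "openin (topo M) A" "p \<in> A" and B: "openin (topo N) B" "q \<in> B"
      and AB: "A \<times> B \<subseteq> W"
      using W(1) pq unfolding openin_prod_topology_alt by blast
    have "A \<subseteq> U" "B \<subseteq> V" using AB W(2) A(2) B(2) by blast+
    hence "open (x ` A \<times> y ` B)" using x'(3)[OF A(1)] y'(3)[OF B(1)] by (simp add: open_Times)
    thus "\<exists>T. open T \<and> z \<in> T \<and> T \<subseteq> map_prod x y ` W"
      using A(2) B(2) AB unfolding z by (intro exI[of _ "x ` A \<times> y ` B"]) (auto simp: image_iff)
  qed
  thus ?case using x'(1,2) y'(1,2)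
    by (auto simp: c prod_manifold_def openin_prod_Times_iff intro: map_prod_inj_on)
qed

lemma charted_open_submanifold:
  assumes M: "charted M" and W: "openin (topo M) W"
  shows "charted (open_submanifold M W)"
  unfolding charted_def
proof (intro conjI ballI, goal_cases)
  case 1
  show ?case
  proof (intro equalityI subsetI)
    fix z assume "z \<in> (\<Union>(U, x)\<in>atlas (open_submanifold M W). U)"
    then obtain U x where "(U, x) \<in> atlas M" "z \<in> U \<inter> W" by (auto simp: open_submanifold_def)
    thus "z \<in> points (open_submanifold M W)"
      using chartedD(5)[OF M] by (auto simp: open_submanifold_def)
  next
    fix z assume "z \<in> points (open_submanifold M W)"
    hence z: "z \<in> points M" "z \<in> W" by (auto simp: open_submanifold_def)
    obtain U x where "(U, x) \<in> atlas M" "z \<in> U" using charted_cover[OF M z(1)] by blast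
    hence "(U \<inter> W, x) \<in> atlas (open_submanifold M W)" "z \<in> U \<inter> W"
      using z(2) by (auto simp: open_submanifold_def)
    thus "z \<in> (\<Union>(U, x)\<in>atlas (open_submanifold M W). U)" by (intro UN_I) auto
  qed
next
  case (2 c)
  then obtain U x where c: "c = (U \<inter> W, x)" and x: "(U, x) \<in> atlas M"
    unfolding open_submanifold_def by auto
  note x' = chartedD[OF M x]
  show ?case using x'(1,2,3) W
    by (auto simp: c open_submanifold_def openin_open_subtopology inj_on_Int)
qed

lemma chart_at:
  assumes "charted M" "p \<in> points M"
  shows "chart_at M p \<in> atlas M" "p \<in> fst (chart_at M p)"
proof -
  obtain U x where "(U, x) \<in> atlas M" "p \<in> U" using charted_cover[OF assms] by blast
  hence "\<exists>c. c \<in> atlas M \<and> p \<in> fst c" by (intro exI[of _ "(U, x)"]) simp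
  from someI_ex[OF this] show "chart_at M p \<in> atlas M" "p \<in> fst (chart_at M p)"
    unfolding chart_at_def by auto
qed

lemma smooth_map_coords:
  assumes M: "charted M" and N: "charted N" and f: "smooth_map M N f"
    and x: "(U, x) \<in> atlas M" and y: "(V, y) \<in> atlas N"
  shows "openin (topo M) (U \<inter> f -` V)" "open (x ` (U \<inter> f -` V))"
    "smooth_on (x ` (U \<inter> f -` V)) (y \<circ> f \<circ> inv_into U x)"
proof -
  have "continuous_map (topo M) (topo N) f" using f by (simp add: smooth_map_def)
  hence "openin (topo M) {p \<in> points M. f p \<in> V}"
    using chartedD(1)[OF N y] openin_continuous_map_preimage by blast
  hence "openin (topo M) (U \<inter> {p \<in> points M. f p \<in> V})" using chartedD(1)[OF M x] by blast
  also have "U \<inter> {p \<in> points M. f p \<in> V} = U \<inter> f -` V" using chartedD(5)[OF M x] by blast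
  finally show op: "openin (topo M) (U \<inter> f -` V)" .
  show "open (x ` (U \<inter> f -` V))" by (rule chartedD(3)[OF M x op]) blast
  show "smooth_on (x ` (U \<inter> f -` V)) (y \<circ> f \<circ> inv_into U x)"
    using f x y unfolding smooth_map_def by blast
qed

lemma smooth_map_image: "smooth_map M N f \<Longrightarrow> p \<in> points M \<Longrightarrow> f p \<in> points N"
  unfolding smooth_map_def by (meson continuous_map_image_subset_topspace image_subset_iff)

lemma smooth_map_ident: "smooth_manifold M \<Longrightarrow> smooth_map M M (\<lambda>p. p)"
  unfolding smooth_manifold_def smooth_map_def
  by (auto simp: o_def vimage_def continuous_map_id[unfolded id_def])

lemma smooth_map_const: "p \<in> points N \<Longrightarrow> smooth_map M N (\<lambda>_. p)"
  unfolding smooth_map_def by (auto simp: o_def smooth_on_const)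

lemma smooth_map_Pair:
  fixes L :: "('l, 'f::findim_inner) manifold"
  assumes L: "charted L" and M: "charted M" and N: "charted N"
    and f: "smooth_map L M f" and g: "smooth_map L N g"
  shows "smooth_map L (prod_manifold M N) (\<lambda>l. (f l, g l))"
  unfolding smooth_map_def
proof (intro conjI, goal_cases)
  case 1
  show ?case using f g by (simp add: smooth_map_def prod_manifold_def continuous_map_paired)
next
  case 2
  show ?case
  proof (clarsimp simp: prod_manifold_def)
    fix W z U x V y assume z: "(W, z) \<in> atlas L" and x: "(U, x) \<in> atlas M" and y: "(V, y) \<in> atlas N"
    let ?S = "W \<inter> (\<lambda>l. (f l, g l)) -` (U \<times> V)"
    note cf = smooth_map_coords[OF L M f z x] and cg = smooth_map_coords[OF L N g z y]
    have "openin (topo L) ((W \<inter> f -` U) \<inter> (W \<inter> g -` V))" using cf(1) cg(1) by blast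
    also have "(W \<inter> f -` U) \<inter> (W \<inter> g -` V) = ?S" by auto
    finally have op: "open (z ` ?S)" by (rule chartedD(3)[OF L z]) blast
    have "smooth_on (z ` ?S) (\<lambda>a. ((x \<circ> f \<circ> inv_into W z) a, (y \<circ> g \<circ> inv_into W z) a))"
      by (intro smooth_on_Pair[OF op] smooth_on_subset[OF cf(3)] smooth_on_subset[OF cg(3)]) auto
    thus "smooth_on (z ` ?S) (map_prod x y \<circ> (\<lambda>l. (f l, g l)) \<circ> inv_into W z)" by (simp add: o_def)
  qed
qed

lemma smooth_map_compose:
  fixes M :: "('a, 'd::findim_inner) manifold" and N :: "('b, 'e::findim_inner) manifold"
    and P :: "('c, 'f::real_normed_vector) manifold"
  assumes M: "charted M" and N: "charted N" and P: "charted P"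
    and f: "smooth_map M N f" and g: "smooth_map N P g"
  shows "smooth_map M P (\<lambda>p. g (f p))"
  unfolding smooth_map_def
proof (intro conjI, goal_cases)
  case 1
  show ?case using f g continuous_map_compose[of "topo M" "topo N" f "topo P" g]
    by (simp add: smooth_map_def o_def)
next
  case 2
  show ?case
  proof clarsimp
    fix U x W z assume x: "(U, x) \<in> atlas M" and z: "(W, z) \<in> atlas P"
    show "smooth_on (x ` (U \<inter> (\<lambda>p. g (f p)) -` W)) (z \<circ> (\<lambda>p. g (f p)) \<circ> inv_into U x)"
    proof (rule smooth_on_local)
      fix a assume "a \<in> x ` (U \<inter> (\<lambda>p. g (f p)) -` W)"
      then obtain p where p: "a = x p" "p \<in> U" "g (f p) \<in> W" by blast
      have "f p \<in> points N" using smooth_map_image[OF f] p(2) chartedD(5)[OF M x] by blast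
      then obtain V y where y: "(V, y) \<in> atlas N" "f p \<in> V" using charted_cover[OF N] by blast
      note cf = smooth_map_coords[OF M N f x y(1)] and cg = smooth_map_coords[OF N P g y(1) z]
      let ?C = "V \<inter> g -` W" and ?T = "x ` (U \<inter> f -` (V \<inter> g -` W))"
      have "openin (topo M) (U \<inter> {p \<in> points M. f p \<in> ?C})"
        by (rule openin_Int[OF chartedD(1)[OF M x] openin_continuous_map_preimage[OF _ cg(1)]])
          (use f in \<open>simp add: smooth_map_def\<close>)
      also have "U \<inter> {p \<in> points M. f p \<in> ?C} = U \<inter> f -` ?C" using chartedD(5)[OF M x] by blast
      finally have op: "open ?T" by (rule chartedD(3)[OF M x]) blast
      have "smooth_on ?T (z \<circ> (\<lambda>p. g (f p)) \<circ> inv_into U x)"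
      proof (rule smooth_on_cong[OF op])
        show "smooth_on ?T (\<lambda>b. (z \<circ> g \<circ> inv_into V y) ((y \<circ> f \<circ> inv_into U x) b))"
          by (rule smooth_on_compose[OF op smooth_on_subset[OF cf(3)] cg(3)])
            (auto simp: inv_into_f_f[OF chartedD(2)[OF M x]])
        show "(z \<circ> g \<circ> inv_into V y) ((y \<circ> f \<circ> inv_into U x) b) = (z \<circ> (\<lambda>p. g (f p)) \<circ> inv_into U x) b"
          if "b \<in> ?T" for b
          using that by (auto simp: inv_into_f_f[OF chartedD(2)[OF M x]] inv_into_f_f[OF chartedD(2)[OF N y(1)]])
      qed
      moreover have "a \<in> ?T" using p y(2) by blast
      ultimately show "\<exists>T. open T \<and> a \<in> T \<and> smooth_on T (z \<circ> (\<lambda>p. g (f p)) \<circ> inv_into U x)"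
        using op by blast
    qed
  qed
qed

lemma smooth_curve_onE:
  assumes "smooth_curve_on M I \<gamma>" "t \<in> I"
  obtains e U x c where "e > 0" "(U, x) \<in> atlas M" "smooth_on (ball t e) c"
    "\<And>s. s \<in> I \<Longrightarrow> s \<in> ball t e \<Longrightarrow> \<gamma> s \<in> U \<and> x (\<gamma> s) = c s"
proof -
  from assms obtain e where e: "e > 0" and ex: "\<exists>(U, x)\<in>atlas M. \<exists>c. smooth_on (ball t e) c \<and>
      (\<forall>s\<in>I \<inter> ball t e. \<gamma> s \<in> U \<and> x (\<gamma> s) = c s)"
    unfolding smooth_curve_on_def by blast
  from ex obtain q where q: "q \<in> atlas M" "case q of (U, x) \<Rightarrow> \<exists>c. smooth_on (ball t e) c \<and>
      (\<forall>s\<in>I \<inter> ball t e. \<gamma> s \<in> U \<and> x (\<gamma> s) = c s)" by blast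
  obtain U x where "q = (U, x)" by (cases q)
  with q obtain c where "(U, x) \<in> atlas M" "smooth_on (ball t e) c"
    "\<forall>s\<in>I \<inter> ball t e. \<gamma> s \<in> U \<and> x (\<gamma> s) = c s" by auto
  thus thesis using that e by blast
qed

lemma smooth_curve_onI:
  assumes "\<And>t. t \<in> I \<Longrightarrow> \<exists>e U x c. e > 0 \<and> (U, x) \<in> atlas M \<and> smooth_on (ball t e) c \<and>
    (\<forall>s\<in>I \<inter> ball t e. \<gamma> s \<in> U \<and> x (\<gamma> s) = c s)"
  shows "smooth_curve_on M I \<gamma>"
  unfolding smooth_curve_on_def
proof (intro ballI)
  fix t assume "t \<in> I"
  from assms[OF this] obtain e U x c where "e > 0" "(U, x) \<in> atlas M" "smooth_on (ball t e) c"
    "\<forall>s\<in>I \<inter> ball t e. \<gamma> s \<in> U \<and> x (\<gamma> s) = c s" by blast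
  thus "\<exists>e>0. \<exists>(U, x)\<in>atlas M. \<exists>c. smooth_on (ball t e) c \<and>
      (\<forall>s\<in>I \<inter> ball t e. \<gamma> s \<in> U \<and> x (\<gamma> s) = c s)"
    by (intro exI[of _ e] conjI bexI[of _ "(U, x)"]) auto
qed

text \<open>
  A smooth curve is only given in some chart around each time. Its image under a smooth map has a
  smooth local representative in every chart around the image point.
\<close>

lemma smooth_curve_on_coords:
  fixes M :: "('a, 'd::findim_inner) manifold" and N :: "('b, 'e::real_normed_vector) manifold"
  assumes M: "charted M" and N: "charted N" and f: "smooth_map M N f"
    and c: "smooth_curve_on M I \<gamma>" and t: "t \<in> I" and y: "(V, y) \<in> atlas N" and fV: "f (\<gamma> t) \<in> V"
  obtains e c where "e > 0" "smooth_on (ball t e) c"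
    "\<And>s. s \<in> I \<Longrightarrow> s \<in> ball t e \<Longrightarrow> \<gamma> s \<in> points M \<and> f (\<gamma> s) \<in> V \<and> y (f (\<gamma> s)) = c s"
proof -
  obtain e0 U x c0 where e0: "e0 > 0" and x: "(U, x) \<in> atlas M" and c0: "smooth_on (ball t e0) c0"
    and c0': "\<And>s. s \<in> I \<Longrightarrow> s \<in> ball t e0 \<Longrightarrow> \<gamma> s \<in> U \<and> x (\<gamma> s) = c0 s"
    by (rule smooth_curve_onE[OF c t]) blast
  note co = smooth_map_coords[OF M N f x y]
  let ?T = "x ` (U \<inter> f -` V)"
  note inj = chartedD(2)[OF M x]
  have t0: "t \<in> ball t e0" using e0 by simp
  have "c0 t \<in> ?T" using c0'[OF t t0] fV by (metis Int_iff imageI vimageI)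
  moreover have "open (ball t e0 \<inter> c0 -` ?T)"
    by (rule continuous_open_preimage[OF smooth_on_continuous[OF c0] open_ball co(2)])
  ultimately obtain e where e: "e > 0" "ball t e \<subseteq> ball t e0 \<inter> c0 -` ?T"
    using t0 by (meson IntI open_contains_ball vimageI)
  show thesis
  proof
    show "e > 0" by (rule e)
    show "smooth_on (ball t e) (\<lambda>s. (y \<circ> f \<circ> inv_into U x) (c0 s))"
      by (rule smooth_on_compose[OF open_ball smooth_on_subset[OF c0] co(3)]) (use e in auto)
    fix s assume s: "s \<in> I" "s \<in> ball t e"
    have g: "\<gamma> s \<in> U" "x (\<gamma> s) = c0 s" using c0'[OF s(1)] s(2) e(2) by auto
    obtain p where "p \<in> U" "f p \<in> V" "c0 s = x p" using e(2) s(2) by blast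
    hence "p = \<gamma> s" using g inj by (auto dest: inj_onD)
    thus "\<gamma> s \<in> points M \<and> f (\<gamma> s) \<in> V \<and> y (f (\<gamma> s)) = (y \<circ> f \<circ> inv_into U x) (c0 s)"
      using g \<open>f p \<in> V\<close> chartedD(5)[OF M x] by (auto simp: g(2)[symmetric] inv_into_f_f[OF inj])
  qed
qed

lemma smooth_curve_on_points:
  assumes "charted M" "smooth_curve_on M I \<gamma>" "t \<in> I"
  shows "\<gamma> t \<in> points M"
proof -
  obtain e U x c where "e > 0" "(U, x) \<in> atlas M" "smooth_on (ball t e) c"
    "\<And>s. s \<in> I \<Longrightarrow> s \<in> ball t e \<Longrightarrow> \<gamma> s \<in> U \<and> x (\<gamma> s) = c s"
    by (rule smooth_curve_onE[OF assms(2,3)]) blast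
  thus ?thesis using chartedD(5)[OF assms(1)] assms(3) by (meson centre_in_ball subsetD)
qed

lemma smooth_curve_on_map:
  fixes M :: "('a, 'd::findim_inner) manifold" and N :: "('b, 'e::real_normed_vector) manifold"
  assumes M: "charted M" and N: "charted N" and f: "smooth_map M N f"
    and c: "smooth_curve_on M I \<gamma>"
  shows "smooth_curve_on N I (\<lambda>s. f (\<gamma> s))"
proof (rule smooth_curve_onI)
  fix t assume t: "t \<in> I"
  have "f (\<gamma> t) \<in> points N" by (rule smooth_map_image[OF f smooth_curve_on_points[OF M c t]])
  then obtain V y where y: "(V, y) \<in> atlas N" "f (\<gamma> t) \<in> V" using charted_cover[OF N] by blast
  obtain e c where "e > 0" "smooth_on (ball t e) c"
    "\<And>s. s \<in> I \<Longrightarrow> s \<in> ball t e \<Longrightarrow> \<gamma> s \<in> points M \<and> f (\<gamma> s) \<in> V \<and> y (f (\<gamma> s)) = c s"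
    by (rule smooth_curve_on_coords[OF M N f c t y]) blast
  thus "\<exists>e U x c. e > 0 \<and> (U, x) \<in> atlas N \<and> smooth_on (ball t e) c \<and>
      (\<forall>s\<in>I \<inter> ball t e. f (\<gamma> s) \<in> U \<and> x (f (\<gamma> s)) = c s)" using y(1) by blast
qed

lemma smooth_curve_on_Pair:
  assumes "smooth_curve_on M I \<gamma>" "smooth_curve_on N I \<delta>"
  shows "smooth_curve_on (prod_manifold M N) I (\<lambda>s. (\<gamma> s, \<delta> s))"
proof (rule smooth_curve_onI)
  fix t assume t: "t \<in> I"
  obtain e U x c where 1: "e > 0" "(U, x) \<in> atlas M" "smooth_on (ball t e) c"
    "\<And>s. s \<in> I \<Longrightarrow> s \<in> ball t e \<Longrightarrow> \<gamma> s \<in> U \<and> x (\<gamma> s) = c s"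
    by (rule smooth_curve_onE[OF assms(1) t]) blast
  obtain e' V y c' where 2: "e' > 0" "(V, y) \<in> atlas N" "smooth_on (ball t e') c'"
    "\<And>s. s \<in> I \<Longrightarrow> s \<in> ball t e' \<Longrightarrow> \<delta> s \<in> V \<and> y (\<delta> s) = c' s"
    by (rule smooth_curve_onE[OF assms(2) t]) blast
  show "\<exists>e U x c. e > 0 \<and> (U, x) \<in> atlas (prod_manifold M N) \<and> smooth_on (ball t e) c \<and>
      (\<forall>s\<in>I \<inter> ball t e. (\<gamma> s, \<delta> s) \<in> U \<and> x (\<gamma> s, \<delta> s) = c s)"
  proof (intro exI conjI)
    show "min e e' > 0" using 1 2 by simp
    show "(U \<times> V, map_prod x y) \<in> atlas (prod_manifold M N)" using 1 2 by (auto simp: prod_manifold_def)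
    show "smooth_on (ball t (min e e')) (\<lambda>s. (c s, c' s))"
      by (intro smooth_on_Pair open_ball smooth_on_subset[OF 1(3)] smooth_on_subset[OF 2(3)]) auto
    show "\<forall>s\<in>I \<inter> ball t (min e e'). (\<gamma> s, \<delta> s) \<in> U \<times> V \<and> map_prod x y (\<gamma> s, \<delta> s) = (c s, c' s)"
      using 1(4) 2(4) by auto
  qed
qed

lemma smooth_curve_on_submanifold:
  assumes "\<And>t. t \<in> I \<Longrightarrow> \<gamma> t \<in> W"
  shows "smooth_curve_on (open_submanifold M W) I \<gamma> \<longleftrightarrow> smooth_curve_on M I \<gamma>"
proof
  assume c: "smooth_curve_on M I \<gamma>"
  show "smooth_curve_on (open_submanifold M W) I \<gamma>"
  proof (rule smooth_curve_onI)
    fix t assume t: "t \<in> I"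
    obtain e U x c where 1: "e > 0" "(U, x) \<in> atlas M" "smooth_on (ball t e) c"
      "\<And>s. s \<in> I \<Longrightarrow> s \<in> ball t e \<Longrightarrow> \<gamma> s \<in> U \<and> x (\<gamma> s) = c s"
      by (rule smooth_curve_onE[OF c t]) blast
    show "\<exists>e U x c. e > 0 \<and> (U, x) \<in> atlas (open_submanifold M W) \<and> smooth_on (ball t e) c \<and>
      (\<forall>s\<in>I \<inter> ball t e. \<gamma> s \<in> U \<and> x (\<gamma> s) = c s)"
      by (intro exI[of _ e] exI[of _ "U \<inter> W"] exI[of _ x] exI[of _ c])
        (use 1 assms in \<open>auto simp: open_submanifold_def\<close>)
  qed
next
  assume c: "smooth_curve_on (open_submanifold M W) I \<gamma>"
  show "smooth_curve_on M I \<gamma>"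
  proof (rule smooth_curve_onI)
    fix t assume t: "t \<in> I"
    obtain e U x c where 1: "e > 0" "(U, x) \<in> atlas (open_submanifold M W)" "smooth_on (ball t e) c"
      "\<And>s. s \<in> I \<Longrightarrow> s \<in> ball t e \<Longrightarrow> \<gamma> s \<in> U \<and> x (\<gamma> s) = c s"
      by (rule smooth_curve_onE[OF c t]) blast
    then obtain U' where "U = U' \<inter> W" "(U', x) \<in> atlas M" by (auto simp: open_submanifold_def)
    thus "\<exists>e U x c. e > 0 \<and> (U, x) \<in> atlas M \<and> smooth_on (ball t e) c \<and>
      (\<forall>s\<in>I \<inter> ball t e. \<gamma> s \<in> U \<and> x (\<gamma> s) = c s)" using 1 by blast
  qed
qed

lemma smooth_curve_on_mono:
  assumes c: "smooth_curve_on M I \<gamma>" and "J \<subseteq> I" "\<And>t. t \<in> J \<Longrightarrow> \<gamma> t = \<delta> t"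
  shows "smooth_curve_on M J \<delta>"
proof (rule smooth_curve_onI)
  fix t assume t: "t \<in> J"
  with assms(2) have tI: "t \<in> I" by blast
  obtain e U x c where "e > 0" "(U, x) \<in> atlas M" "smooth_on (ball t e) c"
    "\<And>s. s \<in> I \<Longrightarrow> s \<in> ball t e \<Longrightarrow> \<gamma> s \<in> U \<and> x (\<gamma> s) = c s"
    by (rule smooth_curve_onE[OF c tI]) blast
  moreover from this have "\<forall>s\<in>J \<inter> ball t e. \<delta> s \<in> U \<and> x (\<delta> s) = c s"
    using assms(2,3) by (metis IntD1 IntD2 subsetD)
  ultimately show "\<exists>e U x c. e > 0 \<and> (U, x) \<in> atlas M \<and> smooth_on (ball t e) c \<and>
      (\<forall>s\<in>J \<inter> ball t e. \<delta> s \<in> U \<and> x (\<delta> s) = c s)" by blast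
qed

lemma smooth_curve_on_chart:
  assumes "(U, x) \<in> atlas M" "inj_on x U" "open J" "smooth_on J c" "c ` J \<subseteq> x ` U" "I \<subseteq> J"
  shows "smooth_curve_on M I (\<lambda>s. inv_into U x (c s))"
proof (rule smooth_curve_onI)
  fix t assume "t \<in> I"
  then obtain e where e: "e > 0" "ball t e \<subseteq> J" using assms(3,6) by (meson open_contains_ball subsetD)
  show "\<exists>e U' x' c'. e > 0 \<and> (U', x') \<in> atlas M \<and> smooth_on (ball t e) c' \<and>
      (\<forall>s\<in>I \<inter> ball t e. inv_into U x (c s) \<in> U' \<and> x' (inv_into U x (c s)) = c' s)"
  proof (intro exI conjI ballI)
    show "e > 0" "(U, x) \<in> atlas M" by (fact e(1), fact assms(1))
    show "smooth_on (ball t e) c" by (rule smooth_on_subset[OF assms(4) e(2)])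
    fix s assume "s \<in> I \<inter> ball t e"
    hence "c s \<in> x ` U" using assms(5,6) by blast
    thus "inv_into U x (c s) \<in> U" "x (inv_into U x (c s)) = c s"
      by (simp_all add: inv_into_into f_inv_into_f)
  qed
qed

lemma smooth_curve_on_continuous:
  assumes M: "charted M" and c: "smooth_curve_on M I \<gamma>"
  shows "continuous_map (top_of_set I) (topo M) \<gamma>"
proof (rule continuous_map_eq_topcontinuous_at[THEN iffD2], intro ballI)
  show "topcontinuous_at (top_of_set I) (topo M) \<gamma> t" if "t \<in> topspace (top_of_set I)" for t
    unfolding topcontinuous_at_def
  proof (intro conjI allI impI)
    show "t \<in> topspace (top_of_set I)" by (rule that)
    have t: "t \<in> I" using that by simp
    show "\<gamma> \<in> topspace (top_of_set I) \<rightarrow> points M"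
      using smooth_curve_on_points[OF M c] by simp
    fix W assume W: "openin (topo M) W \<and> \<gamma> t \<in> W"
    obtain e U x c where 1: "e > 0" "(U, x) \<in> atlas M" "smooth_on (ball t e) c"
      "\<And>s. s \<in> I \<Longrightarrow> s \<in> ball t e \<Longrightarrow> \<gamma> s \<in> U \<and> x (\<gamma> s) = c s"
      by (rule smooth_curve_onE[OF c t]) blast
    have "open (x ` (U \<inter> W))"
      by (rule chartedD(3)[OF M 1(2)]) (use W chartedD(1)[OF M 1(2)] in auto)
    hence op: "open (ball t e \<inter> c -` (x ` (U \<inter> W)))"
      by (rule continuous_open_preimage[OF smooth_on_continuous[OF 1(3)] open_ball])
    have tt: "t \<in> I \<inter> ball t e" using t 1(1) by simp
    have "\<gamma> t \<in> U \<inter> W" "c t = x (\<gamma> t)" using 1(4)[of t] tt W by auto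
    hence "c t \<in> x ` (U \<inter> W)" by simp
    moreover have "\<gamma> s \<in> W" if "s \<in> I \<inter> (ball t e \<inter> c -` (x ` (U \<inter> W)))" for s
    proof -
      have "c s \<in> x ` (U \<inter> W)" using that by simp
      then obtain p where "p \<in> U" "p \<in> W" "c s = x p" by blast
      moreover have "\<gamma> s \<in> U" "x (\<gamma> s) = c s" using 1(4) that by auto
      ultimately show ?thesis using chartedD(2)[OF M 1(2)] by (metis inj_onD)
    qed
    ultimately show "\<exists>V. openin (top_of_set I) V \<and> t \<in> V \<and> (\<forall>y\<in>V. \<gamma> y \<in> W)"
      using tt op by (intro exI[of _ "I \<inter> (ball t e \<inter> c -` (x ` (U \<inter> W)))"]) (auto simp: openin_open)
  qed
qed


section \<open>Velocities and differentials\<close>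

lemma smooth_manifold_transition:
  assumes M: "smooth_manifold M" and x: "(U, x) \<in> atlas M" and y: "(V, y) \<in> atlas M"
    and p: "p \<in> U" "p \<in> V"
  shows "((y \<circ> inv_into U x) has_derivative frechet_derivative (y \<circ> inv_into U x) (at (x p))) (at (x p))"
proof (rule smooth_on_has_derivative)
  show "smooth_on (x ` (U \<inter> V)) (y \<circ> inv_into U x)"
    using M x y unfolding smooth_manifold_def by blast
qed (use p in auto)

lemma tangent_of_coords_has_derivative:
  assumes M: "smooth_manifold M" and x: "(U, x) \<in> atlas M" and p: "p \<in> U"
  shows "((coord_at M p \<circ> inv_into U x) has_derivative tangent_of_coords M (U, x) p) (at (x p))"
proof -
  have "p \<in> points M" using chartedD(5)[OF smooth_manifold_charted[OF M] x] p by blast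
  note ca = chart_at[OF smooth_manifold_charted[OF M] this]
  have "((coord_at M p \<circ> inv_into U x) has_derivative
      frechet_derivative (coord_at M p \<circ> inv_into U x) (at (x p))) (at (x p))"
    by (rule smooth_manifold_transition[OF M x _ p ca(2)]) (use ca in simp)
  moreover have "tangent_of_coords M (U, x) p = frechet_derivative (coord_at M p \<circ> inv_into U x) (at (x p))"
    by (rule ext) simp
  ultimately show ?thesis by simp
qed

text \<open>
  Velocities are by definition computed in the chart chosen at the point; this computes them from a
  representative of the curve in any other chart.
\<close>

lemma velocity_in_chart:
  assumes M: "smooth_manifold M" and x: "(U, x) \<in> atlas M" and t: "t \<in> J" and e: "e > 0"
    and g: "\<And>s. s \<in> J \<Longrightarrow> s \<in> ball t e \<Longrightarrow> \<gamma> s \<in> U \<and> x (\<gamma> s) = c s"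
    and c: "(c has_vector_derivative d) (at t within J)"
  shows "((coord_at M (\<gamma> t) \<circ> \<gamma>) has_vector_derivative tangent_of_coords M (U, x) (\<gamma> t) d) (at t within J)"
proof -
  have gt: "\<gamma> t \<in> U" "x (\<gamma> t) = c t" using g[OF t] e by auto
  have "((coord_at M (\<gamma> t) \<circ> inv_into U x) \<circ> c has_vector_derivative
      tangent_of_coords M (U, x) (\<gamma> t) d) (at t within J)"
    by (rule vector_derivative_diff_chain_within[OF c
          has_derivative_at_withinI[OF tangent_of_coords_has_derivative[OF M x gt(1), unfolded gt(2)]]])
  thus ?thesis
  proof (rule has_vector_derivative_transform_within[OF _ e t])
    fix s assume s: "s \<in> J" "dist s t < e"
    hence "\<gamma> s \<in> U" "x (\<gamma> s) = c s" using g[of s] by (auto simp: dist_commute)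
    thus "((coord_at M (\<gamma> t) \<circ> inv_into U x) \<circ> c) s = (coord_at M (\<gamma> t) \<circ> \<gamma>) s"
      using inv_into_f_f[OF chartedD(2)[OF smooth_manifold_charted[OF M] x]] by (metis comp_apply)
  qed
qed

lemma differential_has_derivative:
  assumes M: "charted M" and N: "charted N" and f: "smooth_map M N f" and p: "p \<in> points M"
  shows "((coord_at N (f p) \<circ> f \<circ> inv_into (fst (chart_at M p)) (coord_at M p))
    has_derivative differential M N f p) (at (coord_at M p p))"
proof -
  note cp = chart_at[OF M p] and cf = chart_at[OF N smooth_map_image[OF f p]]
  have x: "(fst (chart_at M p), coord_at M p) \<in> atlas M"
    and y: "(fst (chart_at N (f p)), coord_at N (f p)) \<in> atlas N" using cp cf by simp_all
  show ?thesis unfolding differential_def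
    by (rule smooth_on_has_derivative[OF smooth_map_coords(3)[OF M N f x y]]) (use cp cf in auto)
qed

lemma velocity_image:
  assumes M: "charted M" and N: "charted N" and f: "smooth_map M N f"
    and t: "t \<in> J" and cont: "continuous_map (top_of_set J) (topo M) \<gamma>"
    and v: "((coord_at M (\<gamma> t) \<circ> \<gamma>) has_vector_derivative v) (at t within J)"
  shows "((coord_at N (f (\<gamma> t)) \<circ> (\<lambda>s. f (\<gamma> s))) has_vector_derivative differential M N f (\<gamma> t) v) (at t within J)"
proof -
  let ?p = "\<gamma> t"
  have p: "?p \<in> points M"
    using continuous_map_image_subset_topspace[OF cont] t by auto
  define U x where "U = fst (chart_at M ?p)" and "x = coord_at M ?p"
  have x: "(U, x) \<in> atlas M" "?p \<in> U" using chart_at[OF M p] by (simp_all add: U_def x_def)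
  have "openin (top_of_set J) {s \<in> topspace (top_of_set J). \<gamma> s \<in> U}"
    by (rule openin_continuous_map_preimage[OF cont chartedD(1)[OF M x(1)]])
  then obtain T where T: "open T" "{s \<in> J. \<gamma> s \<in> U} = J \<inter> T" by (auto simp: openin_open)
  have "t \<in> T" using T(2) t x(2) by blast
  then obtain e where e: "e > 0" "ball t e \<subseteq> T" using T(1) open_contains_ball by blast
  have "((coord_at N (f ?p) \<circ> f \<circ> inv_into U x) has_derivative differential M N f ?p) (at ((x \<circ> \<gamma>) t) within S)"
    for S
    using has_derivative_at_withinI[OF differential_has_derivative[OF M N f p]]
    unfolding U_def x_def comp_apply[of _ \<gamma> t] .
  hence "((coord_at N (f ?p) \<circ> f \<circ> inv_into U x) \<circ> (x \<circ> \<gamma>) has_vector_derivative differential M N f ?p v)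
      (at t within J)"
    by (rule vector_derivative_diff_chain_within[OF v[folded x_def]])
  thus ?thesis
  proof (rule has_vector_derivative_transform_within[OF _ e(1) t])
    fix s assume "s \<in> J" "dist s t < e"
    hence "s \<in> J \<inter> T" using e(2) by (auto simp: dist_commute)
    hence "\<gamma> s \<in> U" using T(2) by blast
    thus "((coord_at N (f ?p) \<circ> f \<circ> inv_into U x) \<circ> (x \<circ> \<gamma>)) s = (coord_at N (f ?p) \<circ> (\<lambda>s. f (\<gamma> s))) s"
      using inv_into_f_f[OF chartedD(2)[OF M x(1)]] by simp
  qed
qed

definition form_in_chart ::
  "('a, 'e::real_normed_vector) manifold \<Rightarrow> ('a, 'e) chart \<Rightarrow> ('a \<Rightarrow> 'e \<Rightarrow> 'v) \<Rightarrow> 'e \<Rightarrow> 'e \<Rightarrow> 'v" where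
  "form_in_chart M c \<omega> z v =
     \<omega> (inv_into (fst c) (snd c) z) (tangent_of_coords M c (inv_into (fst c) (snd c) z) v)"

lemma form_in_chart:
  assumes M: "smooth_manifold M" and w: "one_form M \<omega>" and x: "(U, x) \<in> atlas M"
  shows smooth_form_in_chart: "smooth_on (x ` U) (\<lambda>z. form_in_chart M (U, x) \<omega> z v)"
    and linear_form_in_chart: "z \<in> x ` U \<Longrightarrow> linear (form_in_chart M (U, x) \<omega> z)"
proof -
  show "smooth_on (x ` U) (\<lambda>z. form_in_chart M (U, x) \<omega> z v)"
    using w x unfolding one_form_def form_in_chart_def Let_def by auto
  assume z: "z \<in> x ` U"
  define p where "p = inv_into U x z"
  have p: "p \<in> U" "x p = z" using z by (simp_all add: p_def inv_into_into f_inv_into_f)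
  have "linear (\<omega> p)"
    using w p chartedD(5)[OF smooth_manifold_charted[OF M] x] unfolding one_form_def by blast
  moreover have "linear (tangent_of_coords M (U, x) p)"
    using has_derivative_linear[OF tangent_of_coords_has_derivative[OF M x p(1)]] .
  ultimately have "linear (\<omega> p \<circ> tangent_of_coords M (U, x) p)" by (intro linear_compose)
  thus "linear (form_in_chart M (U, x) \<omega> z)"
    by (simp add: form_in_chart_def[abs_def] p_def o_def del: tangent_of_coords.simps)
qed


section \<open>Countably many lower-dimensional images have empty interior\<close>

text \<open>
  A finite type with one element more than an orthonormal basis of \<open>'a\<close>, so that \<open>real ^ 'a basis_index\<close>
  is a Euclidean space isomorphic to \<open>'a \<times> \<real>\<close>. The extra index keeps the type nonempty when \<open>'a\<close> has
  dimension zero.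
\<close>

typedef (overloaded) 'a basis_index = "insert None (Some ` (onb :: 'a::findim_inner set))"
  by blast

lemma UNIV_basis_index:
  "(UNIV :: 'a::findim_inner basis_index set) = Abs_basis_index ` insert None (Some ` onb)"
  using type_definition.Abs_image[OF type_definition_basis_index] by blast

instance basis_index :: (findim_inner) finite
  by standard (simp add: UNIV_basis_index finite_onb)

lemma card_basis_index: "CARD('a::findim_inner basis_index) = Suc (card (onb :: 'a set))"
proof -
  have "CARD('a basis_index) = card (insert None (Some ` (onb :: 'a set)))"
    by (rule type_definition.card[OF type_definition_basis_index])
  also have "\<dots> = Suc (card (Some ` (onb :: 'a set)))"
    by (rule card_insert_disjoint) (auto simp: finite_onb)
  finally show ?thesis by (simp add: card_image)
qed

definition to_cart :: "'a::findim_inner \<times> real \<Rightarrow> real ^ 'a basis_index" where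
  "to_cart p = (\<chi> i. case Rep_basis_index i of None \<Rightarrow> snd p | Some u \<Rightarrow> inner (fst p) u)"

definition of_cart :: "real ^ 'a basis_index \<Rightarrow> 'a::findim_inner \<times> real" where
  "of_cart z = (\<Sum>u\<in>onb. (z $ Abs_basis_index (Some u)) *\<^sub>R u, z $ Abs_basis_index None)"

lemma linear_to_cart: "linear to_cart"
proof (rule linearI)
  show "to_cart (p + q) = to_cart p + to_cart q" for p q :: "'a \<times> real"
    by (simp add: to_cart_def vec_eq_iff inner_add_left split: option.split)
  show "to_cart (c *\<^sub>R p) = c *\<^sub>R to_cart p" for c and p :: "'a \<times> real"
    by (simp add: to_cart_def vec_eq_iff split: option.split)
qed

lemma linear_of_cart: "linear of_cart"
  by (rule linearI) (simp_all add: of_cart_def scaleR_add_left sum.distrib scaleR_sum_right)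

lemma of_cart_to_cart: "of_cart (to_cart p) = p"
  by (cases p) (simp add: to_cart_def of_cart_def Abs_basis_index_inverse onb_expansion)

lemma to_cart_of_cart: "to_cart (of_cart z) = z"
proof -
  have "(case Rep_basis_index i of None \<Rightarrow> z $ Abs_basis_index None
      | Some v \<Rightarrow> inner (\<Sum>u\<in>onb. (z $ Abs_basis_index (Some u)) *\<^sub>R u) v) = z $ i" for i
  proof (cases "Rep_basis_index i")
    case None
    thus ?thesis by (metis Rep_basis_index_inverse option.simps(4))
  next
    case (Some v)
    hence "v \<in> onb" using Rep_basis_index[of i] by auto
    thus ?thesis using Some by (simp add: inner_sum_onb) (metis Rep_basis_index_inverse)
  qed
  thus ?thesis unfolding to_cart_def of_cart_def vec_eq_iff fst_conv snd_conv vec_lambda_beta by blast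
qed

text \<open>
  Differentiable images of lower-dimensional sets are negligible, hence so are their countable unions.
  Negligibility refers to the class \<^class>\<open>euclidean_space\<close>, into which \<open>to_cart\<close> transports both
  spaces; the extra factor \<open>\<real>\<close> shifts both dimensions by one.
\<close>

lemma countable_lowdim_images_empty_interior:
  fixes f :: "'i \<Rightarrow> 'a::findim_inner \<Rightarrow> 'b::findim_inner"
  assumes I: "countable I" and card: "card (onb :: 'a set) < card (onb :: 'b set)"
    and diff: "\<And>i x. i \<in> I \<Longrightarrow> x \<in> S i \<Longrightarrow> f i differentiable (at x)"
    and T: "open T" "T \<subseteq> (\<Union>i\<in>I. f i ` S i)"
  shows "T = {}"
proof (rule ccontr)
  assume "T \<noteq> {}"
  define h where "h i z = to_cart (f i (fst (of_cart z)), snd (of_cart z))"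
    for i and z :: "real ^ 'a basis_index"
  define S' where "S' i = {z :: real ^ 'a basis_index. fst (of_cart z) \<in> S i}" for i
  have bl: "bounded_linear (of_cart :: real ^ 'c::findim_inner basis_index \<Rightarrow> _)"
    by (rule linear_bounded_linear[OF linear_of_cart])
  have neg: "negligible (h i ` S' i)" if i: "i \<in> I" for i
  proof (rule negligible_differentiable_image_lowdim)
    show "DIM(real ^ 'a basis_index) < DIM(real ^ 'b basis_index)"
      using card by (simp add: card_basis_index)
    show "h i differentiable_on S' i"
      unfolding differentiable_on_def
    proof
      fix z assume "z \<in> S' i"
      then obtain D where D: "(f i has_derivative D) (at (fst (of_cart z)))"
        using diff[OF i] by (auto simp: S'_def differentiable_def)
      have 1: "((\<lambda>z. fst (of_cart z)) has_derivative (\<lambda>v. fst (of_cart v))) (at z)"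
        by (intro has_derivative_fst bounded_linear_imp_has_derivative bl)
      have 2: "((\<lambda>z. snd (of_cart z)) has_derivative (\<lambda>v. snd (of_cart v))) (at z)"
        by (intro has_derivative_snd bounded_linear_imp_has_derivative bl)
      have "((\<lambda>z. (f i (fst (of_cart z)), snd (of_cart z))) has_derivative
          (\<lambda>v. (D (fst (of_cart v)), snd (of_cart v)))) (at z)"
        by (rule has_derivative_Pair[OF has_derivative_compose[OF 1 D] 2])
      from bounded_linear.has_derivative[OF linear_bounded_linear[OF linear_to_cart] this]
      have "h i differentiable (at z)" unfolding h_def differentiable_def by blast
      thus "h i differentiable (at z within S' i)" by (rule differentiable_at_withinI)
    qed
  qed
  let ?T = "of_cart -` (T \<times> UNIV)"
  have "negligible (\<Union>((\<lambda>i. h i ` S' i) ` I))"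
    using I neg by (intro negligible_countable_Union) auto
  moreover have "?T \<subseteq> \<Union>((\<lambda>i. h i ` S' i) ` I)"
  proof
    fix z assume z: "z \<in> ?T"
    then obtain i x where i: "i \<in> I" "x \<in> S i" "fst (of_cart z) = f i x" using T(2) by auto
    let ?z = "to_cart (x, snd (of_cart z))"
    have "?z \<in> S' i" using i(2) by (simp add: S'_def of_cart_to_cart)
    moreover have "h i ?z = to_cart (of_cart z)"
      by (simp add: h_def of_cart_to_cart i(3)[symmetric])
    ultimately show "z \<in> \<Union>((\<lambda>i. h i ` S' i) ` I)"
      using i(1) by (auto simp: to_cart_of_cart intro!: bexI[of _ i] image_eqI[of _ _ ?z])
  qed
  ultimately have "negligible ?T" by (rule negligible_subset)
  moreover have "open ?T"
    by (rule open_vimage) (use T(1) in \<open>auto intro!: open_Times linear_continuous_on bl\<close>)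
  moreover have "?T \<noteq> {}"
  proof -
    obtain x where "x \<in> T" using \<open>T \<noteq> {}\<close> by blast
    hence "to_cart (x, 0) \<in> ?T" by (simp add: of_cart_to_cart)
    thus ?thesis by blast
  qed
  ultimately show False using open_not_negligible by blast
qed


section \<open>Actions and semi-torsors\<close>

lemma G_manifoldD:
  assumes "G_manifold G GM B act"
  shows "group G" "smooth_manifold GM" "points GM = carrier G" "smooth_manifold B"
    "group_action G (points B) act" "smooth_map (prod_manifold GM B) B (\<lambda>(g, b). act g b)"
    "charted GM" "charted B"
  using assms smooth_manifold_charted unfolding G_manifold_def lie_group_def by auto

lemma act_one:
  assumes "G_manifold G GM B act" "b \<in> points B"
  shows "act \<one>\<^bsub>G\<^esub> b = b"
  using group_action.id_eq_one[OF G_manifoldD(5)[OF assms(1)]] assms(2) by (metis restrict_apply')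

lemma act_mult:
  assumes "G_manifold G GM B act" "b \<in> points B" "g \<in> carrier G" "h \<in> carrier G"
  shows "act (g \<otimes>\<^bsub>G\<^esub> h) b = act g (act h b)"
  by (rule group_action.composition_rule[OF G_manifoldD(5)[OF assms(1)] assms(2-4)])

lemma act_points:
  assumes "G_manifold G GM B act" "b \<in> points B" "g \<in> carrier G"
  shows "act g b \<in> points B"
  using group_action.element_image[OF G_manifoldD(5)[OF assms(1)] assms(3,2)] by blast

lemma act_inv:
  assumes "G_manifold G GM B act" "b \<in> points B" "g \<in> carrier G"
  shows "act (inv\<^bsub>G\<^esub> g) (act g b) = b"
  using group_action.orbit_sym_aux[OF G_manifoldD(5)[OF assms(1)] assms(3,2)] by blast

lemma smooth_map_act:
  assumes G: "G_manifold G GM B act" and g: "g \<in> carrier G"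
  shows "smooth_map B B (act g)"
proof -
  note G' = G_manifoldD[OF G]
  have "smooth_map B (prod_manifold GM B) (\<lambda>b. (g, b))"
    by (rule smooth_map_Pair[OF G'(8,7,8) smooth_map_const smooth_map_ident[OF G'(4)]]) (use g G'(3) in simp)
  from smooth_map_compose[OF G'(8) charted_prod_manifold[OF G'(7,8)] G'(8) this G'(6)]
  show ?thesis by simp
qed

lemma smooth_map_orbit_map:
  assumes G: "G_manifold G GM B act" and b: "b \<in> points B"
  shows "smooth_map GM B (\<lambda>g. act g b)"
proof -
  note G' = G_manifoldD[OF G]
  have "smooth_map GM (prod_manifold GM B) (\<lambda>g. (g, b))"
    by (rule smooth_map_Pair[OF G'(7,7,8) smooth_map_ident[OF G'(2)] smooth_map_const[OF b]])
  from smooth_map_compose[OF G'(7) charted_prod_manifold[OF G'(7,8)] G'(8) this G'(6)]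
  show ?thesis by simp
qed

text \<open>
  An orbit is the preimage of one point of the discrete orbit space.
\<close>

lemma semi_torsor_orbit_open:
  assumes F: "semi_torsor G GM F act" and f: "f \<in> points F"
  shows "openin (topo F) (orbit G act f)" "f \<in> orbit G act f"
proof -
  have G: "G_manifold G GM F act" using F by (simp add: semi_torsor_def)
  interpret group_action G "points F" act by (rule G_manifoldD(5)[OF G])
  have q: "quotient_map (topo F) (discrete_topology (orbits G (points F) act)) (orbit G act)"
    using F by (simp add: semi_torsor_def)
  have "openin (topo F) {f' \<in> points F. orbit G act f' \<in> {orbit G act f}}"
    by (rule openin_continuous_map_preimage[OF quotient_imp_continuous_map[OF q]])
      (use f in \<open>auto simp: orbits_def\<close>)
  also have "{f' \<in> points F. orbit G act f' \<in> {orbit G act f}} = orbit G act f"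
  proof (intro equalityI subsetI)
    fix f' assume "f' \<in> {f' \<in> points F. orbit G act f' \<in> {orbit G act f}}"
    thus "f' \<in> orbit G act f" using orbit_refl by auto
  next
    fix f' assume f': "f' \<in> orbit G act f"
    have p: "f' \<in> points F" using f' f act_points[OF G] by (auto simp: orbit_def)
    have "orbit G act f' = orbit G act f"
    proof (intro equalityI subsetI)
      fix h assume h: "h \<in> orbit G act f'"
      hence "h \<in> points F" using p act_points[OF G] by (auto simp: orbit_def)
      thus "h \<in> orbit G act f" using orbit_trans[OF f p _ f' h] by blast
    next
      fix h assume h: "h \<in> orbit G act f"
      hence "h \<in> points F" using f act_points[OF G] by (auto simp: orbit_def)
      thus "h \<in> orbit G act f'" using orbit_trans[OF p f _ orbit_sym[OF f p f'] h] by blast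
    qed
    thus "f' \<in> {f' \<in> points F. orbit G act f' \<in> {orbit G act f}}" using p by simp
  qed
  finally show "openin (topo F) (orbit G act f)" .
  show "f \<in> orbit G act f" by (rule orbit_refl[OF f])
qed

text \<open>
  If \<open>G\<close> had smaller dimension than \<open>F\<close>, the open orbit of \<open>f\<close> would be covered, by second
  countability of \<open>G\<close>, by countably many smooth images of chart domains of lower dimension.
\<close>

lemma semi_torsor_dim_le:
  fixes GM :: "('g, 'eg::findim_inner) manifold" and F :: "('f, 'ef::findim_inner) manifold"
  assumes F: "semi_torsor G GM F act" and f: "f \<in> points F"
  shows "card (onb :: 'ef set) \<le> card (onb :: 'eg set)"
proof (rule ccontr)
  assume "\<not> card (onb :: 'ef set) \<le> card (onb :: 'eg set)"
  hence less: "card (onb :: 'eg set) < card (onb :: 'ef set)" by simp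
  have G: "G_manifold G GM F act" using F by (simp add: semi_torsor_def)
  note G' = G_manifoldD[OF G]
  obtain V y where y: "(V, y) \<in> atlas F" "f \<in> V" using charted_cover[OF G'(8) f] by blast
  define \<theta> where "\<theta> = (\<lambda>g. act g f)"
  have \<theta>: "smooth_map GM F \<theta>" unfolding \<theta>_def by (rule smooth_map_orbit_map[OF G f])
  note orb = semi_torsor_orbit_open[OF F f]
  let ?T = "y ` (V \<inter> orbit G act f)"
  have "open ?T" using chartedD(3)[OF G'(8) y(1)] chartedD(1)[OF G'(8) y(1)] orb(1) by blast
  have lind: "Lindelof_space (topo GM)"
    using G'(2) second_countable_imp_Lindelof_space by (auto simp: smooth_manifold_def)
  have "\<Union>(fst ` atlas GM) = points GM"
  proof (intro equalityI subsetI)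
    fix g assume "g \<in> \<Union>(fst ` atlas GM)"
    then obtain U x where "(U, x) \<in> atlas GM" "g \<in> U" by auto
    thus "g \<in> points GM" using chartedD(5)[OF G'(7)] by blast
  next
    fix g assume "g \<in> points GM"
    then obtain U x where "(U, x) \<in> atlas GM" "g \<in> U" using charted_cover[OF G'(7)] by blast
    thus "g \<in> \<Union>(fst ` atlas GM)" by (auto intro!: bexI[of _ "(U, x)"])
  qed
  moreover have "\<forall>U\<in>fst ` atlas GM. openin (topo GM) U" using chartedD(1)[OF G'(7)] by auto
  ultimately obtain \<V> where V: "countable \<V>" "\<V> \<subseteq> fst ` atlas GM" "\<Union>\<V> = points GM"
    using lind[unfolded Lindelof_space_def, THEN spec, of "fst ` atlas GM"] by (elim impE conjE exE) simp_all
  have "\<forall>U\<in>\<V>. \<exists>x. (U, x) \<in> atlas GM" using V(2) by fastforce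
  then obtain x where x: "\<And>U. U \<in> \<V> \<Longrightarrow> (U, x U) \<in> atlas GM" by metis
  have "?T = {}"
  proof (rule countable_lowdim_images_empty_interior[OF V(1) less])
    show "(y \<circ> \<theta> \<circ> inv_into U (x U)) differentiable (at a)" if "U \<in> \<V>" "a \<in> x U ` (U \<inter> \<theta> -` V)" for U a
      using smooth_on_has_derivative[OF smooth_map_coords(3)[OF G'(7,8) \<theta> x[OF that(1)] y(1)] that(2)]
      by (auto simp: differentiable_def)
    show "?T \<subseteq> (\<Union>U\<in>\<V>. (y \<circ> \<theta> \<circ> inv_into U (x U)) ` (x U ` (U \<inter> \<theta> -` V)))"
    proof
      fix z assume "z \<in> ?T"
      then obtain g where g: "g \<in> carrier G" "\<theta> g \<in> V" "z = y (\<theta> g)"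
        by (auto simp: orbit_def \<theta>_def)
      then obtain U where U: "U \<in> \<V>" "g \<in> U" using V(3) G'(3) by blast
      have "(y \<circ> \<theta> \<circ> inv_into U (x U)) (x U g) = z"
        using g(3) inv_into_f_f[OF chartedD(2)[OF G'(7) x[OF U(1)]] U(2)] by simp
      thus "z \<in> (\<Union>U\<in>\<V>. (y \<circ> \<theta> \<circ> inv_into U (x U)) ` (x U ` (U \<inter> \<theta> -` V)))"
        using U g(2) by (intro UN_I[OF U(1)] image_eqI[of _ _ "x U g"]) auto
    qed
    show "open ?T" by fact
  qed
  moreover have "y f \<in> ?T" using y(2) orb(2) by blast
  ultimately show False by blast
qed


section \<open>The action in charts\<close>

text \<open>Around the identity, the group is always parametrized by the chart that defines its Lie algebra.\<close>

definition act_in_charts ::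
  "('g, 'r) monoid_scheme \<Rightarrow> ('g, 'eg) manifold \<Rightarrow> ('b, 'eb) chart \<Rightarrow> ('g \<Rightarrow> 'b \<Rightarrow> 'b) \<Rightarrow> 'eg \<times> 'eb \<Rightarrow> 'eb" where
  "act_in_charts G GM c act = snd c \<circ> (\<lambda>(g, b). act g b) \<circ>
     inv_into (fst (chart_at GM \<one>\<^bsub>G\<^esub>) \<times> fst c) (map_prod (coord_at GM \<one>\<^bsub>G\<^esub>) (snd c))"

text \<open>
  The partial derivative of the action in the group variable at the identity.
\<close>

definition inf_act_in_charts ::
  "('g, 'r) monoid_scheme \<Rightarrow> ('g, 'eg::real_normed_vector) manifold \<Rightarrow> ('b, 'eb::real_normed_vector) chart \<Rightarrow>
    ('g \<Rightarrow> 'b \<Rightarrow> 'b) \<Rightarrow> 'eb \<Rightarrow> 'eg \<Rightarrow> 'eb" where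
  "inf_act_in_charts G GM c act z v =
     frechet_derivative (act_in_charts G GM c act) (at (coord_at GM \<one>\<^bsub>G\<^esub> \<one>\<^bsub>G\<^esub>, z)) (v, 0)"

lemma act_in_charts:
  assumes G: "G_manifold G GM B act" and x: "(U, x) \<in> atlas B"
  obtains A where "open A" "smooth_on A (act_in_charts G GM (U, x) act)"
    and "\<And>b. b \<in> U \<Longrightarrow> (coord_at GM \<one>\<^bsub>G\<^esub> \<one>\<^bsub>G\<^esub>, x b) \<in> A"
    and "\<And>\<zeta> b. (\<zeta>, x b) \<in> A \<Longrightarrow> b \<in> U \<Longrightarrow> \<exists>g\<in>carrier G. act g b \<in> U \<and>
      inv_into (fst (chart_at GM \<one>\<^bsub>G\<^esub>)) (coord_at GM \<one>\<^bsub>G\<^esub>) \<zeta> = g \<and>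
      act_in_charts G GM (U, x) act (\<zeta>, x b) = x (act g b)"
proof -
  note G' = G_manifoldD[OF G]
  have one: "\<one>\<^bsub>G\<^esub> \<in> points GM" using G'(1,3) by (simp add: group.is_monoid)
  define Ug xg where "Ug = fst (chart_at GM \<one>\<^bsub>G\<^esub>)" and "xg = coord_at GM \<one>\<^bsub>G\<^esub>"
  have xg: "(Ug, xg) \<in> atlas GM" "\<one>\<^bsub>G\<^esub> \<in> Ug"
    using chart_at[OF G'(7) one] by (simp_all add: Ug_def xg_def)
  note Ig = chartedD(2)[OF G'(7) xg(1)] and Ix = chartedD(2)[OF G'(8) x]
  have pr: "(Ug \<times> U, map_prod xg x) \<in> atlas (prod_manifold GM B)"
    using xg x by (auto simp: prod_manifold_def)
  note co = smooth_map_coords[OF charted_prod_manifold[OF G'(7,8)] G'(8,6) pr x]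
  let ?A = "map_prod xg x ` (Ug \<times> U \<inter> (\<lambda>(g, b). act g b) -` U)"
  have eq: "act_in_charts G GM (U, x) act = x \<circ> (\<lambda>(g, b). act g b) \<circ> inv_into (Ug \<times> U) (map_prod xg x)"
    by (simp add: act_in_charts_def Ug_def xg_def)
  show thesis
  proof (rule that[of ?A, folded xg_def Ug_def])
    show "open ?A" by (rule co(2))
    show "smooth_on ?A (act_in_charts G GM (U, x) act)" unfolding eq by (rule co(3))
    show "(xg \<one>\<^bsub>G\<^esub>, x b) \<in> ?A" if b: "b \<in> U" for b
    proof (rule image_eqI[of _ _ "(\<one>\<^bsub>G\<^esub>, b)"])
      have "act \<one>\<^bsub>G\<^esub> b = b" using act_one[OF G] b chartedD(5)[OF G'(8) x] by blast
      thus "(\<one>\<^bsub>G\<^esub>, b) \<in> Ug \<times> U \<inter> (\<lambda>(g, b). act g b) -` U" using b xg(2) by simp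
    qed simp
    fix \<zeta> b assume "(\<zeta>, x b) \<in> ?A" and b: "b \<in> U"
    then obtain g b' where g: "g \<in> Ug" "b' \<in> U" "act g b' \<in> U" "\<zeta> = xg g" "x b = x b'" by auto
    have "b' = b" using inj_onD[OF Ix g(5)] g(2) b by simp
    moreover have "inv_into Ug xg \<zeta> = g" using g(1,4) by (simp add: inv_into_f_f[OF Ig])
    moreover have "inv_into (Ug \<times> U) (map_prod xg x) (map_prod xg x (g, b)) = (g, b)"
      by (rule inv_into_f_f[OF map_prod_inj_on[OF Ig Ix]]) (use g(1) b in simp)
    hence "inv_into (Ug \<times> U) (map_prod xg x) (\<zeta>, x b) = (g, b)" by (simp add: g(4))
    moreover have "g \<in> carrier G" using chartedD(5)[OF G'(7) xg(1)] g(1) G'(3) by blast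
    ultimately show "\<exists>g\<in>carrier G. act g b \<in> U \<and> inv_into Ug xg \<zeta> = g \<and>
        act_in_charts G GM (U, x) act (\<zeta>, x b) = x (act g b)"
      using g(3) by (auto simp: eq)
  qed
qed

lemma act_in_charts_one:
  assumes G: "G_manifold G GM B act" and x: "(U, x) \<in> atlas B" and b: "b \<in> U"
  shows "act_in_charts G GM (U, x) act (coord_at GM \<one>\<^bsub>G\<^esub> \<one>\<^bsub>G\<^esub>, x b) = x b"
proof -
  note G' = G_manifoldD[OF G]
  define Ug xg where "Ug = fst (chart_at GM \<one>\<^bsub>G\<^esub>)" and "xg = coord_at GM \<one>\<^bsub>G\<^esub>"
  have "\<one>\<^bsub>G\<^esub> \<in> points GM" using G'(1,3) by (simp add: group.is_monoid)
  from chart_at[OF G'(7) this] have "(Ug, xg) \<in> atlas GM" "\<one>\<^bsub>G\<^esub> \<in> Ug"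
    by (simp_all add: Ug_def xg_def)
  hence "inv_into Ug xg (xg \<one>\<^bsub>G\<^esub>) = \<one>\<^bsub>G\<^esub>" using chartedD(2)[OF G'(7)] by (simp add: inv_into_f_f)
  moreover have "act \<one>\<^bsub>G\<^esub> b = b" using act_one[OF G] b chartedD(5)[OF G'(8) x] by blast
  moreover obtain g where "inv_into Ug xg (xg \<one>\<^bsub>G\<^esub>) = g"
    "act_in_charts G GM (U, x) act (xg \<one>\<^bsub>G\<^esub>, x b) = x (act g b)"
    unfolding Ug_def xg_def by (rule act_in_charts[OF G x]) (use b in blast)
  ultimately show ?thesis unfolding xg_def by simp
qed

lemma act_in_charts_partial_derivative:
  assumes G: "G_manifold G GM B act" and x: "(U, x) \<in> atlas B" and b: "b \<in> U"
  shows "((\<lambda>\<zeta>. act_in_charts G GM (U, x) act (\<zeta>, x b)) has_derivative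
    inf_act_in_charts G GM (U, x) act (x b)) (at (coord_at GM \<one>\<^bsub>G\<^esub> \<one>\<^bsub>G\<^esub>))"
proof -
  let ?e = "coord_at GM \<one>\<^bsub>G\<^esub> \<one>\<^bsub>G\<^esub>"
  obtain A where A: "open A" "smooth_on A (act_in_charts G GM (U, x) act)" "(?e, x b) \<in> A"
    by (rule act_in_charts[OF G x]) (use b in blast)
  have 1: "((\<lambda>\<zeta>. (\<zeta>, x b)) has_derivative (\<lambda>v. (v, 0))) (at ?e)"
    by (intro has_derivative_Pair has_derivative_ident has_derivative_const)
  show ?thesis
    unfolding inf_act_in_charts_def[abs_def]
    by (rule has_derivative_compose[OF 1]) (rule smooth_on_has_derivative[OF A(2,3)])
qed

lemma linear_inf_act_in_charts:
  assumes G: "G_manifold G GM B act" and x: "(U, x) \<in> atlas B" and z: "z \<in> x ` U"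
  shows "linear (inf_act_in_charts G GM (U, x) act z)"
  using z has_derivative_linear[OF act_in_charts_partial_derivative[OF G x]] by blast

lemma smooth_inf_act_in_charts:
  fixes B :: "('b, 'eb::findim_inner) manifold"
  assumes G: "G_manifold G GM B act" and x: "(U, x) \<in> atlas B"
  shows "smooth_on (x ` U) (\<lambda>z. inf_act_in_charts G GM (U, x) act z v)"
proof -
  note op = chartedD(4)[OF G_manifoldD(8)[OF G] x]
  obtain A where A: "open A" "smooth_on A (act_in_charts G GM (U, x) act)"
    "\<And>b. b \<in> U \<Longrightarrow> (coord_at GM \<one>\<^bsub>G\<^esub> \<one>\<^bsub>G\<^esub>, x b) \<in> A"
    by (rule act_in_charts[OF G x]) blast
  show ?thesis unfolding inf_act_in_charts_def
    by (rule smooth_on_compose[OF op smooth_on_Pair[OF op smooth_on_const smooth_on_id]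
          smooth_on_derivative[OF A(2)]])
      (use A(3) in auto)
qed

text \<open>
  The identity \<open>\<omega>\<^sub>b \<circ> a\<^sub>b = id\<close>, moved from the chart chosen at \<open>b\<close> to an arbitrary one.
\<close>

lemma connection_inf_act_in_charts:
  assumes G: "G_manifold G GM B act" and conn: "G_connection G GM B act \<omega>"
    and x: "(U, x) \<in> atlas B" and z: "z \<in> x ` U"
  shows "form_in_chart B (U, x) \<omega> z (inf_act_in_charts G GM (U, x) act z v) = v"
proof -
  note G' = G_manifoldD[OF G]
  obtain b where b: "b \<in> U" "z = x b" using z by blast
  have bB: "b \<in> points B" using chartedD(5)[OF G'(8) x] b(1) by blast
  define Ug xg where "Ug = fst (chart_at GM \<one>\<^bsub>G\<^esub>)" and "xg = coord_at GM \<one>\<^bsub>G\<^esub>"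
  let ?\<alpha> = "act_in_charts G GM (U, x) act" and ?e = "xg \<one>\<^bsub>G\<^esub>"
  note Ix = chartedD(2)[OF G'(8) x]
  have a1: "act \<one>\<^bsub>G\<^esub> b = b" by (rule act_one[OF G bB])
  obtain A where A: "open A" "(?e, x b) \<in> A"
    "\<And>\<zeta>. (\<zeta>, x b) \<in> A \<Longrightarrow> \<exists>g\<in>carrier G. act g b \<in> U \<and> inv_into Ug xg \<zeta> = g \<and> ?\<alpha> (\<zeta>, x b) = x (act g b)"
    unfolding xg_def Ug_def by (rule act_in_charts[OF G x]) (use b in blast)
  have d1: "((\<lambda>\<zeta>. ?\<alpha> (\<zeta>, x b)) has_derivative inf_act_in_charts G GM (U, x) act (x b)) (at ?e)"
    unfolding xg_def by (rule act_in_charts_partial_derivative[OF G x b(1)])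
  have "?\<alpha> (?e, x b) = x b" unfolding xg_def by (rule act_in_charts_one[OF G x b(1)])
  hence "((\<lambda>\<zeta>. (coord_at B b \<circ> inv_into U x) (?\<alpha> (\<zeta>, x b))) has_derivative
      (\<lambda>v. tangent_of_coords B (U, x) b (inf_act_in_charts G GM (U, x) act (x b) v))) (at ?e)"
    using has_derivative_compose[OF d1, of "coord_at B b \<circ> inv_into U x" "tangent_of_coords B (U, x) b"]
      tangent_of_coords_has_derivative[OF G'(4) x b(1)] by simp
  moreover have "open ((\<lambda>\<zeta>. (\<zeta>, x b)) -` A)"
    by (rule open_vimage[OF A(1)]) (intro continuous_intros)
  ultimately have "((coord_at B b \<circ> (\<lambda>g. act g b) \<circ> inv_into Ug xg) has_derivative
      (\<lambda>v. tangent_of_coords B (U, x) b (inf_act_in_charts G GM (U, x) act (x b) v))) (at ?e)"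
  proof (rule has_derivative_transform_within_open)
    show "?e \<in> (\<lambda>\<zeta>. (\<zeta>, x b)) -` A" using A(2) by simp
    show "(coord_at B b \<circ> inv_into U x) (?\<alpha> (\<zeta>, x b)) = (coord_at B b \<circ> (\<lambda>g. act g b) \<circ> inv_into Ug xg) \<zeta>"
      if "\<zeta> \<in> (\<lambda>\<zeta>. (\<zeta>, x b)) -` A" for \<zeta>
      using A(3)[of \<zeta>] that by (auto simp: inv_into_f_f[OF Ix])
  qed
  from fun_cong[OF frechet_derivative_at[OF this], of v, symmetric]
  have inf: "infinitesimal_action G GM B act b v =
      tangent_of_coords B (U, x) b (inf_act_in_charts G GM (U, x) act (x b) v)"
    by (simp add: infinitesimal_action_def differential_def a1 Ug_def[symmetric] xg_def[symmetric]
        del: tangent_of_coords.simps)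
  have "\<omega> b \<circ> infinitesimal_action G GM B act b = id"
    using conn bB by (simp add: G_connection_def)
  hence "\<omega> b (infinitesimal_action G GM B act b v) = v" by (metis comp_apply id_apply)
  thus ?thesis unfolding inf b(2)
    by (simp add: form_in_chart_def inv_into_f_f[OF Ix b(1)] del: tangent_of_coords.simps)
qed


section \<open>Horizontal curves in a local trivialization\<close>

lemma chart_open_submanifold:
  "(U, x) \<in> atlas M \<Longrightarrow> (U \<inter> W, x) \<in> atlas (open_submanifold M W)"
  unfolding open_submanifold_def by auto

lemma zero_set_of_split_linear_equation:
  fixes a :: "'a::real_vector \<Rightarrow> 'b::real_vector"
  assumes a: "linear a" and Q: "linear Q" and Qa: "\<And>u. Q (a u) = u" and surj: "surj a"
  shows "P + Q d = 0 \<longleftrightarrow> d = - a P"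
proof
  assume eq: "P + Q d = 0"
  obtain u where d: "d = a u" using surj by blast
  hence "P = - u" using eq Qa by (simp add: eq_neg_iff_add_eq_0)
  thus "d = - a P" by (simp add: d linear_neg[OF a])
next
  assume "d = - a P"
  thus "P + Q d = 0" by (simp add: linear_neg[OF Q] Qa)
qed

definition trivialization ::
  "('g, 'r) monoid_scheme \<Rightarrow> ('f, 'ef::real_normed_vector) manifold \<Rightarrow> ('g \<Rightarrow> 'f \<Rightarrow> 'f) \<Rightarrow>
   ('m, 'em::real_normed_vector) manifold \<Rightarrow> ('b, 'eb::real_normed_vector) manifold \<Rightarrow>
   ('g \<Rightarrow> 'b \<Rightarrow> 'b) \<Rightarrow> ('b \<Rightarrow> 'm) \<Rightarrow> 'm set \<Rightarrow> ('m \<times> 'f \<Rightarrow> 'b) \<Rightarrow> bool" where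
  "trivialization G F actF M B actB \<pi> U \<phi> \<longleftrightarrow>
     openin (topo M) U \<and>
     diffeomorphism (prod_manifold (open_submanifold M U) F)
       (open_submanifold B {b \<in> points B. \<pi> b \<in> U}) \<phi> \<and>
     (\<forall>u\<in>U. \<forall>f\<in>points F. \<pi> (\<phi> (u, f)) = u) \<and>
     (\<forall>u\<in>U. bij_betw (\<lambda>f. \<phi> (u, f)) (points F) {b \<in> points B. \<pi> b = u} \<and>
        (\<forall>g\<in>carrier G. \<forall>f\<in>points F. \<phi> (u, actF g f) = actB g (\<phi> (u, f))))"

locale bundle_connection =
  fixes G :: "('g, 'r) monoid_scheme"
    and GM :: "('g, 'eg::findim_inner) manifold"
    and F :: "('f, 'ef::findim_inner) manifold"
    and actF :: "'g \<Rightarrow> 'f \<Rightarrow> 'f"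
    and M :: "('m, 'em::findim_inner) manifold"
    and B :: "('b, 'eb::findim_inner) manifold"
    and actB :: "'g \<Rightarrow> 'b \<Rightarrow> 'b"
    and \<pi> :: "'b \<Rightarrow> 'm"
    and \<omega> :: "'b \<Rightarrow> 'eb \<Rightarrow> 'eg"
  assumes semi_principal: "semi_principal_bundle G GM F actF M B actB \<pi>"
    and conn: "G_connection G GM B actB \<omega>"
begin

lemma torsor: "semi_torsor G GM F actF" using semi_principal by (simp add: semi_principal_bundle_def)
lemma F: "G_manifold G GM F actF" using torsor by (simp add: semi_torsor_def)
lemma B: "G_manifold G GM B actB" using semi_principal by (simp add: semi_principal_bundle_def)
lemma M: "smooth_manifold M" using semi_principal by (simp add: semi_principal_bundle_def)
lemma \<pi>: "smooth_map B M \<pi>" using semi_principal by (simp add: semi_principal_bundle_def)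
lemma \<pi>_act: "g \<in> carrier G \<Longrightarrow> b \<in> points B \<Longrightarrow> \<pi> (actB g b) = \<pi> b"
  using semi_principal by (simp add: semi_principal_bundle_def)
lemma form: "one_form B \<omega>" using conn by (simp add: G_connection_def)

lemmas charted = smooth_manifold_charted[OF M] G_manifoldD(8)[OF B] G_manifoldD(8)[OF F]

abbreviation "triv \<equiv> trivialization G F actF M B actB \<pi>"

abbreviation "over U \<equiv> {b \<in> points B. \<pi> b \<in> U}"

lemma ex_trivialization:
  assumes "p \<in> points M"
  obtains U \<phi> where "triv U \<phi>" "p \<in> U"
proof -
  have "\<forall>p\<in>points M. \<exists>U \<phi>. openin (topo M) U \<and> p \<in> U \<and>
      diffeomorphism (prod_manifold (open_submanifold M U) F)
        (open_submanifold B (over U)) \<phi> \<and>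
      (\<forall>u\<in>U. \<forall>f\<in>points F. \<pi> (\<phi> (u, f)) = u) \<and>
      (\<forall>u\<in>U. bij_betw (\<lambda>f. \<phi> (u, f)) (points F) {b \<in> points B. \<pi> b = u} \<and>
         (\<forall>g\<in>carrier G. \<forall>f\<in>points F. \<phi> (u, actF g f) = actB g (\<phi> (u, f))))"
    using semi_principal unfolding semi_principal_bundle_def by (elim conjE)
  from bspec[OF this assms] show thesis
    by (elim exE conjE) (rule that, unfold trivialization_def, intro conjI)
qed

lemma trivializationD:
  assumes "triv U \<phi>"
  shows "openin (topo M) U"
    "smooth_map (prod_manifold (open_submanifold M U) F) (open_submanifold B (over U)) \<phi>"
    "\<And>u f. u \<in> U \<Longrightarrow> f \<in> points F \<Longrightarrow> \<phi> (u, f) \<in> points B"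
    "\<And>u f. u \<in> U \<Longrightarrow> f \<in> points F \<Longrightarrow> \<pi> (\<phi> (u, f)) = u"
    "\<And>u f g. u \<in> U \<Longrightarrow> f \<in> points F \<Longrightarrow> g \<in> carrier G \<Longrightarrow> \<phi> (u, actF g f) = actB g (\<phi> (u, f))"
    "\<And>b. b \<in> points B \<Longrightarrow> \<pi> b \<in> U \<Longrightarrow> \<exists>f\<in>points F. b = \<phi> (\<pi> b, f)"
proof -
  note A = assms[unfolded trivialization_def]
  note A1 = conjunct1[OF A] and A2 = conjunct1[OF conjunct2[OF A]]
    and A3 = conjunct1[OF conjunct2[OF conjunct2[OF A]]] and A4 = conjunct2[OF conjunct2[OF conjunct2[OF A]]]
  show "openin (topo M) U" by (rule A1)
  show "smooth_map (prod_manifold (open_submanifold M U) F) (open_submanifold B (over U)) \<phi>"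
    by (rule A2[unfolded diffeomorphism_def, THEN conjunct1])
  show "\<pi> (\<phi> (u, f)) = u" if "u \<in> U" "f \<in> points F" for u f
    by (rule bspec[OF bspec[OF A3 that(1)] that(2)])
  show "\<phi> (u, actF g f) = actB g (\<phi> (u, f))" if "u \<in> U" "f \<in> points F" "g \<in> carrier G" for u f g
    by (rule bspec[OF bspec[OF conjunct2[OF bspec[OF A4 that(1)]] that(3)] that(2)])
  have im: "(\<lambda>f. \<phi> (u, f)) ` points F = {b \<in> points B. \<pi> b = u}" if "u \<in> U" for u
    by (rule bij_betw_imp_surj_on[OF conjunct1[OF bspec[OF A4 that]]])
  show "\<phi> (u, f) \<in> points B" if "u \<in> U" "f \<in> points F" for u f
    using im[OF that(1)] that(2) by blast
  show "\<exists>f\<in>points F. b = \<phi> (\<pi> b, f)" if "b \<in> points B" "\<pi> b \<in> U" for b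
    using im[OF that(2)] that(1) by blast
qed

lemma charted_trivialization:
  assumes "triv U \<phi>"
  shows "charted (prod_manifold (open_submanifold M U) F)"
    "openin (topo B) (over U)" "charted (open_submanifold B (over U))"
proof -
  show "charted (prod_manifold (open_submanifold M U) F)"
    by (intro charted_prod_manifold charted_open_submanifold charted trivializationD(1)[OF assms])
  show "openin (topo B) (over U)"
    using \<pi> trivializationD(1)[OF assms] by (auto simp: smooth_map_def intro: openin_continuous_map_preimage)
  thus "charted (open_submanifold B (over U))"
    by (intro charted_open_submanifold charted)
qed

text \<open>
  An infinitesimal action with a left inverse \<open>Q\<close> is injective, and an injective linear map into a space
  of no larger dimension is onto.
\<close>

lemma vertical_space_spanned_by_action:
  fixes Q :: "'ef \<Rightarrow> 'eg"
  assumes y: "(V, y) \<in> atlas F" and z: "z \<in> y ` V"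
    and Q: "\<And>v. Q (inf_act_in_charts G GM (V, y) actF z v) = v"
  shows "surj (inf_act_in_charts G GM (V, y) actF z)"
proof -
  obtain f where "f \<in> points F" using z chartedD(5)[OF charted(3) y] by blast
  hence "card (onb :: 'ef set) \<le> card (onb :: 'eg set)" by (rule semi_torsor_dim_le[OF torsor])
  moreover have "inj (inf_act_in_charts G GM (V, y) actF z)" by (rule injI) (metis Q)
  ultimately show ?thesis
    using linear_surj_or_card_less[OF linear_inf_act_in_charts[OF F y z]] by linarith
qed

text \<open>
  The differential equation of horizontal curves. The conclusion is an equivalence so that it serves
  both existence (a solution gives a horizontal curve) and uniqueness (a horizontal curve is a solution);
  it is stated for derivatives within an arbitrary set \<open>J\<close> of times because curves may have one-sided
  velocities only.
\<close>

lemma horizontal_in_trivialization_ode: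
  assumes U: "triv U \<phi>" and c0: "smooth_curve_on M I \<gamma>" and x0: "x0 \<in> I" and x0U: "\<gamma> x0 \<in> U"
    and y: "(V, y) \<in> atlas F" and f0: "f0 \<in> V"
  obtains r R where "r > 0" "smooth_on (ball x0 r \<times> ball (y f0) r) R" "ball (y f0) r \<subseteq> y ` V"
    "\<And>s. s \<in> I \<Longrightarrow> s \<in> ball x0 r \<Longrightarrow> \<gamma> s \<in> U"
    "\<And>J w s d. J \<subseteq> I \<inter> ball x0 r \<Longrightarrow> w ` J \<subseteq> ball (y f0) r \<Longrightarrow> s \<in> J \<Longrightarrow>
      (w has_vector_derivative d) (at s within J) \<Longrightarrow>
      \<exists>v. ((coord_at B (\<phi> (\<gamma> s, inv_into V y (w s))) \<circ> (\<lambda>s. \<phi> (\<gamma> s, inv_into V y (w s))))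
             has_vector_derivative v) (at s within J) \<and>
        (\<omega> (\<phi> (\<gamma> s, inv_into V y (w s))) v = 0 \<longleftrightarrow> d = R (s, w s))"
proof -
  note tr = trivializationD[OF U] and ch = charted_trivialization[OF U]
  let ?MU = "open_submanifold M U" and ?BU = "open_submanifold B (over U)"
  note Iy = chartedD(2)[OF charted(3) y]
  have VF: "V \<subseteq> points F" by (rule chartedD(5)[OF charted(3) y])
  obtain Um xm where xm: "(Um, xm) \<in> atlas M" "\<gamma> x0 \<in> Um"
    using charted_cover[OF charted(1)] tr(1) x0U openin_subset by blast
  note Im = chartedD(2)[OF charted(1) xm(1)]
  define b0 where "b0 = \<phi> (\<gamma> x0, f0)"
  have b0: "b0 \<in> points B" unfolding b0_def by (rule tr(3)[OF x0U]) (use f0 VF in blast)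
  obtain Ub xb where xb: "(Ub, xb) \<in> atlas B" "b0 \<in> Ub" using charted_cover[OF charted(2) b0] by blast
  note Ib = chartedD(2)[OF charted(2) xb(1)]
  obtain e c where e: "e > 0" and c: "smooth_on (ball x0 e) c"
    and c': "\<And>s. s \<in> I \<Longrightarrow> s \<in> ball x0 e \<Longrightarrow> \<gamma> s \<in> points M \<and> \<gamma> s \<in> Um \<and> xm (\<gamma> s) = c s"
    by (rule smooth_curve_on_coords[OF charted(1) charted(1) smooth_map_ident[OF M] c0 x0 xm]) blast

  \<comment> \<open>the trivialization in charts of the base, of the fibre and of the total space\<close>
  define \<Omega> where "\<Omega> = map_prod xm y ` (((Um \<inter> U) \<times> V) \<inter> \<phi> -` (Ub \<inter> over U))"
  define \<Phi> where "\<Phi> = xb \<circ> \<phi> \<circ> inv_into ((Um \<inter> U) \<times> V) (map_prod xm y)"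
  have pc: "((Um \<inter> U) \<times> V, map_prod xm y) \<in> atlas (prod_manifold ?MU F)"
  proof -
    have "(Um \<inter> U, xm) \<in> atlas ?MU" by (rule chart_open_submanifold[OF xm(1)])
    thus ?thesis using y by (auto simp: prod_manifold_def)
  qed
  have bc: "(Ub \<inter> over U, xb) \<in> atlas ?BU"
    by (rule chart_open_submanifold[OF xb(1)])
  have o\<Omega>: "open \<Omega>"
    unfolding \<Omega>_def by (rule smooth_map_coords(2)[OF ch(1) ch(3) tr(2) pc bc])
  have s\<Phi>: "smooth_on \<Omega> \<Phi>"
    unfolding \<Omega>_def \<Phi>_def by (rule smooth_map_coords(3)[OF ch(1) ch(3) tr(2) pc bc])
  have \<Phi>: "\<phi> (u, f) \<in> Ub \<and> \<Phi> (z, y f) = xb (\<phi> (u, f)) \<and> u \<in> U"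
    if "(z, y f) \<in> \<Omega>" "f \<in> V" "u \<in> Um" "xm u = z" for u f z
  proof -
    from that(1)[unfolded \<Omega>_def] obtain q
      where q: "(z, y f) = map_prod xm y q" "q \<in> ((Um \<inter> U) \<times> V) \<inter> \<phi> -` (Ub \<inter> over U)"
      by (rule imageE)
    obtain u' f' where "q = (u', f')" by (cases q)
    with q have *: "u' \<in> Um" "u' \<in> U" "f' \<in> V" "\<phi> (u', f') \<in> Ub" "z = xm u'" "y f = y f'"
      by simp_all
    have [simp]: "f' = f" using inj_onD[OF Iy *(6)] that(2) *(3) by simp
    have [simp]: "u' = u" using inj_onD[OF Im, of u' u] that(3,4) * by simp
    have "inv_into ((Um \<inter> U) \<times> V) (map_prod xm y) (map_prod xm y (u, f)) = (u, f)"
      by (rule inv_into_f_f[OF map_prod_inj_on[OF inj_on_subset[OF Im] Iy]]) (use *(1-3) in auto)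
    thus ?thesis using *(2,4,5) by (simp add: \<Phi>_def)
  qed

  \<comment> \<open>time-dependent coordinates: \<open>h (s, w)\<close> is the point of the fibre over time \<open>s\<close> with fibre coordinates \<open>w\<close>\<close>
  define D where "D = (\<lambda>(s, w). (c s, w)) -` \<Omega> \<inter> (ball x0 e \<times> UNIV)"
  define h where "h = (\<lambda>(s, w). \<Phi> (c s, w))"
  have oe: "open (ball x0 e \<times> (UNIV :: 'ef set))" by (intro open_Times) auto
  have sc: "smooth_on (ball x0 e \<times> UNIV) (\<lambda>z. (c (fst z), snd z) :: 'em \<times> 'ef)"
    by (intro smooth_on_Pair oe smooth_on_compose[OF oe _ c] smooth_onI
        Ck_on_bounded_linear bounded_linear_fst bounded_linear_snd) auto
  have oD: "open D"
    using continuous_open_preimage[OF smooth_on_continuous[OF sc] oe o\<Omega>]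
    unfolding D_def by (simp add: vimage_def case_prod_unfold Int_commute)
  have sh: "smooth_on D h"
  proof -
    have "smooth_on D (\<lambda>z. \<Phi> (c (fst z), snd z))"
      by (rule smooth_on_compose[OF oD smooth_on_subset[OF sc] s\<Phi>]) (auto simp: D_def)
    thus ?thesis by (simp add: h_def case_prod_unfold)
  qed
  have x0e: "x0 \<in> ball x0 e" using e by simp
  have D0: "(x0, y f0) \<in> D"
  proof -
    have "(\<gamma> x0, f0) \<in> ((Um \<inter> U) \<times> V) \<inter> \<phi> -` (Ub \<inter> over U)"
      using xm(2) x0U f0 xb(2) b0 VF tr(4)[OF x0U] by (auto simp: b0_def)
    hence "map_prod xm y (\<gamma> x0, f0) \<in> \<Omega>" unfolding \<Omega>_def by (rule imageI)
    hence "(c x0, y f0) \<in> \<Omega>" using c'[OF x0 x0e] by simp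
    thus ?thesis using e by (simp add: D_def)
  qed
  have hD: "\<exists>u f. u \<in> Um \<inter> U \<and> f \<in> V \<and> \<phi> (u, f) \<in> Ub \<and> xm u = c s \<and> y f = w \<and> h (s, w) = xb (\<phi> (u, f))"
    if "(s, w) \<in> D" for s w
  proof -
    have "(c s, w) \<in> \<Omega>" using that by (simp add: D_def)
    then obtain q where q: "(c s, w) = map_prod xm y q" "q \<in> ((Um \<inter> U) \<times> V) \<inter> \<phi> -` (Ub \<inter> over U)"
      unfolding \<Omega>_def by (rule imageE)
    obtain u f where "q = (u, f)" by (cases q)
    with q have *: "u \<in> Um" "u \<in> U" "f \<in> V" "xm u = c s" "y f = w" by simp_all
    have "(c s, y f) \<in> \<Omega>" using \<open>(c s, w) \<in> \<Omega>\<close> *(5) by simp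
    from \<Phi>[OF this *(3,1,4)] * show ?thesis
      by (intro exI[of _ u] exI[of _ f]) (simp add: h_def)
  qed
  have hUb: "h z \<in> xb ` Ub" if "z \<in> D" for z
  proof -
    obtain s w where z: "z = (s, w)" by (cases z)
    show ?thesis using hD[of s w] that unfolding z by blast
  qed
  let ?Dh = "\<lambda>z. frechet_derivative h (at z)"
  define om where "om = form_in_chart B (Ub, xb) \<omega>"
  have som: "smooth_on (xb ` Ub) (\<lambda>z. om z v)" for v
    unfolding om_def by (rule smooth_form_in_chart[OF G_manifoldD(4)[OF B] form xb(1)])
  have lom: "linear (om z)" if "z \<in> xb ` Ub" for z
    unfolding om_def by (rule linear_form_in_chart[OF G_manifoldD(4)[OF B] form xb(1) that])
  define a where "a = inf_act_in_charts G GM (V, y) actF"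
  have sa: "smooth_on (y ` V) (\<lambda>z. a z v)" for v unfolding a_def by (rule smooth_inf_act_in_charts[OF F y])
  have la: "linear (a z)" if "z \<in> y ` V" for z
    unfolding a_def by (rule linear_inf_act_in_charts[OF F y that])
  have yV: "w \<in> y ` V" if "(s, w) \<in> D" for s w using hD[OF that] by blast
  define P where "P z = om (h z) (?Dh z (1, 0))" for z
  define Q where "Q z v = om (h z) (?Dh z (0, v))" for z v
  have sP: "smooth_on D P"
    unfolding P_def
    by (rule smooth_on_linear_family[OF oD lom[OF hUb] smooth_on_compose[OF oD sh som hUb] smooth_on_derivative[OF sh]])
  have lQ: "linear (Q z)" if "z \<in> D" for z
  proof -
    have "linear (om (h z) \<circ> (?Dh z \<circ> Pair 0))"
      by (intro linear_compose lom hUb that smooth_on_linear_derivative[OF sh that]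
          bounded_linear.linear[OF bounded_linear_Pair[OF bounded_linear_zero bounded_linear_ident]])
    thus ?thesis by (simp add: Q_def[abs_def] o_def)
  qed

  \<comment> \<open>vertical vectors: the connection inverts the infinitesimal action\<close>
  have Qa: "Q (s, w) (a w v) = v" if D: "(s, w) \<in> D" for s w v
  proof -
    obtain u f where uf: "u \<in> Um \<inter> U" "f \<in> V" "\<phi> (u, f) \<in> Ub" "xm u = c s" "y f = w" "h (s, w) = xb (\<phi> (u, f))"
      using hD[OF D] by blast
    let ?b = "\<phi> (u, f)" and ?e = "coord_at GM \<one>\<^bsub>G\<^esub> \<one>\<^bsub>G\<^esub>"
    let ?\<alpha> = "act_in_charts G GM (V, y) actF" and ?\<beta> = "act_in_charts G GM (Ub, xb) actB"
    obtain AF where AF: "open AF" "(?e, y f) \<in> AF"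
      "\<And>\<zeta>. (\<zeta>, y f) \<in> AF \<Longrightarrow> \<exists>g\<in>carrier G. actF g f \<in> V \<and>
        inv_into (fst (chart_at GM \<one>\<^bsub>G\<^esub>)) (coord_at GM \<one>\<^bsub>G\<^esub>) \<zeta> = g \<and> ?\<alpha> (\<zeta>, y f) = y (actF g f)"
      by (rule act_in_charts[OF F y]) (use uf(2) in blast)
    obtain AB where AB: "open AB" "(?e, xb ?b) \<in> AB"
      "\<And>\<zeta>. (\<zeta>, xb ?b) \<in> AB \<Longrightarrow> \<exists>g\<in>carrier G. actB g ?b \<in> Ub \<and>
        inv_into (fst (chart_at GM \<one>\<^bsub>G\<^esub>)) (coord_at GM \<one>\<^bsub>G\<^esub>) \<zeta> = g \<and> ?\<beta> (\<zeta>, xb ?b) = xb (actB g ?b)"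
      by (rule act_in_charts[OF B xb(1)]) (use uf(3) in blast)
    have dF: "((\<lambda>\<zeta>. ?\<alpha> (\<zeta>, y f)) has_derivative a w) (at ?e)"
      unfolding a_def uf(5)[symmetric] by (rule act_in_charts_partial_derivative[OF F y uf(2)])
    have dB: "((\<lambda>\<zeta>. ?\<beta> (\<zeta>, xb ?b)) has_derivative inf_act_in_charts G GM (Ub, xb) actB (xb ?b)) (at ?e)"
      by (rule act_in_charts_partial_derivative[OF B xb(1) uf(3)])
    have \<alpha>e: "?\<alpha> (?e, y f) = w" using act_in_charts_one[OF F y uf(2)] uf(5) by simp
    have dL: "((\<lambda>\<zeta>. h (s, ?\<alpha> (\<zeta>, y f))) has_derivative (\<lambda>v. ?Dh (s, w) (0, a w v))) (at ?e)"
    proof -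
      have 1: "((\<lambda>\<zeta>. (s, ?\<alpha> (\<zeta>, y f))) has_derivative (\<lambda>v. (0, a w v))) (at ?e)"
        by (intro has_derivative_Pair has_derivative_const dF)
      have 2: "(h has_derivative ?Dh (s, w)) (at (s, ?\<alpha> (?e, y f)))"
        unfolding \<alpha>e by (rule smooth_on_has_derivative[OF sh D])
      show ?thesis by (rule has_derivative_compose[OF 1 2])
    qed
    \<comment> \<open>equivariance: \<open>h (s, _)\<close> intertwines the two actions near the identity\<close>
    define N where "N = ((\<lambda>\<zeta>. (\<zeta>, y f)) -` AF \<inter> (\<lambda>\<zeta>. (\<zeta>, xb ?b)) -` AB)"
    obtain T where T: "open T" "?e \<in> T" "\<And>\<zeta>. \<zeta> \<in> T \<Longrightarrow> (s, ?\<alpha> (\<zeta>, y f)) \<in> D"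
    proof -
      have "isCont (\<lambda>\<zeta>. (s, ?\<alpha> (\<zeta>, y f))) ?e"
        by (intro continuous_intros has_derivative_continuous[OF dF])
      hence "\<forall>\<^sub>F \<zeta> in nhds ?e. (s, ?\<alpha> (\<zeta>, y f)) \<in> D"
        using topological_tendstoD[OF _ oD, of "\<lambda>\<zeta>. (s, ?\<alpha> (\<zeta>, y f))" "(s, ?\<alpha> (?e, y f))" "nhds ?e"] D
        unfolding \<alpha>e by (simp add: isCont_def tendsto_nhds_iff \<alpha>e)
      thus thesis using that unfolding eventually_nhds by blast
    qed
    have "((\<lambda>\<zeta>. h (s, ?\<alpha> (\<zeta>, y f))) has_derivative inf_act_in_charts G GM (Ub, xb) actB (xb ?b)) (at ?e)"
    proof (rule has_derivative_transform_within_open[OF dB, of "N \<inter> T"])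
      show "open (N \<inter> T)" unfolding N_def
        by (intro open_Int T(1) open_vimage[OF AF(1)] open_vimage[OF AB(1)] continuous_intros)
      show "?e \<in> N \<inter> T" unfolding N_def using AF(2) AB(2) T(2) by simp
      fix \<zeta> assume \<zeta>: "\<zeta> \<in> N \<inter> T"
      obtain g where g: "g \<in> carrier G" "actF g f \<in> V" "?\<alpha> (\<zeta>, y f) = y (actF g f)"
        "inv_into (fst (chart_at GM \<one>\<^bsub>G\<^esub>)) (coord_at GM \<one>\<^bsub>G\<^esub>) \<zeta> = g"
        using AF(3)[of \<zeta>] \<zeta> by (auto simp: N_def)
      have \<beta>: "?\<beta> (\<zeta>, xb ?b) = xb (actB g ?b)" using AB(3)[of \<zeta>] \<zeta> g(4) by (auto simp: N_def)
      have "(c s, y (actF g f)) \<in> \<Omega>" using T(3)[of \<zeta>] \<zeta> g(3) by (simp add: D_def)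
      hence "h (s, y (actF g f)) = xb (\<phi> (u, actF g f))"
        using \<Phi>[of "c s" "actF g f" u] g(2) uf(1,4) by (simp add: h_def)
      moreover have "\<phi> (u, actF g f) = actB g ?b"
        by (rule tr(5)) (use uf(1,2) g(1) VF in auto)
      ultimately show "?\<beta> (\<zeta>, xb ?b) = h (s, ?\<alpha> (\<zeta>, y f))" by (simp only: \<beta> g(3))
    qed
    from has_derivative_unique[OF dL this]
    have "?Dh (s, w) (0, a w v) = inf_act_in_charts G GM (Ub, xb) actB (xb ?b) v" by metis
    thus ?thesis unfolding Q_def om_def
      using connection_inf_act_in_charts[OF B conn xb(1), of "xb ?b" v] uf(3) by (simp add: uf(6))
  qed
  \<comment> \<open>solving \<open>P + Q d = 0\<close> for the derivative \<open>d\<close>\<close>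
  have surj: "surj (a w)" if "(s, w) \<in> D" for s w
    unfolding a_def
    by (rule vertical_space_spanned_by_action[OF y yV[OF that], of "Q (s, w)"])
      (rule Qa[OF that, unfolded a_def])

  define R where "R = (\<lambda>(s, w). - a w (P (s, w)))"
  have sR: "smooth_on D R"
  proof -
    have "smooth_on D (\<lambda>z. a (snd z) (P z))"
    proof (rule smooth_on_linear_family[OF oD _ _ sP])
      show "linear (a (snd z))" if "z \<in> D" for z using la[OF yV[of "fst z"]] that by simp
      show "smooth_on D (\<lambda>z. a (snd z) v)" for v
        by (rule smooth_on_compose[OF oD _ sa])
          (use yV in \<open>auto intro!: smooth_onI Ck_on_bounded_linear bounded_linear_snd oD\<close>)
    qed
    from smooth_on_linear_compose[OF bounded_linear_minus[OF bounded_linear_ident] oD this]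
    show ?thesis by (simp add: R_def case_prod_unfold)
  qed
  have "\<exists>r>0. ball x0 r \<times> ball (y f0) r \<subseteq> D"
  proof -
    obtain S T where ST: "open S" "open T" "x0 \<in> S" "y f0 \<in> T" "S \<times> T \<subseteq> D"
      using open_prod_elim[OF oD D0] by (metis mem_Sigma_iff)
    obtain r1 where r1: "r1 > 0" "ball x0 r1 \<subseteq> S" using ST(1,3) open_contains_ball by metis
    obtain r2 where r2: "r2 > 0" "ball (y f0) r2 \<subseteq> T" using ST(2,4) open_contains_ball by metis
    have "ball x0 (min r1 r2) \<subseteq> S" "ball (y f0) (min r1 r2) \<subseteq> T" using r1(2) r2(2) by auto
    hence "ball x0 (min r1 r2) \<times> ball (y f0) (min r1 r2) \<subseteq> D" using ST(5) by blast
    thus ?thesis using r1(1) r2(1) by (intro exI[of _ "min r1 r2"]) simp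
  qed
  then obtain r where r: "r > 0" "ball x0 r \<times> ball (y f0) r \<subseteq> D" by blast
  show thesis
  proof (rule that[OF r(1) smooth_on_subset[OF sR r(2)]])
    have x0r: "x0 \<in> ball x0 r" using r(1) by simp
    show "ball (y f0) r \<subseteq> y ` V" using yV[of x0] r(2) x0r by blast
    have y0r: "y f0 \<in> ball (y f0) r" using r(1) by simp
    have re: "s \<in> ball x0 e" if "s \<in> ball x0 r" for s
    proof -
      have "(s, y f0) \<in> D" using r(2) that y0r by blast
      thus ?thesis by (simp add: D_def)
    qed
    have cU: "\<gamma> s \<in> Um" "xm (\<gamma> s) = c s" if "s \<in> I" "s \<in> ball x0 r" for s
      using c'[OF that(1) re[OF that(2)]] by auto
    have pt: "\<gamma> s \<in> U \<and> \<phi> (\<gamma> s, inv_into V y w) \<in> Ub \<and> h (s, w) = xb (\<phi> (\<gamma> s, inv_into V y w))"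
      if s: "s \<in> I" "s \<in> ball x0 r" and w: "w \<in> ball (y f0) r" for s w
    proof -
      have sw: "(s, w) \<in> D" using r(2) s(2) w by blast
      have f: "inv_into V y w \<in> V" "y (inv_into V y w) = w"
        using yV[OF sw] by (simp_all add: inv_into_into f_inv_into_f)
      have "(c s, y (inv_into V y w)) \<in> \<Omega>" using sw f(2) by (simp add: D_def)
      from \<Phi>[OF this f(1) cU[OF s]] show ?thesis by (simp add: h_def f(2))
    qed
    show "\<gamma> s \<in> U" if "s \<in> I" "s \<in> ball x0 r" for s
      using pt[OF that y0r] by blast
    fix J w s d
    assume J: "J \<subseteq> I \<inter> ball x0 r" and w: "w ` J \<subseteq> ball (y f0) r" and s: "s \<in> J"
      and d: "(w has_vector_derivative d) (at s within J)"
    let ?\<Gamma> = "\<lambda>s. \<phi> (\<gamma> s, inv_into V y (w s))"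
    have sw: "(s, w s) \<in> D" using r(2) J w s by blast
    have G: "?\<Gamma> s' \<in> Ub \<and> xb (?\<Gamma> s') = h (s', w s')" if "s' \<in> J" for s'
    proof -
      have "s' \<in> I" "s' \<in> ball x0 r" "w s' \<in> ball (y f0) r" using J w that by blast+
      from pt[OF this] show ?thesis by simp
    qed
    have dh: "((\<lambda>s. h (s, w s)) has_vector_derivative ?Dh (s, w s) (1, d)) (at s within J)"
    proof -
      have "((\<lambda>s. (s, w s)) has_vector_derivative (1, d)) (at s within J)"
        by (intro has_vector_derivative_Pair d has_vector_derivative_id)
      from vector_derivative_diff_chain_within[OF this
          has_derivative_at_withinI[OF smooth_on_has_derivative[OF sh sw]]]
      show ?thesis by (simp add: o_def)
    qed
    have vel: "((coord_at B (?\<Gamma> s) \<circ> ?\<Gamma>) has_vector_derivative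
        tangent_of_coords B (Ub, xb) (?\<Gamma> s) (?Dh (s, w s) (1, d))) (at s within J)"
      by (rule velocity_in_chart[OF G_manifoldD(4)[OF B] xb(1) s zero_less_one G dh])
    have "\<omega> (?\<Gamma> s) (tangent_of_coords B (Ub, xb) (?\<Gamma> s) (?Dh (s, w s) (1, d))) =
        om (h (s, w s)) (?Dh (s, w s) (1, d))"
      using G[OF s] inv_into_f_f[OF Ib, of "?\<Gamma> s"]
      by (simp add: om_def form_in_chart_def del: tangent_of_coords.simps)
    also have "\<dots> = om (h (s, w s)) (?Dh (s, w s) (1, 0) + ?Dh (s, w s) (0, d))"
      using linear_add[OF smooth_on_linear_derivative[OF sh sw], of "(1, 0)" "(0, d)"] by simp
    also have "\<dots> = P (s, w s) + Q (s, w s) d"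
      unfolding P_def Q_def by (rule linear_add[OF lom[OF hUb[OF sw]]])
    finally have "\<omega> (?\<Gamma> s) (tangent_of_coords B (Ub, xb) (?\<Gamma> s) (?Dh (s, w s) (1, d))) =
        P (s, w s) + Q (s, w s) d" .
    moreover have "P (s, w s) + Q (s, w s) d = 0 \<longleftrightarrow> d = R (s, w s)"
      using zero_set_of_split_linear_equation[OF la[OF yV[OF sw]] lQ[OF sw] Qa[OF sw] surj[OF sw]]
      by (simp add: R_def)
    ultimately show "\<exists>v. ((coord_at B (?\<Gamma> s) \<circ> ?\<Gamma>) has_vector_derivative v) (at s within J) \<and>
        (\<omega> (?\<Gamma> s) v = 0 \<longleftrightarrow> d = R (s, w s))"
      using vel by auto
  qed
qed

end


section \<open>Partitions of an interval\<close>

definition partitioned :: "(real set \<Rightarrow> bool) \<Rightarrow> real \<Rightarrow> real \<Rightarrow> bool" where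
  "partitioned P p q \<longleftrightarrow> (\<exists>n (\<tau> :: nat \<Rightarrow> real). \<tau> 0 = p \<and> \<tau> n = q \<and>
     (\<forall>i<n. \<tau> i < \<tau> (Suc i) \<and> P {\<tau> i..\<tau> (Suc i)}))"

lemma partition_bounds:
  fixes \<tau> :: "nat \<Rightarrow> real"
  assumes step: "\<And>i. i < n \<Longrightarrow> \<tau> i < \<tau> (Suc i)" and i: "i \<le> n"
  shows "\<tau> 0 \<le> \<tau> i" "\<tau> i \<le> \<tau> n"
proof -
  show "\<tau> 0 \<le> \<tau> i" using i
  proof (induction i)
    case (Suc i)
    thus ?case using step[of i] by simp
  qed simp
  show "\<tau> i \<le> \<tau> n" using i
  proof (induction rule: inc_induct)
    case (step k)
    thus ?case using assms(1)[of k] by simp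
  qed simp
qed

lemma partition_right:
  fixes \<tau> :: "nat \<Rightarrow> real"
  assumes "\<tau> 0 \<le> x" "x < \<tau> n"
  shows "\<exists>i<n. \<tau> i \<le> x \<and> x < \<tau> (Suc i)"
  using assms
proof (induction n)
  case (Suc n)
  show ?case
  proof (cases "x < \<tau> n")
    case True
    thus ?thesis using Suc by (metis less_Suc_eq)
  next
    case False
    thus ?thesis using Suc.prems by (intro exI[of _ n]) auto
  qed
qed simp

lemma partition_left:
  fixes \<tau> :: "nat \<Rightarrow> real"
  assumes "\<tau> 0 < x" "x \<le> \<tau> n"
  shows "\<exists>i<n. \<tau> i < x \<and> x \<le> \<tau> (Suc i)"
  using assms
proof (induction n)
  case (Suc n)
  show ?case
  proof (cases "x \<le> \<tau> n")
    case True
    thus ?thesis using Suc by (metis less_Suc_eq)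
  next
    case False
    thus ?thesis using Suc.prems by (intro exI[of _ n]) auto
  qed
qed simp

section \<open>Existence of horizontal lifts\<close>

context bundle_connection
begin

text \<open>
  Horizontality is expressed by the existence of a velocity annihilated by \<open>\<omega>\<close>, which for a smooth curve
  is equivalent to the condition on all velocities if \<open>J\<close> is a nondegenerate interval, but, unlike that
  condition, passes to arbitrary subsets of \<open>J\<close>.
\<close>

definition horizontal_piece :: "real set \<Rightarrow> (real \<Rightarrow> 'b) \<Rightarrow> bool" where
  "horizontal_piece J \<Gamma> \<longleftrightarrow> smooth_curve_on B J \<Gamma> \<and>
     (\<forall>t\<in>J. \<exists>v. ((coord_at B (\<Gamma> t) \<circ> \<Gamma>) has_vector_derivative v) (at t within J) \<and> \<omega> (\<Gamma> t) v = 0)"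

lemma horizontal_piece_mono:
  assumes h: "horizontal_piece J \<Gamma>" and KJ: "K \<subseteq> J" and eq: "\<And>t. t \<in> K \<Longrightarrow> \<Gamma> t = \<Delta> t"
  shows "horizontal_piece K \<Delta>"
  unfolding horizontal_piece_def
proof (intro conjI ballI)
  show "smooth_curve_on B K \<Delta>"
    by (rule smooth_curve_on_mono[OF conjunct1[OF h[unfolded horizontal_piece_def]] KJ]) (rule eq)
  fix t assume t: "t \<in> K"
  hence "t \<in> J" using KJ by blast
  then obtain v where v: "((coord_at B (\<Gamma> t) \<circ> \<Gamma>) has_vector_derivative v) (at t within J)" "\<omega> (\<Gamma> t) v = 0"
    using h unfolding horizontal_piece_def by blast
  have "((coord_at B (\<Gamma> t) \<circ> \<Delta>) has_vector_derivative v) (at t within K)"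
    by (rule has_vector_derivative_transform[OF t _ has_vector_derivative_within_subset[OF v(1) KJ]])
      (simp add: eq)
  thus "\<exists>v. ((coord_at B (\<Delta> t) \<circ> \<Delta>) has_vector_derivative v) (at t within K) \<and> \<omega> (\<Delta> t) v = 0"
    using v(2) eq[OF t] by auto
qed

text \<open>
  By invariance, \<open>\<omega>\<close> takes the value \<open>Ad\<^sub>g 0\<close> on the translated vector, and invariance at the
  zero vector shows that \<open>Ad\<^sub>g 0 = 0\<close>.
\<close>

lemma connection_translate:
  assumes g: "g \<in> carrier G" and b: "b \<in> points B" and v: "\<omega> b v = 0"
  shows "\<omega> (actB g b) (differential B B (actB g) b v) = 0"
proof -
  have eq: "\<omega> (actB g b) (differential B B (actB g) b v) = Ad G GM g (\<omega> b v)" for v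
    using conn g b unfolding G_connection_def by (metis comp_apply)
  have "linear (differential B B (actB g) b)"
    using differential_has_derivative[OF charted(2,2) smooth_map_act[OF B g] b] has_derivative_linear by blast
  moreover have lin: "linear (\<omega> (actB g b))" "linear (\<omega> b)"
    using form b act_points[OF B b g] unfolding one_form_def by blast+
  ultimately have "Ad G GM g 0 = 0" using eq[of 0] by (simp add: linear_0)
  thus ?thesis using eq[of v] v by simp
qed

lemma horizontal_piece_translate:
  assumes h: "horizontal_piece J \<Gamma>" and g: "g \<in> carrier G"
  shows "horizontal_piece J (\<lambda>t. actB g (\<Gamma> t))"
  unfolding horizontal_piece_def
proof (intro conjI ballI)
  have sm: "smooth_curve_on B J \<Gamma>" using h by (simp add: horizontal_piece_def)
  show "smooth_curve_on B J (\<lambda>t. actB g (\<Gamma> t))"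
    by (rule smooth_curve_on_map[OF charted(2,2) smooth_map_act[OF B g] sm])
  fix t assume t: "t \<in> J"
  then obtain v where v: "((coord_at B (\<Gamma> t) \<circ> \<Gamma>) has_vector_derivative v) (at t within J)" "\<omega> (\<Gamma> t) v = 0"
    using h unfolding horizontal_piece_def by blast
  have "((coord_at B (actB g (\<Gamma> t)) \<circ> (\<lambda>s. actB g (\<Gamma> s))) has_vector_derivative
      differential B B (actB g) (\<Gamma> t) v) (at t within J)"
    by (rule velocity_image[OF charted(2,2) smooth_map_act[OF B g] t smooth_curve_on_continuous[OF charted(2) sm] v(1)])
  moreover have "\<omega> (actB g (\<Gamma> t)) (differential B B (actB g) (\<Gamma> t) v) = 0"
    by (rule connection_translate[OF g smooth_curve_on_points[OF charted(2) sm t] v(2)])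
  ultimately show "\<exists>v. ((coord_at B (actB g (\<Gamma> t)) \<circ> (\<lambda>t. actB g (\<Gamma> t))) has_vector_derivative v) (at t within J) \<and>
      \<omega> (actB g (\<Gamma> t)) v = 0" by blast
qed

text \<open>
  The lift passes near \<open>\<phi>(\<gamma>(x0), f0)\<close>; that its fibre component stays in \<open>N\<close> will be used with
  \<open>N\<close> the orbit of \<open>f0\<close>, where any other initial point is reached by translation.
\<close>

lemma local_horizontal_lift:
  assumes U: "triv U \<phi>" and c: "smooth_curve_on M I \<gamma>" and x0: "x0 \<in> I" and x0U: "\<gamma> x0 \<in> U"
    and f0: "f0 \<in> points F" and N: "openin (topo F) N" "f0 \<in> N"
  obtains \<delta> \<Gamma> where "\<delta> > 0" "horizontal_piece (I \<inter> ball x0 \<delta>) \<Gamma>"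
    "\<And>s. s \<in> I \<Longrightarrow> s \<in> ball x0 \<delta> \<Longrightarrow> \<gamma> s \<in> U \<and> (\<exists>f\<in>N. \<Gamma> s = \<phi> (\<gamma> s, f))"
proof -
  obtain V y where y: "(V, y) \<in> atlas F" "f0 \<in> V" using charted_cover[OF charted(3) f0] by blast
  note y' = chartedD[OF charted(3) y(1)]
  obtain r R where r: "r > 0" "smooth_on (ball x0 r \<times> ball (y f0) r) R" "ball (y f0) r \<subseteq> y ` V"
    "\<And>s. s \<in> I \<Longrightarrow> s \<in> ball x0 r \<Longrightarrow> \<gamma> s \<in> U"
    and ode: "\<And>J w s d. J \<subseteq> I \<inter> ball x0 r \<Longrightarrow> w ` J \<subseteq> ball (y f0) r \<Longrightarrow> s \<in> J \<Longrightarrow>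
      (w has_vector_derivative d) (at s within J) \<Longrightarrow>
      \<exists>v. ((coord_at B (\<phi> (\<gamma> s, inv_into V y (w s))) \<circ> (\<lambda>s. \<phi> (\<gamma> s, inv_into V y (w s))))
             has_vector_derivative v) (at s within J) \<and>
        (\<omega> (\<phi> (\<gamma> s, inv_into V y (w s))) v = 0 \<longleftrightarrow> d = R (s, w s))"
    by (rule horizontal_in_trivialization_ode[OF U c x0 x0U y]) blast
  have oN: "open (y ` (V \<inter> N))" by (rule y'(3)) (use y'(1) N(1) in auto)
  define D where "D = ball x0 r \<times> (ball (y f0) r \<inter> y ` (V \<inter> N))"
  have oD: "open D" unfolding D_def by (intro open_Times open_Int oN open_ball)
  have D0: "(x0, y f0) \<in> D" unfolding D_def using r(1) y(2) N(2) by auto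
  have sR: "smooth_on D R" by (rule smooth_on_subset[OF r(2)]) (auto simp: D_def)
  obtain \<rho> L K where \<rho>: "\<rho> > 0" "L \<ge> 0" "K \<ge> 0" "cball x0 \<rho> \<times> cball (y f0) \<rho> \<subseteq> D"
    and lip: "\<And>s w w'. s \<in> cball x0 \<rho> \<Longrightarrow> w \<in> cball (y f0) \<rho> \<Longrightarrow> w' \<in> cball (y f0) \<rho> \<Longrightarrow>
      norm (R (s, w) - R (s, w')) \<le> L * norm (w - w')"
    and bd: "\<And>s w. s \<in> cball x0 \<rho> \<Longrightarrow> w \<in> cball (y f0) \<rho> \<Longrightarrow> norm (R (s, w)) \<le> K"
    by (rule smooth_locally_lipschitz[OF oD sR D0]) blast
  have contR: "continuous_on (cball x0 \<rho> \<times> cball (y f0) \<rho>) R"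
    by (rule continuous_on_subset[OF smooth_on_continuous[OF sR] \<rho>(4)])
  obtain \<delta> w where \<delta>: "\<delta> > 0" "\<delta> \<le> \<rho>" and "w x0 = y f0"
    and w: "\<And>s. s \<in> ball x0 \<delta> \<Longrightarrow> w s \<in> cball (y f0) \<rho> \<and> (w has_vector_derivative R (s, w s)) (at s)"
    by (rule picard_lindelof[OF \<rho>(1-3) contR lip bd]) (assumption+, rule that)
  have wD: "(s, w s) \<in> D" if "s \<in> ball x0 \<delta>" for s
  proof -
    have "s \<in> cball x0 \<rho>" using that \<delta>(2) by simp
    thus ?thesis using w[OF that] \<rho>(4) by blast
  qed
  let ?J = "I \<inter> ball x0 \<delta>"
  let ?f = "\<lambda>s. inv_into V y (w s)"
  let ?\<Gamma> = "\<lambda>s. \<phi> (\<gamma> s, ?f s)"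
  have sw: "smooth_on (ball x0 \<delta>) w"
    by (rule ode_solution_smooth[OF open_ball sR]) (use w wD in blast)
  have fN: "?f s \<in> V \<inter> N" if "s \<in> ball x0 \<delta>" for s
  proof -
    have "w s \<in> y ` (V \<inter> N)" using wD[OF that] by (simp add: D_def)
    then obtain f where "f \<in> V \<inter> N" "w s = y f" by blast
    thus ?thesis using inv_into_f_f[OF y'(2)] by simp
  qed
  have Jr: "?J \<subseteq> I \<inter> ball x0 r" and wr: "w ` ?J \<subseteq> ball (y f0) r"
    using wD by (auto simp: D_def)
  have gU: "\<gamma> s \<in> U" if "s \<in> ?J" for s using r(4) Jr that by blast
  have sF: "smooth_curve_on F ?J ?f"
  proof (rule smooth_curve_on_chart[OF y(1) y'(2) open_ball sw])
    show "w ` ball x0 \<delta> \<subseteq> y ` V" using wD unfolding D_def by blast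
  qed simp
  have s\<gamma>: "smooth_curve_on (open_submanifold M U) ?J \<gamma>"
    using smooth_curve_on_submanifold[of ?J \<gamma> U M] gU smooth_curve_on_mono[OF c, of ?J \<gamma>] by blast
  have sB: "smooth_curve_on B ?J ?\<Gamma>"
  proof -
    have *: "smooth_curve_on (open_submanifold B (over U)) ?J ?\<Gamma>"
      by (rule smooth_curve_on_map[OF charted_trivialization(1,3)[OF U] trivializationD(2)[OF U]
            smooth_curve_on_Pair[OF s\<gamma> sF]])
    have "?\<Gamma> s \<in> over U" if "s \<in> ?J" for s
    proof -
      have "?f s \<in> points F" using fN[of s] that y'(5) by auto
      thus ?thesis using trivializationD(3,4)[OF U gU[OF that]] gU[OF that] by simp
    qed
    from smooth_curve_on_submanifold[of ?J ?\<Gamma>, OF this] * show ?thesis by blast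
  qed
  have "horizontal_piece ?J ?\<Gamma>"
    unfolding horizontal_piece_def
  proof (intro conjI ballI sB)
    fix s assume s: "s \<in> ?J"
    have "(w has_vector_derivative R (s, w s)) (at s within ?J)"
      using w[of s] s by (simp add: has_vector_derivative_at_within)
    from ode[OF Jr wr s this] show "\<exists>v. ((coord_at B (?\<Gamma> s) \<circ> ?\<Gamma>) has_vector_derivative v) (at s within ?J) \<and>
        \<omega> (?\<Gamma> s) v = 0" by blast
  qed
  moreover have "\<gamma> s \<in> U \<and> (\<exists>f\<in>N. ?\<Gamma> s = \<phi> (\<gamma> s, f))" if "s \<in> I" "s \<in> ball x0 \<delta>" for s
    using fN[OF that(2)] gU[of s] that by blast
  ultimately show thesis by (rule that[OF \<delta>(1)])
qed

text \<open>
  The case \<open>p = q\<close>, with an empty partition, is included so that bisection applies.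
\<close>

definition lift_on :: "(real \<Rightarrow> 'm) \<Rightarrow> real \<Rightarrow> real \<Rightarrow> 'b \<Rightarrow> (real \<Rightarrow> 'b) \<Rightarrow> bool" where
  "lift_on \<gamma> p q b \<Gamma> \<longleftrightarrow>
     partitioned (\<lambda>J. horizontal_piece J \<Gamma>) p q \<and>
     continuous_map (top_of_set {p..q}) (topo B) \<Gamma> \<and>
     (\<forall>t\<in>{p..q}. \<pi> (\<Gamma> t) = \<gamma> t) \<and> \<Gamma> p = b"

lemma lift_on_points:
  assumes l: "lift_on \<gamma> p q b \<Gamma>" and t: "t \<in> {p..q}"
  shows "\<Gamma> t \<in> points B"
proof -
  have "continuous_map (top_of_set {p..q}) (topo B) \<Gamma>" using l by (simp add: lift_on_def)
  from continuous_map_image_subset_topspace[OF this] show ?thesis using t by auto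
qed

lemma lift_on_refl:
  assumes "b \<in> points B" "\<pi> b = \<gamma> p"
  shows "lift_on \<gamma> p p b (\<lambda>_. b)"
  unfolding lift_on_def partitioned_def using assms
  by (intro conjI exI[of _ "0::nat"] exI[of _ "\<lambda>_. p"]) auto

lemma lift_on_single_piece:
  assumes "p < q" "horizontal_piece {p..q} \<Gamma>" "\<And>t. t \<in> {p..q} \<Longrightarrow> \<pi> (\<Gamma> t) = \<gamma> t"
  shows "lift_on \<gamma> p q (\<Gamma> p) \<Gamma>"
  unfolding lift_on_def
proof (intro conjI)
  show "partitioned (\<lambda>J. horizontal_piece J \<Gamma>) p q"
    unfolding partitioned_def using assms(1,2) by (intro exI[of _ "1::nat"] exI[of _ "\<lambda>i. if i = 0 then p else q"]) auto
  show "continuous_map (top_of_set {p..q}) (topo B) \<Gamma>"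
    using assms(2) by (intro smooth_curve_on_continuous charted) (simp add: horizontal_piece_def)
qed (use assms(3) in auto)

lemma lift_on_concat:
  assumes 1: "lift_on \<gamma> p m b \<Gamma>" and 2: "lift_on \<gamma> m q (\<Gamma> m) \<Delta>" and pm: "p \<le> m" and mq: "m \<le> q"
  shows "lift_on \<gamma> p q b (\<lambda>t. if t \<le> m then \<Gamma> t else \<Delta> t)"
proof -
  let ?H = "\<lambda>t. if t \<le> m then \<Gamma> t else \<Delta> t"
  have join: "\<Delta> m = \<Gamma> m" using 2 by (simp add: lift_on_def)
  obtain n \<tau> where \<tau>: "\<tau> 0 = p" "\<tau> n = m"
    "\<And>i. i < n \<Longrightarrow> \<tau> i < \<tau> (Suc i) \<and> horizontal_piece {\<tau> i..\<tau> (Suc i)} \<Gamma>"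
    using 1 unfolding lift_on_def partitioned_def by blast
  obtain k \<sigma> where \<sigma>: "\<sigma> 0 = m" "\<sigma> k = q"
    "\<And>i. i < k \<Longrightarrow> \<sigma> i < \<sigma> (Suc i) \<and> horizontal_piece {\<sigma> i..\<sigma> (Suc i)} \<Delta>"
    using 2 unfolding lift_on_def partitioned_def by blast
  have \<tau>m: "\<tau> i \<le> m" if "i \<le> n" for i
    using partition_bounds(2)[of n \<tau>, OF conjunct1[OF \<tau>(3)] that] by (simp add: \<tau>(2))
  have \<sigma>m: "m \<le> \<sigma> i" if "i \<le> k" for i
    using partition_bounds(1)[of k \<sigma>, OF conjunct1[OF \<sigma>(3)] that] by (simp add: \<sigma>(1))
  define \<theta> where "\<theta> i = (if i \<le> n then \<tau> i else \<sigma> (i - n))" for i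
  have "\<theta> i < \<theta> (Suc i) \<and> horizontal_piece {\<theta> i..\<theta> (Suc i)} ?H" if i: "i < n + k" for i
  proof (cases "i < n")
    case True
    have "horizontal_piece {\<tau> i..\<tau> (Suc i)} ?H"
      by (rule horizontal_piece_mono[of "{\<tau> i..\<tau> (Suc i)}" \<Gamma>]) (use \<tau>(3)[OF True] \<tau>m[of "Suc i"] True in auto)
    thus ?thesis using True \<tau>(3)[OF True] by (simp add: \<theta>_def)
  next
    case False
    define j where "j = i - n"
    have j: "j < k" "i = n + j" using False i by (auto simp: j_def)
    have \<theta>: "\<theta> i = \<sigma> j" "\<theta> (Suc i) = \<sigma> (Suc j)" using \<tau>(2) \<sigma>(1) by (auto simp: \<theta>_def j)
    have "horizontal_piece {\<sigma> j..\<sigma> (Suc j)} ?H"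
    proof (rule horizontal_piece_mono[OF conjunct2[OF \<sigma>(3)[OF j(1)]] subset_refl])
      fix t assume "t \<in> {\<sigma> j..\<sigma> (Suc j)}"
      hence "m \<le> t" using \<sigma>m[of j] j(1) by simp
      thus "\<Delta> t = ?H t" using join by (cases "t = m") auto
    qed
    thus ?thesis using \<sigma>(3)[OF j(1)] by (simp add: \<theta>)
  qed
  moreover have "\<theta> 0 = p" "\<theta> (n + k) = q" using \<tau>(1,2) \<sigma>(1,2) by (auto simp: \<theta>_def)
  ultimately have part: "partitioned (\<lambda>J. horizontal_piece J ?H) p q"
    unfolding partitioned_def by blast
  have "continuous_map (top_of_set {p..q}) (topo B) ?H"
  proof (rule continuous_map_cases_le)
    show "continuous_map (top_of_set {p..q}) euclideanreal (\<lambda>t. t)"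
      by (simp add: continuous_map_from_subtopology continuous_map_id[unfolded id_def])
    have "{t \<in> topspace (top_of_set {p..q}). t \<le> m} = {p..m}" using mq by auto
    thus "continuous_map (subtopology (top_of_set {p..q}) {t \<in> topspace (top_of_set {p..q}). t \<le> m}) (topo B) \<Gamma>"
      using 1 mq by (simp add: lift_on_def subtopology_subtopology inf_absorb2)
    have "{t \<in> topspace (top_of_set {p..q}). m \<le> t} = {m..q}" using pm by auto
    thus "continuous_map (subtopology (top_of_set {p..q}) {t \<in> topspace (top_of_set {p..q}). m \<le> t}) (topo B) \<Delta>"
      using 2 pm by (simp add: lift_on_def subtopology_subtopology inf_absorb2)
  qed (use join in auto)
  thus ?thesis using 1 2 part pm unfolding lift_on_def by auto
qed

text \<open>
  Bisection among lifts whose fibre component stays in the orbit of one point: around each time, all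
  these lifts are translates of one and the same local lift, so they exist for a uniform time.
\<close>

lemma lift_on_trivial_interval:
  assumes U: "triv U \<phi>" and c: "smooth_curve_on M {p..q} \<gamma>" and pq: "p \<le> q"
    and gU: "\<And>t. t \<in> {p..q} \<Longrightarrow> \<gamma> t \<in> U" and b: "b \<in> points B" "\<pi> b = \<gamma> p"
  shows "\<exists>\<Gamma>. lift_on \<gamma> p q b \<Gamma>"
proof -
  note tr = trivializationD[OF U]
  have "\<pi> b \<in> U" using gU[of p] b(2) pq by simp
  then obtain f0 where f0: "f0 \<in> points F" "b = \<phi> (\<gamma> p, f0)" using tr(6)[OF b(1)] b(2) by auto
  \<comment> \<open>\<open>G\<close> acts transitively on the open set \<open>N\<close>\<close>
  define N where "N = orbit G actF f0"
  have N: "openin (topo F) N" "f0 \<in> N" unfolding N_def by (rule semi_torsor_orbit_open[OF torsor f0(1)])+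
  have NF: "N \<subseteq> points F" using openin_subset[OF N(1)] .
  have Nact: "actF g f \<in> N" if f: "f \<in> N" and g: "g \<in> carrier G" for f g
  proof -
    obtain h where h: "h \<in> carrier G" "f = actF h f0" using f by (auto simp: N_def orbit_def)
    have "actF g f = actF (g \<otimes>\<^bsub>G\<^esub> h) f0" using act_mult[OF F f0(1) g h(1)] h(2) by simp
    moreover have "g \<otimes>\<^bsub>G\<^esub> h \<in> carrier G"
      using group.is_monoid[OF G_manifoldD(1)[OF F]] g h(1) by (rule monoid.m_closed)
    ultimately show ?thesis by (auto simp: N_def orbit_def)
  qed
  have Ntrans: "\<exists>g\<in>carrier G. f' = actF g f" if f: "f \<in> N" and f': "f' \<in> N" for f f'
  proof -
    obtain h where h: "h \<in> carrier G" "f = actF h f0" using f by (auto simp: N_def orbit_def)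
    obtain k where k: "k \<in> carrier G" "f' = actF k f0" using f' by (auto simp: N_def orbit_def)
    have hi: "inv\<^bsub>G\<^esub> h \<in> carrier G" using group.inv_closed[OF G_manifoldD(1)[OF F] h(1)] .
    have "f0 = actF (inv\<^bsub>G\<^esub> h) f" using act_inv[OF F f0(1) h(1)] h(2) by simp
    hence "f' = actF (k \<otimes>\<^bsub>G\<^esub> inv\<^bsub>G\<^esub> h) f" using act_mult[OF F _ k(1) hi] k(2) f NF by auto
    moreover have "k \<otimes>\<^bsub>G\<^esub> inv\<^bsub>G\<^esub> h \<in> carrier G"
      using group.is_monoid[OF G_manifoldD(1)[OF F]] k(1) hi by (rule monoid.m_closed)
    ultimately show ?thesis by blast
  qed
  define P where "P s t \<longleftrightarrow> (p \<le> s \<longrightarrow> t \<le> q \<longrightarrow> s \<le> t \<longrightarrow>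
    (\<forall>f\<in>N. \<exists>\<Gamma>. lift_on \<gamma> s t (\<phi> (\<gamma> s, f)) \<Gamma> \<and> (\<exists>f'\<in>N. \<Gamma> t = \<phi> (\<gamma> t, f'))))" for s t
  have "P p q"
    using pq
  proof (induction rule: Bolzano)
    case (trans s m t)
    show ?case unfolding P_def
    proof (intro impI ballI)
      fix f assume st: "p \<le> s" "t \<le> q" "s \<le> t" and f: "f \<in> N"
      obtain \<Gamma> f' where 1: "lift_on \<gamma> s m (\<phi> (\<gamma> s, f)) \<Gamma>" "f' \<in> N" "\<Gamma> m = \<phi> (\<gamma> m, f')"
        using trans(1,3,4) st f unfolding P_def by (meson order_trans)
      obtain \<Delta> f'' where 2: "lift_on \<gamma> m t (\<phi> (\<gamma> m, f')) \<Delta>" "f'' \<in> N" "\<Delta> t = \<phi> (\<gamma> t, f'')"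
        using trans(2,3,4) st 1(2) unfolding P_def by (meson order_trans)
      have "lift_on \<gamma> s t (\<phi> (\<gamma> s, f)) (\<lambda>x. if x \<le> m then \<Gamma> x else \<Delta> x)"
        by (rule lift_on_concat[OF 1(1)]) (use 1(3) 2(1) trans(3,4) in simp_all)
      moreover have "\<exists>f'\<in>N. (if t \<le> m then \<Gamma> t else \<Delta> t) = \<phi> (\<gamma> t, f')"
      proof (cases "t \<le> m")
        case True
        hence "t = m" using trans(4) by simp
        thus ?thesis using 1(2,3) by auto
      qed (use 2(2,3) in auto)
      ultimately show "\<exists>\<Gamma>. lift_on \<gamma> s t (\<phi> (\<gamma> s, f)) \<Gamma> \<and> (\<exists>f'\<in>N. \<Gamma> t = \<phi> (\<gamma> t, f'))" by blast
    qed
  next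
    case (local x)
    hence x: "x \<in> {p..q}" by simp
    obtain \<delta> \<Lambda> where \<delta>: "\<delta> > 0" "horizontal_piece ({p..q} \<inter> ball x \<delta>) \<Lambda>"
      and \<Lambda>: "\<And>s. s \<in> {p..q} \<Longrightarrow> s \<in> ball x \<delta> \<Longrightarrow> \<gamma> s \<in> U \<and> (\<exists>f\<in>N. \<Lambda> s = \<phi> (\<gamma> s, f))"
      by (rule local_horizontal_lift[OF U c x gU[OF x] f0(1) N]) blast
    have "P s t" if st: "s \<le> x \<and> x \<le> t \<and> t - s < \<delta>" for s t
      unfolding P_def
    proof (intro impI ballI)
      fix f assume "p \<le> s" "t \<le> q" "s \<le> t" and f: "f \<in> N"
      have sub: "{s..t} \<subseteq> {p..q} \<inter> ball x \<delta>"
        using st \<open>p \<le> s\<close> \<open>t \<le> q\<close> by (auto simp: dist_real_def)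
      have s: "s \<in> {p..q}" "s \<in> ball x \<delta>" using sub \<open>s \<le> t\<close> by auto
      have sU: "\<gamma> s \<in> U" by (rule gU[OF s(1)])
      have pt: "\<phi> (\<gamma> s, f) \<in> points B" "\<pi> (\<phi> (\<gamma> s, f)) = \<gamma> s"
        using tr(3,4)[OF sU] f NF by auto
      show "\<exists>\<Gamma>. lift_on \<gamma> s t (\<phi> (\<gamma> s, f)) \<Gamma> \<and> (\<exists>f'\<in>N. \<Gamma> t = \<phi> (\<gamma> t, f'))"
      proof (cases "s = t")
        case True
        thus ?thesis using lift_on_refl[of "\<phi> (\<gamma> s, f)" \<gamma> s] pt f by auto
      next
        case False
        hence less: "s < t" using \<open>s \<le> t\<close> by simp
        obtain f1 where f1: "f1 \<in> N" "\<Lambda> s = \<phi> (\<gamma> s, f1)" using \<Lambda>[OF s] by blast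
        \<comment> \<open>the translate of the local lift that starts at the prescribed point\<close>
        obtain g where g: "g \<in> carrier G" "f = actF g f1" using Ntrans[OF f1(1) f] by blast
        have tr_g: "\<exists>f'\<in>N. actB g (\<Lambda> r) = \<phi> (\<gamma> r, f')" "\<pi> (actB g (\<Lambda> r)) = \<gamma> r" if r: "r \<in> {s..t}" for r
        proof -
          have r': "r \<in> {p..q}" "r \<in> ball x \<delta>" using sub r by auto
          obtain f' where f': "f' \<in> N" "\<Lambda> r = \<phi> (\<gamma> r, f')" using \<Lambda>[OF r'] by blast
          have f'F: "f' \<in> points F" using f'(1) NF by blast
          have eq: "actB g (\<Lambda> r) = \<phi> (\<gamma> r, actF g f')"
            using tr(5)[OF gU[OF r'(1)] f'F g(1)] f'(2) by simp
          show "\<exists>f'\<in>N. actB g (\<Lambda> r) = \<phi> (\<gamma> r, f')" using Nact[OF f'(1) g(1)] eq by blast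
          show "\<pi> (actB g (\<Lambda> r)) = \<gamma> r"
            unfolding eq by (rule tr(4)[OF gU[OF r'(1)] act_points[OF F f'F g(1)]])
        qed
        have "horizontal_piece {s..t} (\<lambda>r. actB g (\<Lambda> r))"
          by (rule horizontal_piece_translate[OF horizontal_piece_mono[OF \<delta>(2) sub] g(1)]) simp
        hence "lift_on \<gamma> s t (actB g (\<Lambda> s)) (\<lambda>r. actB g (\<Lambda> r))"
          by (rule lift_on_single_piece[OF less]) (rule tr_g(2))
        moreover have "actB g (\<Lambda> s) = \<phi> (\<gamma> s, f)"
          using tr(5)[OF sU _ g(1), of f1] f1 NF g(2) by auto
        ultimately show ?thesis using tr_g(1)[of t] \<open>s \<le> t\<close> by auto
      qed
    qed
    thus ?case using \<delta>(1) by blast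
  qed
  thus ?thesis using pq N(2) f0(2) unfolding P_def by blast
qed

end

text \<open>
  At either end of \<open>[0, 1]\<close> one of the two sets is a single point, which inherits smoothness
  from the other side.
\<close>

lemma piecewise_smooth_one_sided:
  assumes c: "piecewise_smooth_curve M \<gamma>" and x: "x \<in> {0..1}"
  shows "\<exists>e>0. smooth_curve_on M ({0..1} \<inter> {x..x + e}) \<gamma> \<and> smooth_curve_on M ({0..1} \<inter> {x - e..x}) \<gamma>"
proof -
  obtain n \<tau> where \<tau>: "\<tau> 0 = 0" "\<tau> n = 1" "\<And>i. i < n \<Longrightarrow> \<tau> i < \<tau> (Suc i) \<and> smooth_curve_on M {\<tau> i..\<tau> (Suc i)} \<gamma>"
    using c unfolding piecewise_smooth_curve_def by blast
  have right: "\<exists>e>0. smooth_curve_on M {x..x + e} \<gamma>" if lt: "x < 1"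
  proof -
    obtain i where i: "i < n" "\<tau> i \<le> x" "x < \<tau> (Suc i)" using partition_right[of \<tau> x n] \<tau>(1,2) x lt by auto
    thus ?thesis using \<tau>(3)[OF i(1)]
      by (intro exI[of _ "\<tau> (Suc i) - x"]) (auto intro: smooth_curve_on_mono)
  qed
  have left: "\<exists>e>0. smooth_curve_on M {x - e..x} \<gamma>" if gt: "0 < x"
  proof -
    obtain i where i: "i < n" "\<tau> i < x" "x \<le> \<tau> (Suc i)" using partition_left[of \<tau> x n] \<tau>(1,2) x gt by auto
    thus ?thesis using \<tau>(3)[OF i(1)]
      by (intro exI[of _ "x - \<tau> i"]) (auto intro: smooth_curve_on_mono)
  qed
  consider "x = 0" | "x = 1" | "0 < x" "x < 1" using x by fastforce
  thus ?thesis
  proof cases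
    case 1
    then obtain e where e: "e > 0" "smooth_curve_on M {x..x + e} \<gamma>" using right by auto
    have "{0..1} \<inter> {x - e..x} \<subseteq> {x..x + e}" "{0..1} \<inter> {x..x + e} \<subseteq> {x..x + e}" using 1 e(1) by auto
    thus ?thesis using e by (blast intro: smooth_curve_on_mono)
  next
    case 2
    then obtain e where e: "e > 0" "smooth_curve_on M {x - e..x} \<gamma>" using left by auto
    have "{0..1} \<inter> {x - e..x} \<subseteq> {x - e..x}" "{0..1} \<inter> {x..x + e} \<subseteq> {x - e..x}" using 2 e(1) by auto
    thus ?thesis using e by (blast intro: smooth_curve_on_mono)
  next
    case 3
    obtain e where e: "e > 0" "smooth_curve_on M {x - e..x} \<gamma>" using left 3 by auto
    obtain e' where e': "e' > 0" "smooth_curve_on M {x..x + e'} \<gamma>" using right 3 by auto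
    have "{0..1} \<inter> {x - min e e'..x} \<subseteq> {x - e..x}" "{0..1} \<inter> {x..x + min e e'} \<subseteq> {x..x + e'}" by auto
    hence "smooth_curve_on M ({0..1} \<inter> {x..x + min e e'}) \<gamma> \<and> smooth_curve_on M ({0..1} \<inter> {x - min e e'..x}) \<gamma>"
      using e e' by (blast intro: smooth_curve_on_mono)
    moreover have "min e e' > 0" using e e' by simp
    ultimately show ?thesis by blast
  qed
qed

context bundle_connection
begin

text \<open>
  A short interval around \<open>x\<close> is split at \<open>x\<close>, since \<open>x\<close> may be a corner of the curve.
\<close>

lemma lift_on_exists:
  assumes c: "piecewise_smooth_curve M \<gamma>" and b: "b \<in> points B" "\<pi> b = \<gamma> 0"
  shows "\<exists>\<Gamma>. lift_on \<gamma> 0 1 b \<Gamma>"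
proof -
  have cont: "continuous_map (top_of_set {0..1}) (topo M) \<gamma>"
    using c by (simp add: piecewise_smooth_curve_def)
  define P where "P s t \<longleftrightarrow> (0 \<le> s \<longrightarrow> t \<le> 1 \<longrightarrow> s \<le> t \<longrightarrow>
    (\<forall>b\<in>points B. \<pi> b = \<gamma> s \<longrightarrow> (\<exists>\<Gamma>. lift_on \<gamma> s t b \<Gamma>)))" for s t :: real
  have concat: "P s t" if P: "P s m" "P m t" and m: "s \<le> m" "m \<le> t" for s m t
    unfolding P_def
  proof (intro impI ballI)
    fix b assume st: "0 \<le> s" "t \<le> 1" "s \<le> t" and b: "b \<in> points B" "\<pi> b = \<gamma> s"
    obtain \<Gamma> where 1: "lift_on \<gamma> s m b \<Gamma>"
      using P(1) st m b unfolding P_def by (meson order_trans)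
    have "m \<in> {s..m}" using m by simp
    hence "\<Gamma> m \<in> points B" "\<pi> (\<Gamma> m) = \<gamma> m"
      using lift_on_points[OF 1] 1 unfolding lift_on_def by auto
    then obtain \<Delta> where "lift_on \<gamma> m t (\<Gamma> m) \<Delta>"
      using P(2) st m unfolding P_def by (meson order_trans)
    from lift_on_concat[OF 1 this m] show "\<exists>\<Gamma>. lift_on \<gamma> s t b \<Gamma>" by blast
  qed
  have "P 0 1"
    using zero_le_one
  proof (induction rule: Bolzano)
    case (trans s m t)
    thus ?case by (rule concat)
  next
    case (local x)
    hence x: "x \<in> {0..1}" by simp
    have "\<gamma> x \<in> points M" using continuous_map_image_subset_topspace[OF cont] x by auto
    then obtain U \<phi> where U: "triv U \<phi>" "\<gamma> x \<in> U" by (rule ex_trivialization)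
    obtain e where e: "e > 0" "smooth_curve_on M ({0..1} \<inter> {x..x + e}) \<gamma>"
      "smooth_curve_on M ({0..1} \<inter> {x - e..x}) \<gamma>"
      using piecewise_smooth_one_sided[OF c x] by blast
    have "openin (top_of_set {0..1}) {t \<in> topspace (top_of_set {0..1}). \<gamma> t \<in> U}"
      by (rule openin_continuous_map_preimage[OF cont trivializationD(1)[OF U(1)]])
    then obtain T where T: "open T" "{t \<in> {0..1}. \<gamma> t \<in> U} = {0..1} \<inter> T" by (auto simp: openin_open)
    have "x \<in> T" using T(2) x U(2) by blast
    then obtain d where d: "d > 0" "ball x d \<subseteq> T" using T(1) open_contains_ball by blast
    have piece: "P s t" if "smooth_curve_on M ({0..1} \<inter> {s..t}) \<gamma>" "{s..t} \<subseteq> ball x d" for s t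
      unfolding P_def
    proof (intro impI ballI)
      fix b assume st: "0 \<le> s" "t \<le> 1" "s \<le> t" and b: "b \<in> points B" "\<pi> b = \<gamma> s"
      have eq: "{0..1} \<inter> {s..t} = {s..t}" using st by auto
      have "smooth_curve_on M {s..t} \<gamma>" using that(1) unfolding eq .
      moreover have gU: "\<gamma> r \<in> U" if r: "r \<in> {s..t}" for r
      proof -
        have "r \<in> {0..1} \<inter> T" using r st \<open>{s..t} \<subseteq> ball x d\<close> d(2) by auto
        thus ?thesis using T(2) by blast
      qed
      ultimately show "\<exists>\<Gamma>. lift_on \<gamma> s t b \<Gamma>"
        by (intro lift_on_trivial_interval[where U = U and \<phi> = \<phi>] U(1) st(3) b)
    qed
    have "P s t" if st: "s \<le> x \<and> x \<le> t \<and> t - s < min d e" for s t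
    proof (rule concat)
      show "P s x"
      proof (rule piece)
        show "smooth_curve_on M ({0..1} \<inter> {s..x}) \<gamma>"
          by (rule smooth_curve_on_mono[OF e(3)]) (use st in auto)
        show "{s..x} \<subseteq> ball x d" using st by (auto simp: dist_real_def)
      qed
      show "P x t"
      proof (rule piece)
        show "smooth_curve_on M ({0..1} \<inter> {x..t}) \<gamma>"
          by (rule smooth_curve_on_mono[OF e(2)]) (use st in auto)
        show "{x..t} \<subseteq> ball x d" using st by (auto simp: dist_real_def)
      qed
    qed (use st in auto)
    moreover have "min d e > 0" using d(1) e(1) by simp
    ultimately show ?case by blast
  qed
  thus ?thesis using b unfolding P_def by simp
qed

text \<open>
  At a corner, a velocity of the lift is in particular a one-sided velocity of an adjacent piece.
\<close>

lemma lift_on_imp_horizontal_lift: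
  assumes l: "lift_on \<gamma> 0 1 b \<Gamma>"
  shows "horizontal_lift B \<pi> \<omega> \<gamma> b \<Gamma>"
proof -
  obtain n \<tau> where \<tau>: "\<tau> 0 = 0" "\<tau> n = 1"
    "\<And>i. i < n \<Longrightarrow> \<tau> i < \<tau> (Suc i) \<and> horizontal_piece {\<tau> i..\<tau> (Suc i)} \<Gamma>"
    using l unfolding lift_on_def partitioned_def by blast
  have \<tau>le: "\<tau> i \<le> 1" and \<tau>ge: "0 \<le> \<tau> i" if "i \<le> n" for i
    using partition_bounds[of n \<tau>, OF conjunct1[OF \<tau>(3)] that] by (simp_all add: \<tau>(1,2))
  have "horizontal B \<omega> \<Gamma>"
    unfolding horizontal_def
  proof (intro ballI allI impI)
    fix t :: real and v assume t: "t \<in> {0..1}" and v: "has_velocity B \<Gamma> t v"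
    have "\<exists>i<n. \<tau> i \<le> t \<and> t \<le> \<tau> (Suc i)"
    proof (cases "t < 1")
      case True
      thus ?thesis using partition_right[of \<tau> t n] \<tau>(1,2) t by (auto intro: less_imp_le)
    next
      case False
      thus ?thesis using partition_left[of \<tau> t n] \<tau>(1,2) t by (auto intro: less_imp_le)
    qed
    then obtain i where i: "i < n" "\<tau> i \<le> t" "t \<le> \<tau> (Suc i)" by blast
    have sub: "{\<tau> i..\<tau> (Suc i)} \<subseteq> {0..1}" using \<tau>le[of "Suc i"] \<tau>ge[of i] i(1) by auto
    have ti: "t \<in> {\<tau> i..\<tau> (Suc i)}" using i by simp
    obtain v' where v': "((coord_at B (\<Gamma> t) \<circ> \<Gamma>) has_vector_derivative v') (at t within {\<tau> i..\<tau> (Suc i)})"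
      "\<omega> (\<Gamma> t) v' = 0"
      using \<tau>(3)[OF i(1)] ti unfolding horizontal_piece_def by blast
    have "((coord_at B (\<Gamma> t) \<circ> \<Gamma>) has_vector_derivative v) (at t within {\<tau> i..\<tau> (Suc i)})"
      using v has_vector_derivative_within_subset[OF _ sub] unfolding has_velocity_def by blast
    hence "v = v'"
      using vector_derivative_unique_within_closed_interval[of "\<tau> i" "\<tau> (Suc i)" t] v'(1) \<tau>(3)[OF i(1)] ti
      by (simp add: cbox_interval)
    thus "\<omega> (\<Gamma> t) v = 0" using v'(2) by simp
  qed
  moreover have "piecewise_smooth_curve B \<Gamma>"
    unfolding piecewise_smooth_curve_def
  proof (intro conjI exI allI impI)
    show "continuous_map (top_of_set {0..1}) (topo B) \<Gamma>" using l by (simp add: lift_on_def)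
    show "\<tau> 0 = 0" "\<tau> n = 1" by (fact \<tau>(1), fact \<tau>(2))
    fix i assume "i < n"
    thus "\<tau> i < \<tau> (Suc i)" "smooth_curve_on B {\<tau> i..\<tau> (Suc i)} \<Gamma>"
      using \<tau>(3) by (auto simp: horizontal_piece_def)
  qed
  ultimately show ?thesis using l by (simp add: horizontal_lift_def lift_on_def)
qed

end


section \<open>Uniqueness of horizontal lifts\<close>

context bundle_connection
begin

text \<open>
  The inverse of the trivialization is smooth, so the fibre component of a smooth lift is smooth.
\<close>

lemma lift_fibre_coordinates:
  assumes U: "triv U \<phi>" and sm: "smooth_curve_on B I \<Gamma>" and x: "x \<in> I"
    and IU: "\<And>s. s \<in> I \<Longrightarrow> \<pi> (\<Gamma> s) \<in> U" and y: "(V, y) \<in> atlas F" "f0 \<in> V"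
    and f0: "\<Gamma> x = \<phi> (\<pi> (\<Gamma> x), f0)"
  obtains e w where "e > 0" "smooth_on (ball x e) w" "w x = y f0"
    "\<And>s. s \<in> I \<Longrightarrow> s \<in> ball x e \<Longrightarrow> \<Gamma> s = \<phi> (\<pi> (\<Gamma> s), inv_into V y (w s))"
proof -
  note tr = trivializationD[OF U] and ch = charted_trivialization[OF U]
  let ?MU = "open_submanifold M U" and ?BU = "open_submanifold B (over U)"
  let ?N = "prod_manifold ?MU F"
  define \<psi> where "\<psi> = inv_into (points ?N) \<phi>"
  note diff = conjunct1[OF conjunct2[OF U[unfolded trivialization_def]], unfolded diffeomorphism_def]
  have \<psi>: "smooth_map ?BU ?N \<psi>" unfolding \<psi>_def by (rule conjunct2[OF conjunct2[OF diff]])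
  have bij: "bij_betw \<phi> (points ?N) (points ?BU)" by (rule conjunct1[OF conjunct2[OF diff]])
  have ptN: "points ?N = U \<times> points F"
    using openin_subset[OF tr(1)] by (simp add: prod_manifold_def open_submanifold_def inf_absorb2)
  have VF: "V \<subseteq> points F" by (rule chartedD(5)[OF charted(3) y(1)])
  have ptB: "\<Gamma> s \<in> points ?BU" if "s \<in> I" for s
    using smooth_curve_on_points[OF charted(2) sm that] IU[OF that] by (simp add: open_submanifold_def)
  have inv: "\<exists>f\<in>points F. \<psi> (\<Gamma> s) = (\<pi> (\<Gamma> s), f) \<and> \<Gamma> s = \<phi> (\<pi> (\<Gamma> s), f)" if s: "s \<in> I" for s
  proof -
    have "\<Gamma> s \<in> points B" by (rule smooth_curve_on_points[OF charted(2) sm s])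
    then obtain f where f: "f \<in> points F" "\<Gamma> s = \<phi> (\<pi> (\<Gamma> s), f)"
      using tr(6) IU[OF s] by blast
    have "(\<pi> (\<Gamma> s), f) \<in> points ?N" using f(1) IU[OF s] by (simp add: ptN)
    hence "\<psi> (\<phi> (\<pi> (\<Gamma> s), f)) = (\<pi> (\<Gamma> s), f)"
      unfolding \<psi>_def by (rule inv_into_f_f[OF bij_betw_imp_inj_on[OF bij]])
    thus ?thesis using f by (intro bexI[of _ f]) simp_all
  qed
  have \<psi>x: "\<psi> (\<Gamma> x) = (\<pi> (\<Gamma> x), f0)"
  proof -
    have "(\<pi> (\<Gamma> x), f0) \<in> points ?N" using IU[OF x] y(2) VF by (auto simp: ptN)
    hence "\<psi> (\<phi> (\<pi> (\<Gamma> x), f0)) = (\<pi> (\<Gamma> x), f0)"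
      unfolding \<psi>_def by (rule inv_into_f_f[OF bij_betw_imp_inj_on[OF bij]])
    thus ?thesis using f0 by simp
  qed
  obtain Um xm where xm: "(Um, xm) \<in> atlas M" "\<pi> (\<Gamma> x) \<in> Um"
    using charted_cover[OF charted(1)] openin_subset[OF tr(1)] IU[OF x] by blast
  have pc: "((Um \<inter> U) \<times> V, map_prod xm y) \<in> atlas ?N"
  proof -
    have "(Um \<inter> U, xm) \<in> atlas ?MU" by (rule chart_open_submanifold[OF xm(1)])
    thus ?thesis using y(1) by (auto simp: prod_manifold_def)
  qed
  have smU: "smooth_curve_on ?BU I \<Gamma>"
  proof -
    have "\<Gamma> s \<in> over U" if "s \<in> I" for s
      using smooth_curve_on_points[OF charted(2) sm that] IU[OF that] by simp
    from smooth_curve_on_submanifold[of I \<Gamma>, OF this] sm show ?thesis by blast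
  qed
  have in_x: "\<psi> (\<Gamma> x) \<in> (Um \<inter> U) \<times> V" using \<psi>x xm(2) IU[OF x] y(2) by simp
  obtain e c where e: "e > 0" "smooth_on (ball x e) c"
    and c: "\<And>s. s \<in> I \<Longrightarrow> s \<in> ball x e \<Longrightarrow>
      \<Gamma> s \<in> points ?BU \<and> \<psi> (\<Gamma> s) \<in> (Um \<inter> U) \<times> V \<and> map_prod xm y (\<psi> (\<Gamma> s)) = c s"
    by (rule smooth_curve_on_coords[OF ch(3) ch(1) \<psi> smU x pc in_x]) (rule that)
  show thesis
  proof (rule that[OF e(1)])
    show "smooth_on (ball x e) (\<lambda>s. snd (c s))"
      by (rule smooth_on_linear_compose[OF bounded_linear_snd open_ball e(2)])
    have "x \<in> ball x e" using e(1) by simp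
    from conjunct2[OF conjunct2[OF c[OF x this]]] show "snd (c x) = y f0" unfolding \<psi>x by (metis map_prod_simp snd_conv)
    fix s assume s: "s \<in> I" "s \<in> ball x e"
    obtain f where f: "f \<in> points F" "\<psi> (\<Gamma> s) = (\<pi> (\<Gamma> s), f)" "\<Gamma> s = \<phi> (\<pi> (\<Gamma> s), f)"
      using inv[OF s(1)] by blast
    have "f \<in> V" "c s = (xm (\<pi> (\<Gamma> s)), y f)" using c[OF s] unfolding f(2) by auto
    hence "inv_into V y (snd (c s)) = f"
      using inv_into_f_f[OF chartedD(2)[OF charted(3) y(1)]] by simp
    thus "\<Gamma> s = \<phi> (\<pi> (\<Gamma> s), inv_into V y (snd (c s)))" using f(3) by simp
  qed
qed

lemma has_vector_derivative_smooth_on: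
  fixes w :: "real \<Rightarrow> 'v::real_normed_vector"
  assumes "smooth_on S w" "t \<in> S"
  shows "\<exists>d. (w has_vector_derivative d) (at t)"
  using smooth_on_has_derivative[OF assms] vector_derivative_works differentiable_def by blast

text \<open>
  Both lifts satisfy the same differential equation in the fibre, at least in the interior of the
  interval, and they agree at \<open>x\<close>; the differential inequality for their difference gives the rest.
\<close>

lemma horizontal_lifts_locally_unique:
  assumes sm: "\<And>i. i \<in> {1, 2} \<Longrightarrow> smooth_curve_on B {p..q} (\<Gamma> i)"
    and pi: "\<And>i s. i \<in> {1, 2} \<Longrightarrow> s \<in> {p..q} \<Longrightarrow> \<pi> (\<Gamma> i s) = \<gamma> s"
    and hor: "\<And>i s v. i \<in> {1, 2} \<Longrightarrow> s \<in> {p<..<q} \<Longrightarrow>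
      ((coord_at B (\<Gamma> i s) \<circ> \<Gamma> i) has_vector_derivative v) (at s) \<Longrightarrow> \<omega> (\<Gamma> i s) v = 0"
    and x: "x \<in> {p..q}" and eq: "\<Gamma> 1 x = \<Gamma> (2::nat) x"
  shows "\<exists>\<delta>>0. \<forall>s\<in>{p..q} \<inter> ball x \<delta>. \<Gamma> 1 s = \<Gamma> 2 s"
proof -
  let ?I = "{p..q}"
  have one: "(1::nat) \<in> {1, 2}" and two: "(2::nat) \<in> {1, 2}" by simp_all
  have s\<gamma>: "smooth_curve_on M ?I \<gamma>"
    by (rule smooth_curve_on_mono[OF smooth_curve_on_map[OF charted(2,1) \<pi> sm[OF one]] subset_refl])
      (rule pi[OF one])
  have "\<gamma> x \<in> points M" by (rule smooth_curve_on_points[OF charted(1) s\<gamma> x])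
  then obtain U \<phi> where U: "triv U \<phi>" "\<gamma> x \<in> U" by (rule ex_trivialization)
  have "\<Gamma> 1 x \<in> points B" by (rule smooth_curve_on_points[OF charted(2) sm[OF one] x])
  then obtain f0 where f0: "f0 \<in> points F" "\<Gamma> 1 x = \<phi> (\<gamma> x, f0)"
    using trivializationD(6)[OF U(1)] U(2) pi[OF one x] by metis
  obtain V y where y: "(V, y) \<in> atlas F" "f0 \<in> V" using charted_cover[OF charted(3) f0(1)] by blast
  obtain r R where r: "r > 0" "smooth_on (ball x r \<times> ball (y f0) r) R" "ball (y f0) r \<subseteq> y ` V"
    and rU: "\<And>s. s \<in> ?I \<Longrightarrow> s \<in> ball x r \<Longrightarrow> \<gamma> s \<in> U"
    and ode: "\<And>J w s d. J \<subseteq> ?I \<inter> ball x r \<Longrightarrow> w ` J \<subseteq> ball (y f0) r \<Longrightarrow> s \<in> J \<Longrightarrow>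
      (w has_vector_derivative d) (at s within J) \<Longrightarrow>
      \<exists>v. ((coord_at B (\<phi> (\<gamma> s, inv_into V y (w s))) \<circ> (\<lambda>s. \<phi> (\<gamma> s, inv_into V y (w s))))
             has_vector_derivative v) (at s within J) \<and>
        (\<omega> (\<phi> (\<gamma> s, inv_into V y (w s))) v = 0 \<longleftrightarrow> d = R (s, w s))"
    by (rule horizontal_in_trivialization_ode[OF U(1) s\<gamma> x U(2) y]) (rule that)
  have oD: "open (ball x r \<times> ball (y f0) r)" by (intro open_Times open_ball)
  have D0: "(x, y f0) \<in> ball x r \<times> ball (y f0) r" using r(1) by simp
  obtain \<rho> L K where \<rho>: "\<rho> > 0" and \<rho>D: "cball x \<rho> \<times> cball (y f0) \<rho> \<subseteq> ball x r \<times> ball (y f0) r"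
    and lip: "\<And>s w w'. s \<in> cball x \<rho> \<Longrightarrow> w \<in> cball (y f0) \<rho> \<Longrightarrow> w' \<in> cball (y f0) \<rho> \<Longrightarrow>
      norm (R (s, w) - R (s, w')) \<le> L * norm (w - w')"
    by (rule smooth_locally_lipschitz[OF oD r(2) D0]) (rule that)
  have \<rho>r: "cball x \<rho> \<subseteq> ball x r" "cball (y f0) \<rho> \<subseteq> ball (y f0) r"
    using \<rho>D \<rho> by (auto simp: Times_subset_cancel2 times_subset_iff)
  define C where "C i e w \<longleftrightarrow> e > 0 \<and> e \<le> \<rho> \<and> smooth_on (ball x e) w \<and> w x = y f0 \<and>
      w ` ball x e \<subseteq> cball (y f0) \<rho> \<and>
      (\<forall>s\<in>?I \<inter> ball x e. \<Gamma> i s = \<phi> (\<gamma> s, inv_into V y (w s)))" for i e w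
  have ex: "\<exists>e w. C i e w" if i: "i \<in> {1, 2}" for i
  proof -
    let ?I' = "?I \<inter> ball x r"
    have smI': "smooth_curve_on B ?I' (\<Gamma> i)" by (rule smooth_curve_on_mono[OF sm[OF i]]) auto
    have xI': "x \<in> ?I'" using x r(1) by simp
    have piU: "\<pi> (\<Gamma> i s) \<in> U" if "s \<in> ?I'" for s using rU[of s] pi[OF i, of s] that by simp
    have fi: "\<Gamma> i x = \<phi> (\<pi> (\<Gamma> i x), f0)" using f0(2) eq i pi[OF i x] by auto
    obtain e w where e: "e > 0" "smooth_on (ball x e) w" "w x = y f0"
      and w: "\<And>s. s \<in> ?I' \<Longrightarrow> s \<in> ball x e \<Longrightarrow> \<Gamma> i s = \<phi> (\<pi> (\<Gamma> i s), inv_into V y (w s))"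
      by (rule lift_fibre_coordinates[OF U(1) smI' xI' piU y fi]) (assumption+, rule that)
    have "open (ball x e \<inter> w -` ball (y f0) \<rho>)"
      by (rule continuous_open_preimage[OF smooth_on_continuous[OF e(2)] open_ball open_ball])
    moreover have "x \<in> ball x e \<inter> w -` ball (y f0) \<rho>" using e(1,3) \<rho> by simp
    ultimately obtain d where d: "d > 0" "ball x d \<subseteq> ball x e \<inter> w -` ball (y f0) \<rho>"
      using open_contains_ball by blast
    let ?e = "min d \<rho>"
    have sub: "ball x ?e \<subseteq> ball x e" "ball x ?e \<subseteq> cball x \<rho>" "w ` ball x ?e \<subseteq> cball (y f0) \<rho>"
      using d(2) by (auto simp: subset_iff)
    show ?thesis unfolding C_def
    proof (intro exI conjI ballI)
      show "?e > 0" "?e \<le> \<rho>" using d(1) \<rho> by auto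
      show "smooth_on (ball x ?e) w" by (rule smooth_on_subset[OF e(2) sub(1)])
      show "w x = y f0" by (rule e(3))
      show "w ` ball x ?e \<subseteq> cball (y f0) \<rho>" by (rule sub(3))
      fix s assume s: "s \<in> ?I \<inter> ball x ?e"
      have "s \<in> ?I'" "s \<in> ball x e" using s sub(1,2) \<rho>r(1) by blast+
      from w[OF this] show "\<Gamma> i s = \<phi> (\<gamma> s, inv_into V y (w s))" using pi[OF i, of s] s by simp
    qed
  qed
  obtain e w where C: "\<And>i. i \<in> {1, 2} \<Longrightarrow> C i (e i) (w i)" using ex by metis
  have e: "e i > 0" "e i \<le> \<rho>"
    and w: "smooth_on (ball x (e i)) (w i)" "w i x = y f0" "w i ` ball x (e i) \<subseteq> cball (y f0) \<rho>"
      "\<And>s. s \<in> ?I \<inter> ball x (e i) \<Longrightarrow> \<Gamma> i s = \<phi> (\<gamma> s, inv_into V y (w i s))"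
    if "i \<in> {1, 2}" for i
    using C[OF that] unfolding C_def by blast+
  define \<delta> where "\<delta> = min (e 1) (e 2)"
  have \<delta>: "\<delta> > 0" using e(1)[OF one] e(1)[OF two] by (simp add: \<delta>_def)
  have \<delta>e: "ball x \<delta> \<subseteq> ball x (e i)" if "i \<in> {1, 2}" for i using that by (auto simp: \<delta>_def)
  have \<delta>\<rho>: "ball x \<delta> \<subseteq> cball x \<rho>" using e(2)[OF one] by (auto simp: \<delta>_def)
  let ?J = "?I \<inter> ball x \<delta>"
  have w\<rho>: "w i t \<in> cball (y f0) \<rho>" if "i \<in> {1, 2}" "t \<in> ball x \<delta>" for i t
    using w(3)[OF that(1)] \<delta>e[OF that(1)] that(2) by blast
  have der: "(w i has_vector_derivative R (t, w i t)) (at t)"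
    if i: "i \<in> {1, 2}" and t: "t \<in> {p<..<q}" "t \<in> ball x \<delta>" for i t
  proof -
    have "t \<in> ball x (e i)" using \<delta>e[OF i] t(2) by blast
    then obtain d where d: "(w i has_vector_derivative d) (at t)"
      using has_vector_derivative_smooth_on[OF w(1)[OF i]] by blast
    have tJ: "t \<in> ?J" using t by auto
    have at: "at t within ?J = at t"
    proof (rule at_within_interior)
      have "{p<..<q} \<inter> ball x \<delta> \<subseteq> interior ?J"
        by (rule interior_maximal) auto
      thus "t \<in> interior ?J" using t by blast
    qed
    have 1: "?J \<subseteq> ?I \<inter> ball x r" using \<delta>\<rho> \<rho>r(1) by blast
    have 2: "w i ` ?J \<subseteq> ball (y f0) r" using w\<rho>[OF i] \<rho>r(2) by blast
    have eq: "\<Gamma> i s = \<phi> (\<gamma> s, inv_into V y (w i s))" if "s \<in> ?J" for s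
      using w(4)[OF i, of s] \<delta>e[OF i] that by blast
    obtain v where v: "((coord_at B (\<phi> (\<gamma> t, inv_into V y (w i t))) \<circ> (\<lambda>s. \<phi> (\<gamma> s, inv_into V y (w i s))))
        has_vector_derivative v) (at t within ?J)"
      "\<omega> (\<phi> (\<gamma> t, inv_into V y (w i t))) v = 0 \<longleftrightarrow> d = R (t, w i t)"
      using ode[OF 1 2 tJ has_vector_derivative_at_within[OF d]] by blast
    have "((coord_at B (\<Gamma> i t) \<circ> \<Gamma> i) has_vector_derivative v) (at t within ?J)"
      by (rule has_vector_derivative_transform[OF tJ _ v(1)[folded eq[OF tJ]]]) (simp add: eq)
    hence "\<omega> (\<Gamma> i t) v = 0" unfolding at by (rule hor[OF i t(1)])
    hence "d = R (t, w i t)" using v(2) eq[OF tJ] by simp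
    thus ?thesis using d by simp
  qed
  have "\<Gamma> 1 s = \<Gamma> 2 s" if s: "s \<in> ?J" for s
  proof -
    have xJ: "x \<in> ?J" using x \<delta> by simp
    have seg: "closed_segment x s \<subseteq> ?J"
      by (rule closed_segment_subset[OF xJ s]) (intro convex_Int convex_real_interval convex_ball)
    have oseg: "open_segment x s \<subseteq> {p<..<q}"
      using x s by (auto simp: open_segment_eq_real_ivl split: if_splits)
    have "w 1 s - w 2 s = 0"
    proof (rule gronwall_zero[of x s "\<lambda>t. w 1 t - w 2 t" "\<lambda>t. R (t, w 1 t) - R (t, w 2 t)" L])
      have "continuous_on (closed_segment x s) (w i)" if "i \<in> {1, 2}" for i
        by (rule continuous_on_subset[OF smooth_on_continuous[OF w(1)[OF that]]])
          (use seg \<delta>e[OF that] in blast)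
      thus "continuous_on (closed_segment x s) (\<lambda>t. w 1 t - w 2 t)"
        by (intro continuous_on_diff) simp_all
      show "w 1 x - w 2 x = 0" using w(2)[OF one] w(2)[OF two] by simp
      fix t assume t: "t \<in> open_segment x s"
      have t': "t \<in> {p<..<q}" "t \<in> ball x \<delta>"
        using oseg t seg segment_open_subset_closed[of x s] by blast+
      show "((\<lambda>t. w 1 t - w 2 t) has_vector_derivative R (t, w 1 t) - R (t, w 2 t)) (at t) \<and>
          norm (R (t, w 1 t) - R (t, w 2 t)) \<le> L * norm (w 1 t - w 2 t)"
        by (intro conjI has_vector_derivative_diff der[OF one t'] der[OF two t'] lip
            w\<rho>[OF one t'(2)] w\<rho>[OF two t'(2)] subsetD[OF \<delta>\<rho> t'(2)])
    qed
    moreover have "\<Gamma> i s = \<phi> (\<gamma> s, inv_into V y (w i s))" if "i \<in> {1, 2}" for i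
      using w(4)[OF that, of s] \<delta>e[OF that] s by blast
    ultimately show ?thesis using one two by simp
  qed
  thus ?thesis using \<delta> by blast
qed

text \<open>
  The set of times at which the lifts agree is open and closed in \<open>[0, 1]\<close>. Around each time the two
  sides are treated separately, since the lifts may have corners there.
\<close>

lemma horizontal_lift_unique:
  assumes l1: "horizontal_lift B \<pi> \<omega> \<gamma> b \<Gamma>" and l2: "horizontal_lift B \<pi> \<omega> \<gamma> b \<Delta>" and t: "t \<in> {0..1}"
  shows "\<Gamma> t = \<Delta> t"
proof -
  \<comment> \<open>indexing the two lifts lets each statement about both be proved once\<close>
  define H where "H i = (if i = (1::nat) then \<Gamma> else \<Delta>)" for i
  have l: "horizontal_lift B \<pi> \<omega> \<gamma> b (H i)" for i using l1 l2 by (simp add: H_def)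
  have pw: "piecewise_smooth_curve B (H i)" and pi: "\<And>t. t \<in> {0..1} \<Longrightarrow> \<pi> (H i t) = \<gamma> t"
    and hor: "horizontal B \<omega> (H i)" and H0: "H i 0 = b" for i
    using l[of i] by (simp_all add: horizontal_lift_def)
  have cont: "continuous_map (top_of_set {0..1}) (topo B) (H i)" for i
    using pw[of i] by (simp add: piecewise_smooth_curve_def)
  let ?E = "{t \<in> topspace (top_of_set {0..1}). H 1 t = H 2 t}"
  have "Hausdorff_space (topo B)" using G_manifoldD(4)[OF B] by (simp add: smooth_manifold_def)
  hence closed: "closedin (top_of_set {0..1}) ?E"
    by (rule closedin_continuous_maps_eq) (rule cont)+
  have interval: "\<exists>\<delta>>0. \<forall>s\<in>{p..q} \<inter> ball x \<delta>. H 1 s = H 2 s"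
    if x: "x \<in> {p..q}" and eq: "H 1 x = H 2 x" and sub: "{p..q} \<subseteq> {0..1}"
      and sm: "\<And>i. i \<in> {1, 2} \<Longrightarrow> smooth_curve_on B {p..q} (H i)" for p q x
  proof (rule horizontal_lifts_locally_unique[OF sm _ _ x eq])
    show "\<pi> (H i s) = \<gamma> s" if "s \<in> {p..q}" for i s using pi sub that by blast
    show "\<omega> (H i s) v = 0" if s: "s \<in> {p<..<q}"
      and v: "((coord_at B (H i s) \<circ> H i) has_vector_derivative v) (at s)" for i s v
    proof -
      have "s \<in> {0..1}" using sub s by auto
      moreover have "has_velocity B (H i) s v"
        unfolding has_velocity_def by (rule has_vector_derivative_at_within[OF v])
      ultimately show ?thesis using hor[of i] unfolding horizontal_def by blast
    qed
  qed
  have nbhd: "\<exists>\<delta>>0. \<forall>s\<in>{0..1} \<inter> ball x \<delta>. H 1 s = H 2 s" if x: "x \<in> {0..1}" and eq: "H 1 x = H 2 x" for x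
  proof -
    obtain e1 where e1: "e1 > 0" "smooth_curve_on B ({0..1} \<inter> {x..x + e1}) (H 1)"
      "smooth_curve_on B ({0..1} \<inter> {x - e1..x}) (H 1)"
      using piecewise_smooth_one_sided[OF pw x] by blast
    obtain e2 where e2: "e2 > 0" "smooth_curve_on B ({0..1} \<inter> {x..x + e2}) (H 2)"
      "smooth_curve_on B ({0..1} \<inter> {x - e2..x}) (H 2)"
      using piecewise_smooth_one_sided[OF pw x] by blast
    define e where "e = min e1 e2"
    have e: "e > 0" using e1(1) e2(1) by (simp add: e_def)
    have R: "smooth_curve_on B {x..min 1 (x + e)} (H i)" if i: "i \<in> {1, 2}" for i
    proof -
      have "{x..min 1 (x + e)} \<subseteq> {0..1} \<inter> {x..x + e1}" "{x..min 1 (x + e)} \<subseteq> {0..1} \<inter> {x..x + e2}"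
        using x by (auto simp: e_def)
      from smooth_curve_on_mono[OF e1(2) this(1) refl] smooth_curve_on_mono[OF e2(2) this(2) refl]
      show ?thesis using i by auto
    qed
    have L: "smooth_curve_on B {max 0 (x - e)..x} (H i)" if i: "i \<in> {1, 2}" for i
    proof -
      have "{max 0 (x - e)..x} \<subseteq> {0..1} \<inter> {x - e1..x}" "{max 0 (x - e)..x} \<subseteq> {0..1} \<inter> {x - e2..x}"
        using x by (auto simp: e_def)
      from smooth_curve_on_mono[OF e1(3) this(1) refl] smooth_curve_on_mono[OF e2(3) this(2) refl]
      show ?thesis using i by auto
    qed
    obtain d1 where d1: "d1 > 0" "\<And>s. s \<in> {x..min 1 (x + e)} \<inter> ball x d1 \<Longrightarrow> H 1 s = H 2 s"
      using interval[of x x "min 1 (x + e)", OF _ eq _ R] x e by auto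
    obtain d2 where d2: "d2 > 0" "\<And>s. s \<in> {max 0 (x - e)..x} \<inter> ball x d2 \<Longrightarrow> H 1 s = H 2 s"
      using interval[of x "max 0 (x - e)" x, OF _ eq _ L] x e by auto
    have "H 1 s = H 2 s" if s: "s \<in> {0..1} \<inter> ball x (min e (min d1 d2))" for s
    proof (cases "x \<le> s")
      case True
      show ?thesis by (rule d1(2)) (use s True in \<open>auto simp: dist_real_def\<close>)
    next
      case False
      show ?thesis by (rule d2(2)) (use s False in \<open>auto simp: dist_real_def\<close>)
    qed
    thus ?thesis using e d1(1) d2(1) by (intro exI[of _ "min e (min d1 d2)"]) auto
  qed
  have "openin (top_of_set {0..1}) ?E"
    unfolding openin_contains_ball
  proof (intro conjI ballI)
    fix x assume "x \<in> ?E"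
    then obtain \<delta> where "\<delta> > 0" "\<forall>s\<in>{0..1} \<inter> ball x \<delta>. H 1 s = H 2 s" using nbhd[of x] by auto
    thus "\<exists>e>0. ball x e \<inter> {0..1} \<subseteq> ?E" by (intro exI[of _ \<delta>]) auto
  qed auto
  from connected_clopen[THEN iffD1, OF connected_Icc, rule_format, OF conjI[OF this closed]]
  have "?E = {} \<or> ?E = {0..1}" .
  moreover have "0 \<in> ?E" using H0[of 1] H0[of 2] by simp
  ultimately have "t \<in> ?E" using t by blast
  thus ?thesis by (simp add: H_def)
qed

text \<open>
  A velocity \<open>v\<close> of \<open>g\<Gamma>\<close> might a priori exist where \<open>\<Gamma>\<close> has none, so it is first pulled back by
  \<open>g\<^sup>-\<^sup>1\<close> to a velocity of \<open>\<Gamma>\<close>.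
\<close>

lemma horizontal_lift_translate:
  assumes l: "horizontal_lift B \<pi> \<omega> \<gamma> b \<Gamma>" and g: "g \<in> carrier G"
  shows "horizontal_lift B \<pi> \<omega> \<gamma> (actB g b) (\<lambda>t. actB g (\<Gamma> t))"
proof -
  have pw: "piecewise_smooth_curve B \<Gamma>" and hor: "horizontal B \<omega> \<Gamma>"
    and pi: "\<And>t. t \<in> {0..1} \<Longrightarrow> \<pi> (\<Gamma> t) = \<gamma> t" and \<Gamma>0: "\<Gamma> 0 = b"
    using l by (simp_all add: horizontal_lift_def)
  have cont: "continuous_map (top_of_set {0..1}) (topo B) \<Gamma>"
    using pw by (simp add: piecewise_smooth_curve_def)
  have pt: "\<Gamma> t \<in> points B" if "t \<in> {0..1}" for t
    using continuous_map_image_subset_topspace[OF cont] that by auto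
  let ?\<Delta> = "\<lambda>t. actB g (\<Gamma> t)"
  have sg: "smooth_map B B (actB g)" by (rule smooth_map_act[OF B g])
  have contg: "continuous_map (top_of_set {0..1}) (topo B) ?\<Delta>"
    using continuous_map_compose[OF cont] sg by (fastforce simp: smooth_map_def o_def)
  have gi: "inv\<^bsub>G\<^esub> g \<in> carrier G" using group.inv_closed[OF G_manifoldD(1)[OF B] g] .
  obtain n \<tau> where \<tau>: "\<tau> 0 = 0" "\<tau> n = 1" "\<And>i. i < n \<Longrightarrow> \<tau> i < \<tau> (Suc i) \<and> smooth_curve_on B {\<tau> i..\<tau> (Suc i)} \<Gamma>"
    using pw unfolding piecewise_smooth_curve_def by blast
  have "piecewise_smooth_curve B ?\<Delta>"
    unfolding piecewise_smooth_curve_def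
  proof (intro conjI exI allI impI contg)
    show "\<tau> 0 = 0" "\<tau> n = 1" by (fact \<tau>(1), fact \<tau>(2))
    fix i assume i: "i < n"
    show "\<tau> i < \<tau> (Suc i)" using \<tau>(3)[OF i] by simp
    show "smooth_curve_on B {\<tau> i..\<tau> (Suc i)} ?\<Delta>"
      by (rule smooth_curve_on_map[OF charted(2,2) sg conjunct2[OF \<tau>(3)[OF i]]])
  qed
  moreover have "horizontal B \<omega> ?\<Delta>"
    unfolding horizontal_def
  proof (intro ballI allI impI)
    fix t :: real and v assume t: "t \<in> {0..1}" and v: "has_velocity B ?\<Delta> t v"
    have undo: "actB (inv\<^bsub>G\<^esub> g) (?\<Delta> s) = \<Gamma> s" if "s \<in> {0..1}" for s
      by (rule act_inv[OF B pt[OF that] g])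
    let ?v = "differential B B (actB (inv\<^bsub>G\<^esub> g)) (?\<Delta> t) v"
    have "((coord_at B (actB (inv\<^bsub>G\<^esub> g) (?\<Delta> t)) \<circ> (\<lambda>s. actB (inv\<^bsub>G\<^esub> g) (?\<Delta> s))) has_vector_derivative ?v)
        (at t within {0..1})"
      by (rule velocity_image[OF charted(2,2) smooth_map_act[OF B gi] t contg v[unfolded has_velocity_def]])
    hence vel: "((coord_at B (\<Gamma> t) \<circ> \<Gamma>) has_vector_derivative ?v) (at t within {0..1})"
      unfolding undo[OF t] by (rule has_vector_derivative_transform[OF t, rotated]) (simp add: undo)
    hence "\<omega> (\<Gamma> t) ?v = 0" using hor t unfolding horizontal_def has_velocity_def by blast
    hence "\<omega> (?\<Delta> t) (differential B B (actB g) (\<Gamma> t) ?v) = 0"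
      by (rule connection_translate[OF g pt[OF t]])
    moreover have "((coord_at B (?\<Delta> t) \<circ> ?\<Delta>) has_vector_derivative differential B B (actB g) (\<Gamma> t) ?v)
        (at t within {0..1})"
      by (rule velocity_image[OF charted(2,2) sg t cont vel])
    hence "v = differential B B (actB g) (\<Gamma> t) ?v"
      using vector_derivative_unique_within_closed_interval[of 0 1 t] v t
      by (simp add: has_velocity_def cbox_interval)
    ultimately show "\<omega> (?\<Delta> t) v = 0" by metis
  qed
  moreover have "\<pi> (?\<Delta> t) = \<gamma> t" if "t \<in> {0..1}" for t using \<pi>_act[OF g pt[OF that]] pi[OF that] by simp
  ultimately show ?thesis by (simp add: horizontal_lift_def \<Gamma>0)
qed

lemma lift_on_restrict:
  assumes l: "lift_on \<gamma> p q b \<Gamma>" and pq: "p \<le> q"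
  shows "lift_on \<gamma> p q b (restrict \<Gamma> {p..q})"
proof -
  let ?H = "restrict \<Gamma> {p..q}"
  obtain n \<tau> where \<tau>: "\<tau> 0 = p" "\<tau> n = q"
    "\<And>i. i < n \<Longrightarrow> \<tau> i < \<tau> (Suc i) \<and> horizontal_piece {\<tau> i..\<tau> (Suc i)} \<Gamma>"
    using l unfolding lift_on_def partitioned_def by blast
  have bounds: "p \<le> \<tau> i" "\<tau> i \<le> q" if "i \<le> n" for i
    using partition_bounds[of n \<tau>, OF conjunct1[OF \<tau>(3)] that] by (simp_all add: \<tau>(1,2))
  have "horizontal_piece {\<tau> i..\<tau> (Suc i)} ?H" if i: "i < n" for i
    by (rule horizontal_piece_mono[OF conjunct2[OF \<tau>(3)[OF i]] subset_refl])
      (use bounds(1)[of i] bounds(2)[of "Suc i"] i in auto)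
  hence "partitioned (\<lambda>J. horizontal_piece J ?H) p q"
    unfolding partitioned_def using \<tau> by blast
  moreover have "continuous_map (top_of_set {p..q}) (topo B) ?H"
    by (rule continuous_map_eq[of _ _ \<Gamma>]) (use l in \<open>auto simp: lift_on_def\<close>)
  ultimately show ?thesis using l pq by (simp add: lift_on_def)
qed

lemma parallel_transport_eq:
  assumes l: "horizontal_lift B \<pi> \<omega> \<gamma> b \<Gamma>"
  shows "parallel_transport B \<pi> \<omega> \<gamma> b = \<Gamma> 1"
  unfolding parallel_transport_def
proof (rule the_equality)
  show "\<exists>\<Delta>. horizontal_lift B \<pi> \<omega> \<gamma> b \<Delta> \<and> \<Gamma> 1 = \<Delta> 1" using l by blast
  show "c = \<Gamma> 1" if "\<exists>\<Delta>. horizontal_lift B \<pi> \<omega> \<gamma> b \<Delta> \<and> c = \<Delta> 1" for c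
    using that horizontal_lift_unique[OF _ l, of _ 1] by auto
qed

end

theorem proposition4p16:
  fixes G :: "('g, 'r) monoid_scheme"
    and GM :: "('g, 'eg::findim_inner) manifold"
    and F :: "('f, 'ef::findim_inner) manifold"
    and actF :: "'g \<Rightarrow> 'f \<Rightarrow> 'f"
    and M :: "('m, 'em::findim_inner) manifold"
    and B :: "('b, 'eb::findim_inner) manifold"
    and actB :: "'g \<Rightarrow> 'b \<Rightarrow> 'b"
    and \<pi> :: "'b \<Rightarrow> 'm"
    and \<omega> :: "'b \<Rightarrow> 'eb \<Rightarrow> 'eg"
    and \<gamma> :: "real \<Rightarrow> 'm"
    and b :: 'b
  assumes "semi_principal_bundle G GM F actF M B actB \<pi>"
    and "G_connection G GM B actB \<omega>"
    and "piecewise_smooth_curve M \<gamma>"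
    and "b \<in> points B"
    and "\<pi> b = \<gamma> 0"
  shows "(\<exists>!\<Gamma>. \<Gamma> \<in> extensional {0..1} \<and> horizontal_lift B \<pi> \<omega> \<gamma> b \<Gamma>) \<and>
         (\<forall>g\<in>carrier G.
            parallel_transport B \<pi> \<omega> \<gamma> (actB g b) = actB g (parallel_transport B \<pi> \<omega> \<gamma> b) \<and>
            (\<forall>\<Gamma>. horizontal_lift B \<pi> \<omega> \<gamma> b \<Gamma> \<longrightarrow>
               horizontal_lift B \<pi> \<omega> \<gamma> (actB g b) (\<lambda>t. actB g (\<Gamma> t))))"
proof -
  interpret bundle_connection G GM F actF M B actB \<pi> \<omega>
    by unfold_locales (fact assms(1), fact assms(2))
  obtain \<Gamma>' where "lift_on \<gamma> 0 1 b \<Gamma>'" using lift_on_exists[OF assms(3-5)] by blast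
  hence lift: "horizontal_lift B \<pi> \<omega> \<gamma> b (restrict \<Gamma>' {0..1})"
    by (intro lift_on_imp_horizontal_lift lift_on_restrict) simp_all
  define \<Gamma> where "\<Gamma> = restrict \<Gamma>' {0..1}"
  have \<Gamma>: "\<Gamma> \<in> extensional {0..1}" "horizontal_lift B \<pi> \<omega> \<gamma> b \<Gamma>" using lift by (simp_all add: \<Gamma>_def)
  have "\<exists>!\<Gamma>. \<Gamma> \<in> extensional {0..1} \<and> horizontal_lift B \<pi> \<omega> \<gamma> b \<Gamma>"
  proof (rule ex1I[of _ \<Gamma>])
    fix \<Delta> assume \<Delta>: "\<Delta> \<in> extensional {0..1} \<and> horizontal_lift B \<pi> \<omega> \<gamma> b \<Delta>"
    show "\<Delta> = \<Gamma>"
      by (rule extensionalityI[of _ "{0..1}"]) (use \<Delta> \<Gamma> horizontal_lift_unique in auto)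
  qed (use \<Gamma> in blast)
  moreover have "parallel_transport B \<pi> \<omega> \<gamma> (actB g b) = actB g (parallel_transport B \<pi> \<omega> \<gamma> b)"
    if "g \<in> carrier G" for g
    using parallel_transport_eq[OF \<Gamma>(2)] parallel_transport_eq[OF horizontal_lift_translate[OF \<Gamma>(2) that]]
    by simp
  ultimately show ?thesis using horizontal_lift_translate by blast
qed

end
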